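(* Let $N\ge 1$ and let $M\subset\mathbb{C}^{N+1}$ be a real (formal) submanifold of codimension $2$ given near the point $0\in M$ by the formal power series equation $$w=z_{1}\overline{z}_{1}+\dots+z_{N}\overline{z}_{N}+\sum_{m+n\geq 3}\varphi_{m,n}(z,\overline{z}),$$ where $\varphi_{m,n}(z,\overline{z})$ is a bihomogeneous polynomial of bidegree $(m,n)$ in $(z,\overline{z})$. Write $\varphi_{k,0}(z):=\varphi_{k,0}(z,\overline z)$, and assume that $$\operatorname{Re}\Big\{\sum_{k\geq 3}\varphi_{k,0}(z)\Big\}\not\equiv 0 .$$ Let $s:=\min\{k\ge 3:\ \varphi_{k,0}(z)\not\equiv 0\}<\infty$, and put $\Delta(z):=\varphi_{s,0}(z)$ and $\Delta_{k}(z):=\partial_{z_k}\varphi_{s,0}(z)$ for $k=1,\dots,N$. Assume that the homogeneous polynomial $\Delta$ of degree $s$ is nondegenerate. Then there exists a unique formal map $$(z',w')=\big(F(z,w),G(z,w)\big)=(z,w)+\mathrm{O}(2)$$ that transforms $M$ into the normal form $$w'=z'_{1}\overline{z'}_{1}+\dots+z'_{N}\overline{z'}_{N}+\sum_{m+n\geq 3,\ m,n\neq 0}\varphi'_{m,n}(z',\overline{z'})+2\operatorname{Re}\Big\{\sum_{k\geq s}\varphi'_{k,0}(z')\Big\},$$ where $\varphi'_{m,n}(z',\overline{z'})$ is a bihomogeneous polynomial of bidegree $(m,n)$ in $(z',\overline{z'})$ (and $\varphi'_{k,0}(z')$ is a homogeneous holomorphic polynomial of degree $k$), satisfying the normalization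 conditions $$\begin{cases}\operatorname{tr}^{m-1}\varphi'_{m,n}(z',\overline{z'})=0, & m\leq n-1,\ m,n\neq 0,\\ \operatorname{tr}^{n}\varphi'_{m,n}(z',\overline{z'})=0, & m\geq n,\ m,n\neq 0,\end{cases}$$ and $$\begin{cases}(\Delta^{t})^{\star}\big(\varphi'_{T,0}(z)\big)=0, & \text{if } T=ts+1,\ t\geq 1,\\ (\Delta_{k}\Delta^{t})^{\star}\big(\varphi'_{T,0}(z)\big)=0,\quad k=1,\dots,N, & \text{if } T=(t+1)s,\ t\geq 1.\end{cases}$$
   Context: Coordinates on $\mathbb{C}^{N+1}$ are $(z,w)=(z_1,\dots,z_N,w)$. A formal real submanifold of codimension $2$ is given by an equation $w=\rho(z,\overline z)$ with $\rho$ a formal power series in $(z,\overline z)$ with complex coefficients ($z$ and $\overline z$ being treated as independent variables). Bihomogeneous of bidegree $(m,n)$ means homogeneous of degree $m$ in $z$ and of degree $n$ in $\overline z$. A formal map $(z',w')=(F(z,w),G(z,w))$, with $F$ ($\mathbb{C}^N$-valued) and $G$ ($\mathbb{C}$-valued) formal power series in $(z,w)$ without constant term, transforms $M=\{w=\rho(z,\overline z)\}$ into $M'=\{w'=\rho'(z',\overline{z'})\}$ if $$G(z,\rho(z,\overline z))=\rho'\big(F(z,\rho(z,\overline z)),\overline{F(z,\rho(z,\overline z))}\big)$$ as formal power series in $(z,\overline z)$. Assign normal weights $1$ to each $z_k$ and $2$ to $w$; a formal series $h(z,w)$ without constant term decomposes as $h=\sum_{l\ge1}h_{nor}^{(l)}$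 with $h_{nor}^{(l)}(\tau z,\tau^2w)=\tau^l h_{nor}^{(l)}(z,w)$. The notation $(F,G)=(z,w)+\mathrm{O}(2)$ means that $F(z,w)=z+\sum_{k\ge2}F_{nor}^{(k)}(z,w)$ and $G(z,w)=w+\sum_{k\ge2}G_{nor}^{(k+1)}(z,w)$. The trace operator is $\operatorname{tr}:=\sum_{k=1}^{N}\frac{\partial^{2}}{\partial z_{k}\,\partial\overline{z}_{k}}$, $\operatorname{tr}^j$ is its $j$-th iterate, and $\operatorname{tr}^0$ is the identity. For a homogeneous polynomial $V(z)=\sum_{|I|=k}b_I z^I$, the associated Fischer differential operator is $V^{\star}=\sum_{|I|=k}\overline{b}_I\frac{\partial^{|I|}}{\partial z^I}$. The homogeneous polynomial $\Delta(z)$ is called nondegenerate if for any linear forms $\mathcal{L}_1(z),\dots,\mathcal{L}_N(z)$ one has: $\mathcal{L}_1(z)\Delta_1(z)+\dots+\mathcal{L}_N(z)\Delta_N(z)\equiv 0$ implies $\mathcal{L}_1(z)\equiv\dots\equiv\mathcal{L}_N(z)\equiv 0$, where $\Delta_k=\partial_{z_k}\Delta$.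
   Formalization: The pure terms of M are assumed conjugate, φ_{0,k} = conj(φ_{k,0}) for all k≥3 (always achievable by w→w+g(z), which may change s and Δ); without it the claim fails, e.g. uniqueness for w = z z̄ + z³ with N=1. *)

theory Defs
  imports Complex_Main "HOL-Library.FuncSet" "HOL-Library.Function_Algebras"
begin

section \<open>Formal power series in finitely many variables\<close>

text \<open>
  The variables are the elements of a finite type \<^typ>\<open>'v\<close>; a multi-index is a function
  \<^typ>\<open>'v \<Rightarrow> nat\<close>, with pointwise order and
  addition, and a series is its family of coefficients.
\<close>

typedef 'v mfps = "UNIV :: (('v \<Rightarrow> nat) \<Rightarrow> complex) set"
  morphisms mcoeff Abs_mfps ..

lemma mcoeff_Abs_mfps [simp]: "mcoeff (Abs_mfps f) = f"
  by (simp add: Abs_mfps_inverse)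

lemma mfps_eqI: "(\<And>\<alpha>. mcoeff f \<alpha> = mcoeff g \<alpha>) \<Longrightarrow> f = g"
  by (metis ext mcoeff_inject)

lemma finite_multi_index_atMost: "finite {\<beta> :: 'v::finite \<Rightarrow> nat. \<beta> \<le> \<alpha>}"
proof -
  have "{\<beta> :: 'v \<Rightarrow> nat. \<beta> \<le> \<alpha>} = PiE UNIV (\<lambda>v. {..\<alpha> v})"
    by (auto simp: le_fun_def PiE_def)
  then show ?thesis
    by (simp add: finite_PiE)
qed

lemma finite_multi_index_splits: "finite {(\<beta>, \<gamma>). \<beta> + \<gamma> = (\<alpha> :: 'v::finite \<Rightarrow> nat)}"
proof (rule finite_subset)
  show "{(\<beta>, \<gamma>). \<beta> + \<gamma> = \<alpha>} \<subseteq> {\<beta>. \<beta> \<le> \<alpha>} \<times> {\<gamma>. \<gamma> \<le> \<alpha>}"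
    by (auto simp: le_fun_def)
qed (simp add: finite_multi_index_atMost)

instantiation mfps :: (finite) comm_ring_1
begin

definition zero_mfps :: "'a mfps" where
  "0 = Abs_mfps (\<lambda>\<alpha>. 0)"

definition one_mfps :: "'a mfps" where
  "1 = Abs_mfps (\<lambda>\<alpha>. if \<alpha> = 0 then 1 else 0)"

definition plus_mfps :: "'a mfps \<Rightarrow> 'a mfps \<Rightarrow> 'a mfps" where
  "f + g = Abs_mfps (\<lambda>\<alpha>. mcoeff f \<alpha> + mcoeff g \<alpha>)"

definition uminus_mfps :: "'a mfps \<Rightarrow> 'a mfps" where
  "- f = Abs_mfps (\<lambda>\<alpha>. - mcoeff f \<alpha>)"

definition minus_mfps :: "'a mfps \<Rightarrow> 'a mfps \<Rightarrow> 'a mfps" where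
  "f - g = Abs_mfps (\<lambda>\<alpha>. mcoeff f \<alpha> - mcoeff g \<alpha>)"

definition times_mfps :: "'a mfps \<Rightarrow> 'a mfps \<Rightarrow> 'a mfps" where
  "f * g = Abs_mfps (\<lambda>\<alpha>. \<Sum>(\<beta>, \<gamma>) | \<beta> + \<gamma> = \<alpha>. mcoeff f \<beta> * mcoeff g \<gamma>)"

instance
proof
  fix f g h :: "'a mfps"
  show "f + g + h = f + (g + h)" "f + g = g + f" "0 + f = f" "- f + f = 0" "f - g = f + - g"
    by (auto intro!: mfps_eqI simp: plus_mfps_def zero_mfps_def uminus_mfps_def minus_mfps_def)
  have "mcoeff (0 :: 'a mfps) 0 \<noteq> mcoeff (1 :: 'a mfps) 0"
    by (simp add: one_mfps_def zero_mfps_def)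
  then show "(0 :: 'a mfps) \<noteq> 1"
    by metis
  show "f * g = g * f"
  proof (rule mfps_eqI)
    fix \<alpha>
    show "mcoeff (f * g) \<alpha> = mcoeff (g * f) \<alpha>"
      unfolding times_mfps_def mcoeff_Abs_mfps
      by (rule sum.reindex_bij_witness[of _ prod.swap prod.swap]) (auto simp: add.commute)
  qed
  show "(f + g) * h = f * h + g * h"
    by (rule mfps_eqI)
      (simp add: times_mfps_def plus_mfps_def distrib_right sum.distrib case_prod_unfold)
  show "1 * f = f"
  proof (rule mfps_eqI)
    fix \<alpha>
    have "(\<Sum>(\<beta>, \<gamma>) | \<beta> + \<gamma> = \<alpha>. (if \<beta> = 0 then 1 else 0) * mcoeff f \<gamma>) =
      (\<Sum>(\<beta>, \<gamma>) \<in> {(0 :: 'a \<Rightarrow> nat, \<alpha>)}. (if \<beta> = 0 then 1 else 0) * mcoeff f \<gamma>)"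
      by (rule sum.mono_neutral_right) (auto simp: finite_multi_index_splits split: if_splits)
    then show "mcoeff (1 * f) \<alpha> = mcoeff f \<alpha>"
      by (simp add: times_mfps_def one_mfps_def)
  qed
  show "f * g * h = f * (g * h)"
  proof (rule mfps_eqI)
    fix \<alpha> :: "'a \<Rightarrow> nat"
    let ?S = "\<lambda>\<alpha> :: 'a \<Rightarrow> nat. {(\<beta>, \<gamma>). \<beta> + \<gamma> = \<alpha>}"
    have "mcoeff (f * g * h) \<alpha> =
      (\<Sum>p \<in> ?S \<alpha>. \<Sum>q \<in> ?S (fst p). mcoeff f (fst q) * mcoeff g (snd q) * mcoeff h (snd p))"
      by (simp add: times_mfps_def case_prod_unfold sum_distrib_right)
    also have "\<dots> = (\<Sum>(p, q) \<in> Sigma (?S \<alpha>) (\<lambda>p. ?S (fst p)).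
        mcoeff f (fst q) * mcoeff g (snd q) * mcoeff h (snd p))"
      by (rule sum.Sigma) (use finite_multi_index_splits in \<open>auto simp: case_prod_unfold\<close>)
    also have "\<dots> = (\<Sum>(p, q) \<in> Sigma (?S \<alpha>) (\<lambda>p. ?S (snd p)).
        mcoeff f (fst p) * (mcoeff g (fst q) * mcoeff h (snd q)))"
      by (rule sum.reindex_bij_witness[of _
            "\<lambda>((a, b), (c, d)). ((a + c, d), (a, c))" "\<lambda>((a, b), (c, d)). ((c, d + b), (d, b))"])
        (auto simp: add.assoc mult.assoc)
    also have "\<dots> = (\<Sum>p \<in> ?S \<alpha>. \<Sum>q \<in> ?S (snd p).
        mcoeff f (fst p) * (mcoeff g (fst q) * mcoeff h (snd q)))"
      by (rule sum.Sigma[symmetric])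
        (use finite_multi_index_splits in \<open>auto simp: case_prod_unfold\<close>)
    also have "\<dots> = mcoeff (f * (g * h)) \<alpha>"
      by (simp add: times_mfps_def case_prod_unfold sum_distrib_left)
    finally show "mcoeff (f * g * h) \<alpha> = mcoeff (f * (g * h)) \<alpha>" .
  qed
qed

end

definition mconst :: "complex \<Rightarrow> 'v mfps" where
  "mconst c = Abs_mfps (\<lambda>\<alpha>. if \<alpha> = 0 then c else 0)"

definition mvar :: "'v \<Rightarrow> 'v mfps" where
  "mvar v = Abs_mfps (\<lambda>\<alpha>. if \<alpha> = (0 :: 'v \<Rightarrow> nat)(v := 1) then 1 else 0)"

definition mdeg :: "('v::finite \<Rightarrow> nat) \<Rightarrow> nat" where
  "mdeg \<alpha> = (\<Sum>v\<in>UNIV. \<alpha> v)"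

text \<open>
  Homogeneous polynomials are series supported in a single degree; the zero series is
  homogeneous of every degree.
\<close>

definition homogeneous :: "nat \<Rightarrow> 'v::finite mfps \<Rightarrow> bool" where
  "homogeneous d f \<longleftrightarrow> (\<forall>\<alpha>. mcoeff f \<alpha> \<noteq> 0 \<longrightarrow> mdeg \<alpha> = d)"

text \<open>
  Sum of a locally finite family, i.e. one in which every monomial occurs in only finitely
  many members.
\<close>

definition formal_sum :: "'i set \<Rightarrow> ('i \<Rightarrow> 'v mfps) \<Rightarrow> 'v mfps" where
  "formal_sum I f = Abs_mfps (\<lambda>\<alpha>. \<Sum>i | i \<in> I \<and> mcoeff (f i) \<alpha> \<noteq> 0. mcoeff (f i) \<alpha>)"

text \<open>
  Substitution of \<open>g v\<close> for the variable \<open>v\<close>, for series \<open>g v\<close> without constant term. Then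
  \<open>\<Prod>v. g v ^ \<beta> v\<close> has no terms of degree below \<^term>\<open>mdeg \<beta>\<close>, so only the finitely many \<open>\<beta>\<close> with
  \<^term>\<open>mdeg \<beta> \<le> mdeg \<alpha>\<close> can contribute to the coefficient at \<open>\<alpha>\<close>.
\<close>

definition msubst :: "'u::finite mfps \<Rightarrow> ('u \<Rightarrow> 'v::finite mfps) \<Rightarrow> 'v mfps" where
  "msubst f g = Abs_mfps (\<lambda>\<alpha>. \<Sum>\<beta> | mdeg \<beta> \<le> mdeg \<alpha>.
     mcoeff f \<beta> * mcoeff (\<Prod>v\<in>UNIV. g v ^ \<beta> v) \<alpha>)"

lemma finite_multi_index_mdeg: "finite {\<beta> :: 'v::finite \<Rightarrow> nat. mdeg \<beta> \<le> d}"
proof (rule finite_subset)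
  have "\<beta> v \<le> mdeg \<beta>" for \<beta> :: "'v \<Rightarrow> nat" and v
    unfolding mdeg_def by (rule member_le_sum) auto
  then show "{\<beta> :: 'v \<Rightarrow> nat. mdeg \<beta> \<le> d} \<subseteq> {\<beta>. \<beta> \<le> (\<lambda>v. d)}"
    by (auto simp: le_fun_def intro: order_trans)
qed (rule finite_multi_index_atMost)

definition mderiv :: "'v \<Rightarrow> 'v mfps \<Rightarrow> 'v mfps" where
  "mderiv v f = Abs_mfps (\<lambda>\<alpha>. of_nat (Suc (\<alpha> v)) * mcoeff f (\<alpha>(v := Suc (\<alpha> v))))"

text \<open>The higher partial derivative \<open>\<partial>\<^sup>|\<^sup>I\<^sup>| / \<partial>z\<^sup>I\<close>, in closed form.\<close>

definition mderivs :: "('v::finite \<Rightarrow> nat) \<Rightarrow> 'v mfps \<Rightarrow> 'v mfps" where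
  "mderivs I f = Abs_mfps (\<lambda>\<alpha>. (\<Prod>v\<in>UNIV. fact (\<alpha> v + I v) / fact (\<alpha> v)) * mcoeff f (\<alpha> + I))"

lemma mderivs_0: "mderivs 0 f = f"
  by (rule mfps_eqI) (simp add: mderivs_def)

lemma mderivs_Suc: "mderivs (I(v := Suc (I v))) f = mderiv v (mderivs I f)"
proof (rule mfps_eqI)
  fix \<alpha>
  have eq: "\<alpha> + I(v := Suc (I v)) = \<alpha>(v := Suc (\<alpha> v)) + I"
    by (auto simp: fun_eq_iff)
  have "(\<Prod>u\<in>UNIV. fact (\<alpha> u + (I(v := Suc (I v))) u) / fact (\<alpha> u) :: complex) =
    (\<Prod>u\<in>UNIV. (if u = v then of_nat (Suc (\<alpha> v)) else 1) *
      (fact ((\<alpha>(v := Suc (\<alpha> v))) u + I u) / fact ((\<alpha>(v := Suc (\<alpha> v))) u)))"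
    by (rule prod.cong) (auto simp: field_simps simp del: of_nat_Suc)
  also have "\<dots> = of_nat (Suc (\<alpha> v)) *
      (\<Prod>u\<in>UNIV. fact ((\<alpha>(v := Suc (\<alpha> v))) u + I u) / fact ((\<alpha>(v := Suc (\<alpha> v))) u))"
    by (subst prod.distrib) (simp del: of_nat_Suc fun_upd_apply)
  finally show "mcoeff (mderivs (I(v := Suc (I v))) f) \<alpha> = mcoeff (mderiv v (mderivs I f)) \<alpha>"
    by (simp add: mderivs_def mderiv_def eq del: of_nat_Suc fun_upd_apply)
qed

text \<open>The Fischer differential operator \<open>V\<^sup>\<star>\<close> of a polynomial \<open>V\<close>.\<close>

definition fischer :: "'v::finite mfps \<Rightarrow> 'v mfps \<Rightarrow> 'v mfps" where
  "fischer V f = (\<Sum>I | mcoeff V I \<noteq> 0. mconst (cnj (mcoeff V I)) * mderivs I f)"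

definition nondegenerate :: "'n::finite mfps \<Rightarrow> bool" where
  "nondegenerate D \<longleftrightarrow> (\<forall>L :: 'n \<Rightarrow> 'n mfps.
     (\<forall>k. homogeneous 1 (L k)) \<longrightarrow> (\<Sum>k\<in>UNIV. L k * mderiv k D) = 0 \<longrightarrow> (\<forall>k. L k = 0))"


section \<open>Series in $z$ and $\overline z$\<close>

text \<open>
  With \<^typ>\<open>'n\<close> indexing the coordinates $z_1, \dots, z_N$, a series in $(z, \overline z)$ has variables
  \<^typ>\<open>'n + 'n\<close>: \<^term>\<open>Inl k\<close> stands for $z_k$ and \<^term>\<open>Inr k\<close> for $\overline z_k$.
\<close>

definition bihomogeneous :: "nat \<Rightarrow> nat \<Rightarrow> ('n::finite + 'n) mfps \<Rightarrow> bool" where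
  "bihomogeneous m n f \<longleftrightarrow>
     (\<forall>\<alpha>. mcoeff f \<alpha> \<noteq> 0 \<longrightarrow> (\<Sum>k\<in>UNIV. \<alpha> (Inl k)) = m \<and> (\<Sum>k\<in>UNIV. \<alpha> (Inr k)) = n)"

text \<open>
  Complex conjugation of a series in $(z, \overline z)$: coefficients are conjugated, and the variables
  $z_k$ and $\overline z_k$ exchanged.
\<close>

definition mbar :: "('n + 'n) mfps \<Rightarrow> ('n + 'n) mfps" where
  "mbar f = Abs_mfps (\<lambda>\<alpha>. cnj (mcoeff f (\<alpha> \<circ> case_sum Inr Inl)))"

definition mRe :: "('n::finite + 'n) mfps \<Rightarrow> ('n + 'n) mfps" where
  "mRe f = mconst (1 / 2) * (f + mbar f)"

text \<open>A series in $z$, read as a series in $(z, \overline z)$.\<close>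

definition of_hol :: "'n::finite mfps \<Rightarrow> ('n + 'n) mfps" where
  "of_hol f = msubst f (\<lambda>k. mvar (Inl k))"

text \<open>
  The series in $z$ obtained by putting $\overline z = 0$; on series not involving $\overline z$ this
  inverts \<^const>\<open>of_hol\<close>.
\<close>

definition to_hol :: "('n + 'n) mfps \<Rightarrow> 'n mfps" where
  "to_hol f = Abs_mfps (\<lambda>\<alpha>. mcoeff f (case_sum \<alpha> (\<lambda>_. 0)))"

definition trace_op :: "('n::finite + 'n) mfps \<Rightarrow> ('n + 'n) mfps" where
  "trace_op f = (\<Sum>k\<in>UNIV. mderiv (Inl k) (mderiv (Inr k) f))"

definition quadric :: "('n::finite + 'n) mfps" where
  "quadric = (\<Sum>k\<in>UNIV. mvar (Inl k) * mvar (Inr k))"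


section \<open>Formal maps\<close>

text \<open>
  A series in $(z, w)$ has variables \<^typ>\<open>'n option\<close>: \<^term>\<open>Some k\<close> stands for $z_k$ and
  \<^term>\<open>None\<close> for $w$. Restriction to $w = \rho(z, \overline z)$ is the following substitution.
\<close>

definition restrict_to :: "('n::finite + 'n) mfps \<Rightarrow> 'n option mfps \<Rightarrow> ('n + 'n) mfps" where
  "restrict_to \<rho> h = msubst h (case_option \<rho> (\<lambda>k. mvar (Inl k)))"

definition formal_map :: "('n \<Rightarrow> 'n option mfps) \<Rightarrow> 'n option mfps \<Rightarrow> bool" where
  "formal_map F G \<longleftrightarrow> (\<forall>k. mcoeff (F k) 0 = 0) \<and> mcoeff G 0 = 0"

text \<open>\<open>(z', w') = (F, G)\<close> transforms $w = \rho(z, \overline z)$ into $w' = \rho'(z', \overline{z'})$.\<close>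

definition transforms ::
  "('n::finite \<Rightarrow> 'n option mfps) \<Rightarrow> 'n option mfps \<Rightarrow> ('n + 'n) mfps \<Rightarrow> ('n + 'n) mfps \<Rightarrow> bool" where
  "transforms F G \<rho> \<rho>' \<longleftrightarrow>
     restrict_to \<rho> G =
       msubst \<rho>' (case_sum (\<lambda>k. restrict_to \<rho> (F k)) (\<lambda>k. mbar (restrict_to \<rho> (F k))))"

text \<open>The component $h_{nor}^{(l)}$ of normal weight $l$, with weights $1$ for $z_k$ and $2$ for $w$.\<close>

definition nor_part :: "nat \<Rightarrow> 'n::finite option mfps \<Rightarrow> 'n option mfps" where
  "nor_part l h =
     Abs_mfps (\<lambda>\<alpha>. if (\<Sum>k\<in>UNIV. \<alpha> (Some k)) + 2 * \<alpha> None = l then mcoeff h \<alpha> else 0)"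

text \<open>$(F, G) = (z, w) + \mathrm{O}(2)$.\<close>

definition id_plus_O2 :: "('n::finite \<Rightarrow> 'n option mfps) \<Rightarrow> 'n option mfps \<Rightarrow> bool" where
  "id_plus_O2 F G \<longleftrightarrow>
     (\<forall>j. F j = mvar (Some j) + formal_sum {2..} (\<lambda>k. nor_part k (F j))) \<and>
     G = mvar None + formal_sum {2..} (\<lambda>k. nor_part (k + 1) G)"

end

theory Submission
  imports Defs
begin

text \<open>
  Let \<open>Q\<close> be the quadric, \<open>\<Delta>\<close> the lowest pure term, of degree \<open>s\<close>, and $u = Q + \Delta + \overline\Delta$. Give
  $(z, \overline z)$ the weights $(1, s - 1)$ or $(s - 1, 1)$, and \<open>w\<close> the weight \<open>s\<close>. In both gradings \<open>u\<close> has
  order \<open>s\<close> and \<open>\<rho> - u\<close> has order at least \<open>s + 1\<close>, so \<open>w = u\<close> is a model of the given manifold. Call the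
  smaller of the two orders the level.

  Write \<open>F = z + f\<close> and \<open>G = w + g\<close>, and write the normal form as \<open>u + r\<close>. An increment of \<open>(f, g, r)\<close> of level
  \<open>W \<ge> s + 1\<close> changes the error of the equation, up to terms of level \<open>W + 1\<close>, by the linearized
  operator of the model,
  \[ L(f, g, r) = g|_{w = u} - 2 \mathrm{Re} \sum_k (\overline z_k + \Delta_k) f_k|_{w = u} - r \]
  (lemma \<open>E_expansion\<close>). If \<open>L\<close>, restricted to normalized \<open>r\<close>, is bijective at each level to leading order
  (lemmas \<open>linearization_surjective\<close> and \<open>linearization_injective\<close>), then the equation can be solved level
  by level, and in only one way (\<open>solution_exists\<close>, \<open>solution_unique\<close>). The terms of level at most \<open>s\<close> are
  determined by the equation itself (\<open>low_levels\<close>).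

  The bijectivity of \<open>L\<close> has two sources. Consider first the unknowns in which \<open>f\<close> has degree at least
  2 in \<open>z\<close> and \<open>r\<close> has only mixed terms. In lowest total degree \<open>L\<close> acts on them as it does for the quadric,
  $g|_{w = Q} - 2 \mathrm{Re} \sum_k \overline z_k f_k|_{w = Q} - r$. There the orthogonal decomposition of polynomials into
  multiples of $Q^j$ and polynomials annihilated by $\mathrm{tr}^j$ determines \<open>g\<close> from the bidegrees \<open>(m, n)\<close> with
  \<open>m \<ge> n\<close>, and \<open>f\<close> from those with \<open>m < n\<close>. By induction on the total degree these unknowns reach every
  series up to an antiholomorphic polynomial (\<open>Im0_pure_all\<close>), and \<open>L\<close> is injective on them
  (\<open>linearization_injective0\<close>).

  There remain the pure terms of \<open>r\<close> and the parameters of degree at most 1 in \<open>z\<close>: the field $a w^t$ at the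
  level \<open>t * s + 1\<close> and the field $A z w^t$ at the level \<open>(t + 1) * s\<close>. The key relation is that radial fields trade
  a factor \<open>u\<close> in an antiholomorphic multiple for $(1 - s) \overline\Delta$ (\<open>Im0_radial\<close>). It shows that the parameters
  act as the conjugates of $(1 - s)^t \langle z, \overline a \rangle \Delta^t$ and $(\sum_k \Delta_k (M z)_k) \Delta^t$, where \<open>M\<close> is the
  image of \<open>A\<close> under an invertible real-linear map (\<open>Im0_vector_parameter\<close>, \<open>Im0_matrix_parameter\<close>). These
  polynomials span precisely the orthogonal complement of the solutions of the Fischer conditions, and by
  nondegeneracy they determine \<open>a\<close> and \<open>A\<close>.
\<close>

section \<open>Coefficients\<close>

lemma mcoeff_0 [simp]: "mcoeff 0 \<alpha> = 0"
  by (simp add: zero_mfps_def)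

lemma mcoeff_1: "mcoeff 1 \<alpha> = (if \<alpha> = 0 then 1 else 0)"
  by (simp add: one_mfps_def)

lemma mcoeff_add [simp]: "mcoeff (f + g) \<alpha> = mcoeff f \<alpha> + mcoeff g \<alpha>"
  by (simp add: plus_mfps_def)

lemma mcoeff_uminus [simp]: "mcoeff (- f) \<alpha> = - mcoeff f \<alpha>"
  by (simp add: uminus_mfps_def)

lemma mcoeff_diff [simp]: "mcoeff (f - g) \<alpha> = mcoeff f \<alpha> - mcoeff g \<alpha>"
  by (simp add: minus_mfps_def)

lemma mcoeff_sum [simp]: "mcoeff (\<Sum>i\<in>A. f i) \<alpha> = (\<Sum>i\<in>A. mcoeff (f i) \<alpha>)"
  by (induction A rule: infinite_finite_induct) auto

lemma mcoeff_mult: "mcoeff (f * g) \<alpha> = (\<Sum>(\<beta>, \<gamma>) | \<beta> + \<gamma> = \<alpha>. mcoeff f \<beta> * mcoeff g \<gamma>)"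
  by (simp add: times_mfps_def)

lemma mcoeff_mconst: "mcoeff (mconst c) \<alpha> = (if \<alpha> = 0 then c else 0)"
  by (simp add: mconst_def)

lemma mcoeff_mvar: "mcoeff (mvar v) \<alpha> = (if \<alpha> = (0 :: 'v \<Rightarrow> nat)(v := 1) then 1 else 0)"
  for v :: 'v
  by (simp add: mvar_def)

lemma mcoeff_mult_nonzeroE:
  assumes "mcoeff (f * g) \<alpha> \<noteq> 0"
  obtains \<beta> \<gamma> where "\<alpha> = \<beta> + \<gamma>" "mcoeff f \<beta> \<noteq> 0" "mcoeff g \<gamma> \<noteq> 0"
proof -
  have "(\<Sum>(\<beta>, \<gamma>) | \<beta> + \<gamma> = \<alpha>. mcoeff f \<beta> * mcoeff g \<gamma>) \<noteq> 0"
    using assms by (simp add: mcoeff_mult)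
  then obtain x where "x \<in> {(\<beta>, \<gamma>). \<beta> + \<gamma> = \<alpha>}" "(case x of (\<beta>, \<gamma>) \<Rightarrow> mcoeff f \<beta> * mcoeff g \<gamma>) \<noteq> 0"
    by (rule sum.not_neutral_contains_not_neutral)
  then show ?thesis
    by (auto intro: that)
qed

lemma mcoeff_mconst_mult [simp]: "mcoeff (mconst c * f) \<alpha> = c * mcoeff f \<alpha>"
proof -
  have "(\<Sum>(\<beta>, \<gamma>) | \<beta> + \<gamma> = \<alpha>. mcoeff (mconst c) \<beta> * mcoeff f \<gamma>) =
    (\<Sum>(\<beta>, \<gamma>) \<in> {(0 :: 'a \<Rightarrow> nat, \<alpha>)}. mcoeff (mconst c) \<beta> * mcoeff f \<gamma>)"
    by (rule sum.mono_neutral_right)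
      (auto simp: finite_multi_index_splits mcoeff_mconst split: if_splits)
  then show ?thesis
    by (simp add: mcoeff_mult mcoeff_mconst)
qed

lemma mconst_0 [simp]: "mconst 0 = 0"
  by (rule mfps_eqI) (simp add: mcoeff_mconst)

lemma mconst_1 [simp]: "mconst 1 = 1"
  by (rule mfps_eqI) (simp add: mcoeff_mconst mcoeff_1)

lemma mconst_add: "mconst (a + b) = mconst a + mconst b"
  by (rule mfps_eqI) (simp add: mcoeff_mconst)

lemma mconst_uminus: "mconst (- a) = - mconst a"
  by (rule mfps_eqI) (simp add: mcoeff_mconst)

lemma mconst_diff: "mconst (a - b) = mconst a - mconst b"
  by (rule mfps_eqI) (simp add: mcoeff_mconst)

lemma mconst_mult: "mconst (a * b) = mconst a * (mconst b :: 'v::finite mfps)"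
  by (rule mfps_eqI) (simp add: mcoeff_mconst)

lemma mconst_power: "mconst (a ^ n) = (mconst a ^ n :: 'v::finite mfps)"
  by (induction n) (auto simp: mconst_mult)

lemma mconst_of_nat: "mconst (of_nat n) = (of_nat n :: 'v::finite mfps)"
  by (induction n) (auto simp: mconst_add)

lemma mconst_sum: "mconst (\<Sum>i\<in>A. f i) = (\<Sum>i\<in>A. mconst (f i))"
  by (induction A rule: infinite_finite_induct) (auto simp: mconst_add)

lemma mult_mconst_left_commute: "f * (mconst c * g) = mconst c * (f * g :: 'v::finite mfps)"
  by (simp add: ac_simps)

lemma mcoeff_mvar_mult:
  "mcoeff (mvar v * f) \<alpha> = (if \<alpha> v = 0 then 0 else mcoeff f (\<alpha>(v := \<alpha> v - 1)))"
proof (cases "\<alpha> v = 0")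
  case True
  have "mcoeff (mvar v * f) \<alpha> = 0"
  proof (rule ccontr)
    assume "mcoeff (mvar v * f) \<alpha> \<noteq> 0"
    then obtain \<beta> \<gamma> where "\<alpha> = \<beta> + \<gamma>" "mcoeff (mvar v) \<beta> \<noteq> 0"
      by (rule mcoeff_mult_nonzeroE)
    then show False
      using True by (auto simp: mcoeff_mvar split: if_splits)
  qed
  then show ?thesis
    using True by simp
next
  case False
  have eq: "(\<lambda>a. if a = v then Suc 0 else 0) = (0 :: 'a \<Rightarrow> nat)(v := 1)"
    by (auto simp: fun_eq_iff)
  have "(\<Sum>(\<beta>, \<gamma>) | \<beta> + \<gamma> = \<alpha>. mcoeff (mvar v) \<beta> * mcoeff f \<gamma>) =
    (\<Sum>(\<beta>, \<gamma>) \<in> {((0 :: 'a \<Rightarrow> nat)(v := 1), \<alpha>(v := \<alpha> v - 1))}. mcoeff (mvar v) \<beta> * mcoeff f \<gamma>)"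
  proof (rule sum.mono_neutral_right)
    show "{((0 :: 'a \<Rightarrow> nat)(v := 1), \<alpha>(v := \<alpha> v - 1))} \<subseteq> {(\<beta>, \<gamma>). \<beta> + \<gamma> = \<alpha>}"
      using False by (auto simp: fun_eq_iff)
    have "mcoeff (mvar v) a * mcoeff f b = 0"
      if "a + b = \<alpha>" and ne: "(a, b) \<noteq> ((0 :: 'a \<Rightarrow> nat)(v := 1), \<alpha>(v := \<alpha> v - 1))" for a b
    proof -
      have "a \<noteq> (0 :: 'a \<Rightarrow> nat)(v := 1)"
      proof
        assume a: "a = (0 :: 'a \<Rightarrow> nat)(v := 1)"
        have "b = \<alpha>(v := \<alpha> v - 1)"
          by (auto simp: a fun_eq_iff simp flip: that(1))
        then show False using a ne by auto
      qed
      then show "mcoeff (mvar v) a * mcoeff f b = 0"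
        by (simp add: mcoeff_mvar)
    qed
    then show "\<forall>i\<in>{(\<beta>, \<gamma>). \<beta> + \<gamma> = \<alpha>} - {((0 :: 'a \<Rightarrow> nat)(v := 1), \<alpha>(v := \<alpha> v - 1))}.
      (case i of (\<beta>, \<gamma>) \<Rightarrow> mcoeff (mvar v) \<beta> * mcoeff f \<gamma>) = 0"
      by (intro ballI, elim DiffE CollectE case_prodE) (simp del: fun_upd_apply)
  qed (rule finite_multi_index_splits)
  also have "\<dots> = mcoeff f (\<alpha>(v := \<alpha> v - 1))"
    by (simp add: mcoeff_mvar)
  finally show ?thesis
    using False by (simp add: mcoeff_mult)
qed


section \<open>Orders of vanishing\<close>

text \<open>
  \<open>lev\<close> is an arbitrary level function on multi-indices, and the series all of whose monomials
  have level at least \<open>W\<close> form the \<open>W\<close>-th step of a filtration. Levels that are not weighted degrees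
  occur below as well: minima of two weighted degrees, and the levels \<open>levF\<close>, \<open>levG\<close> of the unknowns.
\<close>

definition vge :: "(('v \<Rightarrow> nat) \<Rightarrow> nat) \<Rightarrow> nat \<Rightarrow> 'v mfps \<Rightarrow> bool" where
  "vge lev W f \<longleftrightarrow> (\<forall>\<alpha>. mcoeff f \<alpha> \<noteq> 0 \<longrightarrow> W \<le> lev \<alpha>)"

definition wt :: "('v \<Rightarrow> nat) \<Rightarrow> ('v::finite \<Rightarrow> nat) \<Rightarrow> nat" where
  "wt \<omega> \<alpha> = (\<Sum>v\<in>UNIV. \<omega> v * \<alpha> v)"

lemma vgeD: "vge lev W f \<Longrightarrow> lev \<alpha> < W \<Longrightarrow> mcoeff f \<alpha> = 0"
  by (force simp: vge_def)

lemma vge_0 [simp]: "vge lev W 0"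
  by (simp add: vge_def)

lemma vge_le0 [simp]: "vge lev 0 f"
  by (simp add: vge_def)

lemma vge_mono: "vge lev W f \<Longrightarrow> V \<le> W \<Longrightarrow> vge lev V f"
  by (force simp: vge_def)

lemma vge_add: "vge lev W f \<Longrightarrow> vge lev W g \<Longrightarrow> vge lev W (f + g)"
  unfolding vge_def by (metis add.right_neutral mcoeff_add)

lemma vge_uminus_iff [simp]: "vge lev W (- f) \<longleftrightarrow> vge lev W f"
  by (simp add: vge_def)

lemma vge_diff: "vge lev W f \<Longrightarrow> vge lev W g \<Longrightarrow> vge lev W (f - g)"
  unfolding vge_def by (metis diff_self eq_iff_diff_eq_0 mcoeff_diff)

lemma vge_sum: "(\<And>i. i \<in> A \<Longrightarrow> vge lev W (f i)) \<Longrightarrow> vge lev W (\<Sum>i\<in>A. f i)"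
  by (induction A rule: infinite_finite_induct) (auto intro: vge_add)

lemma vge_all_imp_0: "(\<And>W. vge lev W f) \<Longrightarrow> f = 0"
  by (rule mfps_eqI) (metis mcoeff_0 vgeD lessI)

lemma wt_add [simp]: "wt \<omega> (\<alpha> + \<beta>) = wt \<omega> \<alpha> + wt \<omega> \<beta>"
  by (simp add: wt_def distrib_left sum.distrib)

lemma wt_0 [simp]: "wt \<omega> 0 = 0"
  by (simp add: wt_def)

lemma mdeg_eq_wt: "mdeg = wt (\<lambda>_. 1)"
  by (simp add: mdeg_def wt_def fun_eq_iff)

lemma mdeg_0 [simp]: "mdeg 0 = 0"
  by (simp add: mdeg_eq_wt)

lemma mdeg_add [simp]: "mdeg (\<alpha> + \<beta>) = mdeg \<alpha> + mdeg \<beta>"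
  by (simp add: mdeg_eq_wt)

lemma wt_single [simp]: "wt \<omega> ((0 :: 'v::finite \<Rightarrow> nat)(v := n)) = \<omega> v * n"
proof -
  have "wt \<omega> (0(v := n)) = (\<Sum>x\<in>UNIV. if x = v then \<omega> v * n else 0)"
    unfolding wt_def by (rule sum.cong) auto
  then show ?thesis by simp
qed

lemma vge_mult: "vge (wt \<omega>) a f \<Longrightarrow> vge (wt \<omega>) b g \<Longrightarrow> vge (wt \<omega>) (a + b) (f * g)"
  unfolding vge_def by (metis (no_types, lifting) mcoeff_mult_nonzeroE wt_add add_mono)

lemma vge_mult': "vge (wt \<omega>) a f \<Longrightarrow> vge (wt \<omega>) b g \<Longrightarrow> c \<le> a + b \<Longrightarrow> vge (wt \<omega>) c (f * g)"
  using vge_mono vge_mult by blast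

lemma vge_power: "vge (wt \<omega>) a f \<Longrightarrow> vge (wt \<omega>) (n * a) (f ^ n)"
  by (induction n) (auto intro: vge_mult)

lemma vge_prod:
  "(\<And>i. i \<in> A \<Longrightarrow> vge (wt \<omega>) (a i) (f i)) \<Longrightarrow> vge (wt \<omega>) (\<Sum>i\<in>A. a i) (\<Prod>i\<in>A. f i)"
  by (induction A rule: infinite_finite_induct) (auto intro: vge_mult)

lemma vge_mconst_mult: "vge lev W f \<Longrightarrow> vge lev W (mconst c * f)"
  by (auto simp: vge_def)

lemma vge_mvar: "vge (wt \<omega>) (\<omega> v) (mvar v)"
  by (auto simp: vge_def mcoeff_mvar split: if_splits)

lemma vge_min: "vge (\<lambda>\<alpha>. min (l1 \<alpha>) (l2 \<alpha>)) W f \<longleftrightarrow> vge l1 W f \<and> vge l2 W f"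
  by (auto simp: vge_def)


section \<open>Substitution\<close>

definition mpow :: "('u::finite \<Rightarrow> 'v::finite mfps) \<Rightarrow> ('u \<Rightarrow> nat) \<Rightarrow> 'v mfps" where
  "mpow g \<beta> = (\<Prod>v\<in>UNIV. g v ^ \<beta> v)"

lemma mcoeff_msubst:
  "mcoeff (msubst f g) \<alpha> = (\<Sum>\<beta> | mdeg \<beta> \<le> mdeg \<alpha>. mcoeff f \<beta> * mcoeff (mpow g \<beta>) \<alpha>)"
  by (simp add: msubst_def mpow_def)

lemma mpow_0 [simp]: "mpow g 0 = 1"
  by (simp add: mpow_def)

lemma mpow_add: "mpow g (\<beta> + \<gamma>) = mpow g \<beta> * mpow g \<gamma>"
  by (simp add: mpow_def power_add prod.distrib)

lemma mpow_single [simp]: "mpow g ((0 :: 'u::finite \<Rightarrow> nat)(v := n)) = g v ^ n"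
proof -
  have "mpow g (0(v := n)) = (\<Prod>x\<in>UNIV. if x = v then g v ^ n else 1)"
    unfolding mpow_def by (rule prod.cong) auto
  then show ?thesis by simp
qed

lemma vge_mpow:
  assumes "\<And>v. vge (wt \<omega>) (\<eta> v) (g v)"
  shows "vge (wt \<omega>) (wt \<eta> \<beta>) (mpow g \<beta>)"
  unfolding mpow_def wt_def[of \<eta>]
  by (rule vge_prod) (metis assms vge_power mult.commute)

lemma vge_msubst:
  assumes "\<And>v. vge (wt \<omega>) (\<eta> v) (g v)" "vge (wt \<eta>) a f"
  shows "vge (wt \<omega>) a (msubst f g)"
  unfolding vge_def
proof (intro allI impI)
  fix \<alpha> assume "mcoeff (msubst f g) \<alpha> \<noteq> 0"
  then obtain \<beta> where "mcoeff f \<beta> \<noteq> 0" "mcoeff (mpow g \<beta>) \<alpha> \<noteq> 0"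
    unfolding mcoeff_msubst by (metis (no_types, lifting) mult_eq_0_iff sum.neutral)
  then show "a \<le> wt \<omega> \<alpha>"
    using assms vge_mpow[of \<omega> \<eta> g \<beta>] unfolding vge_def by (meson order_trans)
qed

lemma msubst_add: "msubst (f + h) g = msubst f g + msubst h g"
  by (rule mfps_eqI) (simp add: mcoeff_msubst distrib_right sum.distrib)

lemma msubst_uminus: "msubst (- f) g = - msubst f g"
  by (rule mfps_eqI) (simp add: mcoeff_msubst sum_negf)

lemma msubst_0 [simp]: "msubst 0 g = 0"
  by (rule mfps_eqI) (simp add: mcoeff_msubst)

lemma msubst_sum: "msubst (\<Sum>i\<in>A. f i) g = (\<Sum>i\<in>A. msubst (f i) g)"
  by (induction A rule: infinite_finite_induct) (auto simp: msubst_add)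

lemma vge_1_iff: "vge (wt (\<lambda>_. 1)) 1 f \<longleftrightarrow> mcoeff f 0 = 0"
proof
  assume "vge (wt (\<lambda>_. 1)) 1 f"
  then show "mcoeff f 0 = 0" by (rule vgeD) simp
next
  assume *: "mcoeff f 0 = 0"
  show "vge (wt (\<lambda>_. 1)) 1 f"
    unfolding vge_def
  proof (intro allI impI)
    fix \<alpha> assume "mcoeff f \<alpha> \<noteq> 0"
    then have "\<alpha> \<noteq> 0" using * by auto
    then obtain v where "\<alpha> v \<noteq> 0" by (auto simp: fun_eq_iff)
    then have "(\<Sum>v\<in>UNIV. \<alpha> v) \<noteq> 0" by (meson UNIV_I finite_UNIV sum_eq_0_iff)
    then show "1 \<le> wt (\<lambda>_. 1) \<alpha>" unfolding wt_def mult_1 by linarith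
  qed
qed

text \<open>
  Any finite set of multi-indices that covers the relevant part of the support may replace the
  truncation in the definition of substitution.
\<close>

lemma mcoeff_msubst_finite:
  assumes "\<And>v. mcoeff (g v) 0 = 0" "finite B" "{\<beta>. mdeg \<beta> \<le> mdeg \<alpha> \<and> mcoeff f \<beta> \<noteq> 0} \<subseteq> B"
  shows "mcoeff (msubst f g) \<alpha> = (\<Sum>\<beta>\<in>B. mcoeff f \<beta> * mcoeff (mpow g \<beta>) \<alpha>)"
proof -
  have zero: "mcoeff (mpow g \<beta>) \<alpha> = 0" if "\<not> mdeg \<beta> \<le> mdeg \<alpha>" for \<beta>
    using vge_mpow[of "\<lambda>_. 1" "\<lambda>_. 1" g \<beta>] assms(1) that
    by (intro vgeD[of "wt (\<lambda>_. 1)" "wt (\<lambda>_. 1) \<beta>"]) (auto simp: mdeg_eq_wt vge_1_iff[unfolded One_nat_def])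
  have "mcoeff (msubst f g) \<alpha> =
      (\<Sum>\<beta> | mdeg \<beta> \<le> mdeg \<alpha> \<and> mcoeff f \<beta> \<noteq> 0. mcoeff f \<beta> * mcoeff (mpow g \<beta>) \<alpha>)"
    unfolding mcoeff_msubst
    by (rule sum.mono_neutral_right) (auto simp: finite_multi_index_mdeg)
  also have "\<dots> = (\<Sum>\<beta>\<in>B. mcoeff f \<beta> * mcoeff (mpow g \<beta>) \<alpha>)"
    by (rule sum.mono_neutral_left) (use assms zero in auto)
  finally show ?thesis .
qed

lemma msubst_finite:
  assumes "\<And>v. mcoeff (g v) 0 = 0" "finite B" "{\<beta>. mcoeff f \<beta> \<noteq> 0} \<subseteq> B"
  shows "msubst f g = (\<Sum>\<beta>\<in>B. mconst (mcoeff f \<beta>) * mpow g \<beta>)"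
  by (rule mfps_eqI, subst mcoeff_msubst_finite[OF assms(1,2)]) (use assms(3) in auto)

lemma msubst_mvar:
  assumes "\<And>v. mcoeff (g v) 0 = 0"
  shows "msubst (mvar v) g = g v"
  by (subst msubst_finite[OF assms, of "{0(v := 1)}"]) (auto simp: mcoeff_mvar split: if_splits)

lemma msubst_mult:
  fixes f :: "'a::finite mfps"
  assumes "\<And>v. mcoeff (g v) 0 = 0"
  shows "msubst (f * h) g = msubst f g * (msubst h g :: 'b::finite mfps)"
proof (rule mfps_eqI)
  fix \<alpha> :: "'b \<Rightarrow> nat"
  let ?d = "mdeg \<alpha>"
  let ?B = "{\<beta> :: 'a \<Rightarrow> nat. mdeg \<beta> \<le> ?d}"
  let ?S = "\<lambda>\<beta>. {(\<beta>1, \<beta>2). \<beta>1 + \<beta>2 = \<beta>}"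
  let ?t = "\<lambda>\<beta>1 \<beta>2. mcoeff f \<beta>1 * mcoeff h \<beta>2 * mcoeff (mpow g (\<beta>1 + \<beta>2)) \<alpha>"
  have zero: "mcoeff (mpow g \<beta>) \<alpha> = 0" if "\<not> mdeg \<beta> \<le> mdeg \<alpha>" for \<beta>
    using vge_mpow[of "\<lambda>_. 1" "\<lambda>_. 1" g \<beta>] assms(1) that
    by (intro vgeD[of "wt (\<lambda>_. 1)" "wt (\<lambda>_. 1) \<beta>"]) (auto simp: mdeg_eq_wt vge_1_iff[unfolded One_nat_def])
  have "mcoeff (msubst (f * h) g) \<alpha> = (\<Sum>\<beta>\<in>?B. \<Sum>p\<in>?S \<beta>. ?t (fst p) (snd p))"
    unfolding mcoeff_msubst mcoeff_mult sum_distrib_right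
    by (intro sum.cong) (auto simp: case_prod_unfold)
  also have "\<dots> = (\<Sum>(\<beta>, p)\<in>Sigma ?B ?S. ?t (fst p) (snd p))"
    by (rule sum.Sigma) (auto simp: finite_multi_index_mdeg finite_multi_index_splits)
  also have "\<dots> = (\<Sum>(\<beta>1, \<beta>2) | mdeg (\<beta>1 + \<beta>2) \<le> ?d. ?t \<beta>1 \<beta>2)"
    by (rule sum.reindex_bij_witness[of _ "\<lambda>(\<beta>1, \<beta>2). (\<beta>1 + \<beta>2, (\<beta>1, \<beta>2))" snd]) auto
  also have "\<dots> = (\<Sum>(\<beta>1, \<beta>2) \<in> ?B \<times> ?B. ?t \<beta>1 \<beta>2)"
  proof (rule sum.mono_neutral_left)
    show "{(\<beta>1, \<beta>2). mdeg (\<beta>1 + \<beta>2) \<le> mdeg \<alpha>} \<subseteq> ?B \<times> ?B"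
      by (auto simp: mdeg_eq_wt)
    show "\<forall>i\<in>?B \<times> ?B - {(\<beta>1, \<beta>2). mdeg (\<beta>1 + \<beta>2) \<le> mdeg \<alpha>}. (case i of (\<beta>1, \<beta>2) \<Rightarrow> ?t \<beta>1 \<beta>2) = 0"
      using zero by clarsimp (metis mdeg_add)
  qed (simp add: finite_multi_index_mdeg)
  finally have lhs: "mcoeff (msubst (f * h) g) \<alpha> = (\<Sum>(\<beta>1, \<beta>2) \<in> ?B \<times> ?B. ?t \<beta>1 \<beta>2)" .
  have "mcoeff (msubst f g * msubst h g) \<alpha> =
      (\<Sum>p\<in>?S \<alpha>. (\<Sum>\<beta>1\<in>?B. mcoeff f \<beta>1 * mcoeff (mpow g \<beta>1) (fst p)) *
        (\<Sum>\<beta>2\<in>?B. mcoeff h \<beta>2 * mcoeff (mpow g \<beta>2) (snd p)))"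
    unfolding mcoeff_mult case_prod_unfold
  proof (rule sum.cong[OF refl], goal_cases)
    case (1 p)
    then have "mdeg (fst p) \<le> ?d" "mdeg (snd p) \<le> ?d"
      by (auto simp: mdeg_eq_wt case_prod_unfold)
    then show ?case
      using assms by (subst (1 2) mcoeff_msubst_finite[where B = ?B]) (auto simp: finite_multi_index_mdeg)
  qed
  also have "\<dots> = (\<Sum>p\<in>?S \<alpha>. \<Sum>(\<beta>1, \<beta>2) \<in> ?B \<times> ?B. mcoeff f \<beta>1 * mcoeff h \<beta>2 *
        (mcoeff (mpow g \<beta>1) (fst p) * mcoeff (mpow g \<beta>2) (snd p)))"
    unfolding sum_product sum.cartesian_product by (simp add: ac_simps case_prod_unfold)
  also have "\<dots> = (\<Sum>(\<beta>1, \<beta>2) \<in> ?B \<times> ?B. \<Sum>p\<in>?S \<alpha>. mcoeff f \<beta>1 * mcoeff h \<beta>2 *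
        (mcoeff (mpow g \<beta>1) (fst p) * mcoeff (mpow g \<beta>2) (snd p)))"
    unfolding case_prod_unfold by (rule sum.swap)
  also have "\<dots> = (\<Sum>(\<beta>1, \<beta>2) \<in> ?B \<times> ?B. ?t \<beta>1 \<beta>2)"
    by (intro sum.cong) (auto simp: mpow_add mcoeff_mult case_prod_unfold sum_distrib_left)
  finally show "mcoeff (msubst (f * h) g) \<alpha> = mcoeff (msubst f g * msubst h g) \<alpha>"
    using lhs by simp
qed

lemma msubst_1: "msubst 1 g = 1"
proof (rule mfps_eqI)
  fix \<alpha>
  have "mcoeff (msubst 1 g) \<alpha> = (\<Sum>\<beta>\<in>{0}. mcoeff 1 \<beta> * mcoeff (mpow g \<beta>) \<alpha>)"
    unfolding mcoeff_msubst
    by (rule sum.mono_neutral_right) (auto simp: finite_multi_index_mdeg mcoeff_1 split: if_splits)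
  then show "mcoeff (msubst 1 g) \<alpha> = mcoeff 1 \<alpha>"
    by (simp add: mcoeff_1)
qed

lemma msubst_power:
  "(\<And>v. mcoeff (g v) 0 = 0) \<Longrightarrow> msubst (f ^ n) g = msubst f g ^ n"
  by (induction n) (auto simp: msubst_1 msubst_mult)

lemma msubst_mconst_mult: "msubst (mconst c * f) g = mconst c * msubst f g"
  by (rule mfps_eqI) (simp add: mcoeff_msubst sum_distrib_left mult.assoc)


subsection \<open>Perturbing the substituted series\<close>

lemma vge_power_diff:
  assumes "vge (wt \<omega>) e g" "vge (wt \<omega>) e h" "vge (wt \<omega>) (e + c) (h - g)"
  shows "vge (wt \<omega>) (n * e + c) (h ^ n - g ^ n)"
proof (induction n)
  case (Suc n)
  have "h ^ Suc n - g ^ Suc n = h * (h ^ n - g ^ n) + (h - g) * g ^ n"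
    by (simp add: algebra_simps)
  moreover have "vge (wt \<omega>) (Suc n * e + c) (h * (h ^ n - g ^ n))"
    by (rule vge_mult'[OF assms(2) Suc]) simp
  moreover have "vge (wt \<omega>) (Suc n * e + c) ((h - g) * g ^ n)"
    by (rule vge_mult'[OF assms(3) vge_power[OF assms(1)]]) simp
  ultimately show ?case
    by (metis vge_add)
qed auto

text \<open>
  Telescoping: each factor of order \<open>e v\<close> is replaced in turn, at a relative gain of \<open>c\<close>.
\<close>

lemma vge_prod_diff:
  assumes "finite A" "\<And>v. v \<in> A \<Longrightarrow> vge (wt \<omega>) (e v) (g v)" "\<And>v. v \<in> A \<Longrightarrow> vge (wt \<omega>) (e v) (h v)"
    "\<And>v. v \<in> A \<Longrightarrow> vge (wt \<omega>) (e v + c) (h v - g v)"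
  shows "vge (wt \<omega>) ((\<Sum>v\<in>A. e v) + c) ((\<Prod>v\<in>A. h v) - (\<Prod>v\<in>A. g v))"
  using assms
proof (induction A rule: finite_induct)
  case (insert x A)
  have "(\<Prod>v\<in>insert x A. h v) - (\<Prod>v\<in>insert x A. g v) =
      h x * ((\<Prod>v\<in>A. h v) - (\<Prod>v\<in>A. g v)) + (h x - g x) * (\<Prod>v\<in>A. g v)"
    using insert by (simp add: algebra_simps)
  moreover have "vge (wt \<omega>) ((\<Sum>v\<in>insert x A. e v) + c) (h x * ((\<Prod>v\<in>A. h v) - (\<Prod>v\<in>A. g v)))"
    by (rule vge_mult'[of _ "e x" _ "(\<Sum>v\<in>A. e v) + c"]) (use insert in auto)
  moreover have "vge (wt \<omega>) ((\<Sum>v\<in>insert x A. e v) + c) ((h x - g x) * (\<Prod>v\<in>A. g v))"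
    by (rule vge_mult'[of _ "e x + c" _ "\<Sum>v\<in>A. e v"]) (use insert in \<open>auto intro!: vge_prod\<close>)
  ultimately show ?case
    by (metis vge_add)
qed auto

lemma vge_mpow_diff:
  assumes "\<And>v. vge (wt \<omega>) (\<eta> v) (g v)" "\<And>v. vge (wt \<omega>) (\<eta> v) (h v)"
    "\<And>v. vge (wt \<omega>) (\<eta> v + c) (h v - g v)"
  shows "vge (wt \<omega>) (wt \<eta> \<beta> + c) (mpow h \<beta> - mpow g \<beta>)"
  unfolding mpow_def wt_def[of \<eta>]
proof (rule vge_prod_diff)
  fix v
  show "vge (wt \<omega>) (\<eta> v * \<beta> v) (g v ^ \<beta> v)" "vge (wt \<omega>) (\<eta> v * \<beta> v) (h v ^ \<beta> v)"
    using vge_power[OF assms(1)] vge_power[OF assms(2)] by (metis mult.commute)+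
  show "vge (wt \<omega>) (\<eta> v * \<beta> v + c) (h v ^ \<beta> v - g v ^ \<beta> v)"
    using vge_power_diff[OF assms] by (metis mult.commute)
qed simp

lemma vge_msubst_diff:
  assumes "\<And>v. vge (wt \<omega>) (\<eta> v) (g v)" "\<And>v. vge (wt \<omega>) (\<eta> v) (h v)"
    "\<And>v. vge (wt \<omega>) (\<eta> v + c) (h v - g v)" "vge (wt \<eta>) a f"
  shows "vge (wt \<omega>) (a + c) (msubst f h - msubst f g)"
  unfolding vge_def
proof (intro allI impI)
  fix \<alpha> assume "mcoeff (msubst f h - msubst f g) \<alpha> \<noteq> 0"
  then have "(\<Sum>\<beta> | mdeg \<beta> \<le> mdeg \<alpha>. mcoeff f \<beta> * mcoeff (mpow h \<beta> - mpow g \<beta>) \<alpha>) \<noteq> 0"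
    by (simp add: mcoeff_msubst right_diff_distrib sum_subtractf)
  then obtain \<beta> where "mcoeff f \<beta> \<noteq> 0" "mcoeff (mpow h \<beta> - mpow g \<beta>) \<alpha> \<noteq> 0"
    by (metis (no_types, lifting) mult_eq_0_iff sum.neutral)
  moreover have "vge (wt \<omega>) (wt \<eta> \<beta> + c) (mpow h \<beta> - mpow g \<beta>)"
    by (rule vge_mpow_diff) (rule assms)+
  ultimately have "a \<le> wt \<eta> \<beta>" "wt \<eta> \<beta> + c \<le> wt \<omega> \<alpha>"
    using assms(4) unfolding vge_def by blast+
  then show "a + c \<le> wt \<omega> \<alpha>" by simp
qed


section \<open>The Taylor formula\<close>

definition mmono :: "('v \<Rightarrow> nat) \<Rightarrow> 'v mfps" where
  "mmono \<beta> = Abs_mfps (\<lambda>\<alpha>. if \<alpha> = \<beta> then 1 else 0)"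

lemma mcoeff_mmono: "mcoeff (mmono \<beta>) \<alpha> = (if \<alpha> = \<beta> then 1 else 0)"
  by (simp add: mmono_def)

lemma mmono_0: "mmono 0 = 1"
  by (rule mfps_eqI) (simp add: mcoeff_mmono mcoeff_1)

lemma mvar_eq_mmono: "mvar v = mmono ((0 :: 'v \<Rightarrow> nat)(v := 1))" for v :: 'v
  by (rule mfps_eqI) (simp add: mcoeff_mmono mcoeff_mvar)

lemma mmono_add: "mmono (\<beta> + \<gamma>) = mmono \<beta> * (mmono \<gamma> :: 'v::finite mfps)"
proof (rule mfps_eqI)
  fix \<alpha>
  have "(\<Sum>(b, c) | b + c = \<alpha>. mcoeff (mmono \<beta>) b * mcoeff (mmono \<gamma>) c) =
    (\<Sum>(b, c) \<in> (if \<alpha> = \<beta> + \<gamma> then {(\<beta>, \<gamma>)} else {}). mcoeff (mmono \<beta>) b * mcoeff (mmono \<gamma>) c)"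
    by (rule sum.mono_neutral_right)
      (auto simp: finite_multi_index_splits mcoeff_mmono split: if_splits)
  then show "mcoeff (mmono (\<beta> + \<gamma>)) \<alpha> = mcoeff (mmono \<beta> * mmono \<gamma>) \<alpha>"
    by (simp add: mcoeff_mult mcoeff_mmono)
qed

lemma mmono_sum: "mmono (\<Sum>i\<in>A. f i) = (\<Prod>i\<in>A. mmono (f i) :: 'v::finite mfps)"
proof (induction A rule: infinite_finite_induct)
  case (insert x A)
  then show ?case
    unfolding sum.insert[OF insert(1,2)] prod.insert[OF insert(1,2)] mmono_add by simp
qed (simp_all only: sum.infinite prod.infinite sum.empty prod.empty mmono_0 simp_thms if_False)

lemma mvar_power: "mvar v ^ n = mmono ((0 :: 'v \<Rightarrow> nat)(v := n))" for v :: "'v::finite"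
proof (induction n)
  case 0
  have "(0 :: 'v \<Rightarrow> nat)(v := 0) = 0" by auto
  then show ?case by (simp only: mmono_0 power_0)
next
  case (Suc n)
  have "(0 :: 'v \<Rightarrow> nat)(v := Suc n) = 0(v := 1) + 0(v := n)" by (auto simp: fun_eq_iff)
  then show ?case unfolding power_Suc Suc unfolding mvar_eq_mmono by (simp only: mmono_add)
qed

lemma sum_fun_apply: "(\<Sum>i\<in>A. f i) x = (\<Sum>i\<in>A. f i x)"
  by (induction A rule: infinite_finite_induct) auto

lemma mpow_mvar: "mpow mvar \<beta> = mmono (\<beta> :: 'v::finite \<Rightarrow> nat)"
proof -
  have "(\<Sum>v\<in>UNIV. (0 :: 'v \<Rightarrow> nat)(v := \<beta> v)) = \<beta>"
    by (auto simp: fun_eq_iff sum_fun_apply if_distrib cong: if_cong)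
  then show ?thesis
    by (simp add: mpow_def mvar_power flip: mmono_sum)
qed

lemma msubst_mvars [simp]: "msubst p mvar = p"
proof (rule mfps_eqI)
  fix \<alpha> :: "'a \<Rightarrow> nat"
  have "mcoeff (msubst p mvar) \<alpha> = (\<Sum>\<beta>\<in>{\<alpha>}. mcoeff p \<beta> * mcoeff (mmono \<beta>) \<alpha>)"
    unfolding mcoeff_msubst mpow_mvar
    by (rule sum.mono_neutral_right) (auto simp: finite_multi_index_mdeg mcoeff_mmono)
  then show "mcoeff (msubst p mvar) \<alpha> = mcoeff p \<alpha>"
    by (simp add: mcoeff_mmono)
qed

lemma mfps_eq_sum_mmono:
  fixes p :: "'v::finite mfps"
  assumes "finite B" "{\<beta>. mcoeff p \<beta> \<noteq> 0} \<subseteq> B"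
  shows "p = (\<Sum>\<beta>\<in>B. mconst (mcoeff p \<beta>) * mmono \<beta>)"
proof (rule mfps_eqI)
  fix \<alpha>
  have "(\<Sum>\<beta>\<in>B. mcoeff p \<beta> * (if \<alpha> = \<beta> then 1 else 0)) = (\<Sum>\<beta>\<in>B. if \<alpha> = \<beta> then mcoeff p \<beta> else 0)"
    by (rule sum.cong) auto
  then show "mcoeff p \<alpha> = mcoeff (\<Sum>\<beta>\<in>B. mconst (mcoeff p \<beta>) * mmono \<beta>) \<alpha>"
    using assms by (auto simp: mcoeff_mmono)
qed

lemma mcoeff_mderiv: "mcoeff (mderiv v f) \<alpha> = of_nat (Suc (\<alpha> v)) * mcoeff f (\<alpha>(v := Suc (\<alpha> v)))"
  by (simp add: mderiv_def)

lemma mderiv_add: "mderiv v (f + g) = mderiv v f + mderiv v g"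
  by (rule mfps_eqI) (simp add: mcoeff_mderiv distrib_left)

lemma mderiv_sum: "mderiv v (\<Sum>i\<in>A. f i) = (\<Sum>i\<in>A. mderiv v (f i))"
  by (rule mfps_eqI) (simp add: mcoeff_mderiv sum_distrib_left)

lemma mderiv_mconst_mult: "mderiv v (mconst c * f) = mconst c * mderiv v f"
  by (rule mfps_eqI) (simp add: mcoeff_mderiv)

lemma mderiv_1: "mderiv v 1 = 0"
  by (rule mfps_eqI) (auto simp: mcoeff_mderiv mcoeff_1 fun_eq_iff)

lemma mderiv_mvar_mult: "mderiv v (mvar w * f) = (if v = w then f else 0) + mvar w * mderiv v f"
proof (rule mfps_eqI)
  fix \<alpha> :: "'a \<Rightarrow> nat"
  show "mcoeff (mderiv v (mvar w * f)) \<alpha> = mcoeff ((if v = w then f else 0) + mvar w * mderiv v f) \<alpha>"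
  proof (cases "v = w")
    case True
    show ?thesis
    proof (cases "\<alpha> w = 0")
      case True
      then show ?thesis
        using \<open>v = w\<close> by (simp add: mcoeff_mderiv mcoeff_mvar_mult fun_upd_idem)
    next
      case False
      then have "Suc (\<alpha> w - 1) = \<alpha> w" by simp
      then show ?thesis using \<open>v = w\<close> False
        by (simp add: mcoeff_mderiv mcoeff_mvar_mult distrib_right)
    qed
  next
    case False
    then show ?thesis
      by (simp add: mcoeff_mderiv mcoeff_mvar_mult fun_upd_twist)
  qed
qed

lemma vge_mderiv:
  assumes "vge (wt \<omega>) a f" shows "vge (wt \<omega>) (a - \<omega> v) (mderiv v f)"
  unfolding vge_def
proof (intro allI impI)
  fix \<alpha> assume "mcoeff (mderiv v f) \<alpha> \<noteq> 0"
  then have "a \<le> wt \<omega> (\<alpha>(v := Suc (\<alpha> v)))"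
    using assms by (auto simp: vge_def mcoeff_mderiv)
  also have "\<alpha>(v := Suc (\<alpha> v)) = \<alpha> + 0(v := 1)"
    by (auto simp: fun_eq_iff)
  finally show "a - \<omega> v \<le> wt \<omega> \<alpha>"
    unfolding wt_add wt_single by simp
qed

text \<open>
  The Taylor formula to first order at \<open>g\<close>, with the derivatives evaluated at the identity
  rather than at \<open>g\<close>: as \<open>g\<close> agrees with the identity to leading order, this costs an error of
  the same size as the quadratic terms.
\<close>

context
  fixes \<omega> :: "'v::finite \<Rightarrow> nat" and g h :: "'v \<Rightarrow> 'v mfps" and c :: nat
  assumes g0: "\<And>v. mcoeff (g v) 0 = 0" and h0: "\<And>v. mcoeff (h v) 0 = 0"
    and g: "\<And>v. vge (wt \<omega>) (\<omega> v + 1) (g v - mvar v)"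
    and h: "\<And>v. vge (wt \<omega>) (\<omega> v + c) (h v - g v)"
    and c: "c \<ge> 1"
begin

definition taylor_rest :: "'v mfps \<Rightarrow> 'v mfps" where
  "taylor_rest p = msubst p h - msubst p g - (\<Sum>v\<in>UNIV. mderiv v p * (h v - g v))"

lemma vge_g: "vge (wt \<omega>) (\<omega> v) (g v)"
  using vge_add[OF vge_mono[OF g[of v]] vge_mvar[of \<omega> v]] by simp

lemma vge_h: "vge (wt \<omega>) (\<omega> v) (h v)"
  using vge_add[OF vge_mono[OF h[of v]] vge_g[of v]] by simp

text \<open>
  By the Leibniz rule the remainder for \<open>mvar w * p\<close> is that for \<open>p\<close> times \<open>h w\<close>, up to two products in
  which \<open>h - g\<close>, of relative order \<open>c\<close>, meets the deviation of \<open>h\<close> or \<open>g\<close> from the identity.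
\<close>

lemma taylor_rest_step:
  assumes p: "vge (wt \<omega>) a p" and R: "vge (wt \<omega>) (a + c + 1) (taylor_rest p)"
  shows "vge (wt \<omega>) (\<omega> w + a + c + 1) (taylor_rest (mvar w * p))"
proof -
  define pD where "pD = (\<Sum>v\<in>UNIV. mderiv v p * (h v - g v))"
  have pD: "vge (wt \<omega>) (a + c) pD"
    unfolding pD_def
    by (intro vge_sum vge_mult'[OF vge_mderiv[OF p] h]) simp
  have "(\<Sum>v\<in>UNIV. mderiv v (mvar w * p) * (h v - g v)) =
    (\<Sum>v\<in>UNIV. (if v = w then p * (h v - g v) else 0) + mvar w * (mderiv v p * (h v - g v)))"
    unfolding mderiv_mvar_mult by (rule sum.cong) (auto simp: algebra_simps)
  also have "\<dots> = p * (h w - g w) + mvar w * pD"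
    by (simp add: sum.distrib pD_def sum_distrib_left)
  finally have D: "(\<Sum>v\<in>UNIV. mderiv v (mvar w * p) * (h v - g v)) = p * (h w - g w) + mvar w * pD" .
  have eq: "taylor_rest (mvar w * p) = h w * taylor_rest p + (h w - mvar w) * pD +
      (h w - g w) * (msubst p g - msubst p mvar)"
    unfolding taylor_rest_def D pD_def[symmetric]
    by (simp add: msubst_mult msubst_mvar g0 h0 algebra_simps)
  have "vge (wt \<omega>) (\<omega> w + 1) (h w - mvar w)"
    using vge_add[OF g[of w] vge_mono[OF h[of w], of "\<omega> w + 1"]] c by simp
  then have "vge (wt \<omega>) (\<omega> w + a + c + 1) ((h w - mvar w) * pD)"
    by (rule vge_mult'[OF _ pD]) simp
  moreover have "vge (wt \<omega>) (\<omega> w + a + c + 1) (h w * taylor_rest p)"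
    by (rule vge_mult'[OF vge_h R]) simp
  moreover have "vge (wt \<omega>) (a + 1) (msubst p g - msubst p mvar)"
    by (rule vge_msubst_diff) (use g vge_mvar vge_g p in auto)
  then have "vge (wt \<omega>) (\<omega> w + a + c + 1) ((h w - g w) * (msubst p g - msubst p mvar))"
    by (rule vge_mult'[OF h]) simp
  ultimately show ?thesis
    unfolding eq by (intro vge_add)
qed

lemma taylor_rest_mmono: "vge (wt \<omega>) (wt \<omega> \<beta> + c + 1) (taylor_rest (mmono \<beta>))"
proof (induction "mdeg \<beta>" arbitrary: \<beta>)
  case 0
  have "\<beta> = 0"
    using 0 by (auto simp: mdeg_def fun_eq_iff)
  then show ?case
    unfolding \<open>\<beta> = 0\<close> mmono_0 by (simp add: taylor_rest_def msubst_1 mderiv_1)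
next
  case (Suc d)
  have "\<beta> \<noteq> 0" using Suc(2) by auto
  then obtain w where w: "\<beta> w \<noteq> 0" by (auto simp: fun_eq_iff)
  define \<gamma> where "\<gamma> = \<beta>(w := \<beta> w - 1)"
  have eq: "\<beta> = 0(w := 1) + \<gamma>"
    using w by (auto simp: \<gamma>_def fun_eq_iff)
  have "d = mdeg \<gamma>"
    using Suc(2) unfolding eq by (simp add: mdeg_eq_wt del: fun_upd_apply)
  then have "vge (wt \<omega>) (wt \<omega> \<gamma> + c + 1) (taylor_rest (mmono \<gamma>))"
    by (rule Suc(1))
  moreover have "vge (wt \<omega>) (wt \<omega> \<gamma>) (mmono \<gamma>)"
    by (auto simp: vge_def mcoeff_mmono)
  ultimately have "vge (wt \<omega>) (\<omega> w + wt \<omega> \<gamma> + c + 1) (taylor_rest (mvar w * mmono \<gamma>))"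
    by (intro taylor_rest_step)
  moreover have "mvar w * mmono \<gamma> = mmono \<beta>"
    by (simp add: eq mmono_add mvar_eq_mmono)
  ultimately show ?case
    unfolding eq by (simp del: fun_upd_apply)
qed

lemma taylor_rest_add: "taylor_rest (p + q) = taylor_rest p + taylor_rest q"
  by (simp add: taylor_rest_def msubst_add mderiv_add distrib_right sum.distrib)

lemma taylor_rest_mconst_mult: "taylor_rest (mconst k * p) = mconst k * taylor_rest p"
  by (simp add: taylor_rest_def msubst_mconst_mult mderiv_mconst_mult right_diff_distrib[of "mconst k"]
      sum_distrib_left mult.assoc)

lemma taylor_rest:
  assumes "finite {\<beta>. mcoeff p \<beta> \<noteq> 0}" "vge (wt \<omega>) a p"
  shows "vge (wt \<omega>) (a + c + 1) (msubst p h - msubst p g - (\<Sum>v\<in>UNIV. mderiv v p * (h v - g v)))"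
proof -
  let ?B = "{\<beta>. mcoeff p \<beta> \<noteq> 0}"
  have lin: "taylor_rest (\<Sum>\<beta>\<in>B. mconst (k \<beta>) * mmono \<beta>) = (\<Sum>\<beta>\<in>B. mconst (k \<beta>) * taylor_rest (mmono \<beta>))"
    if "finite B" for B k
    using that
  proof (induction B rule: finite_induct)
    case (insert b B)
    then show ?case
      by (simp add: taylor_rest_add taylor_rest_mconst_mult)
  qed (simp add: taylor_rest_def mderiv_sum[of _ _ "{}", simplified])
  have "taylor_rest p = taylor_rest (\<Sum>\<beta>\<in>?B. mconst (mcoeff p \<beta>) * mmono \<beta>)"
    by (rule arg_cong[OF mfps_eq_sum_mmono[OF assms(1) order_refl]])
  also have "\<dots> = (\<Sum>\<beta>\<in>?B. mconst (mcoeff p \<beta>) * taylor_rest (mmono \<beta>))"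
    by (rule lin[OF assms(1)])
  finally have "taylor_rest p = (\<Sum>\<beta>\<in>?B. mconst (mcoeff p \<beta>) * taylor_rest (mmono \<beta>))" .
  moreover have "vge (wt \<omega>) (a + c + 1) (\<Sum>\<beta>\<in>?B. mconst (mcoeff p \<beta>) * taylor_rest (mmono \<beta>))"
  proof (intro vge_sum vge_mconst_mult)
    fix \<beta> assume "\<beta> \<in> ?B"
    then have "a \<le> wt \<omega> \<beta>"
      using assms(2) by (simp add: vge_def)
    then show "vge (wt \<omega>) (a + c + 1) (taylor_rest (mmono \<beta>))"
      by (intro vge_mono[OF taylor_rest_mmono]) simp
  qed
  ultimately show ?thesis
    by (simp add: taylor_rest_def)
qed

end


section \<open>Conjugation and bidegrees\<close>

definition swap_index :: "('n + 'n \<Rightarrow> nat) \<Rightarrow> ('n + 'n \<Rightarrow> nat)" where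
  "swap_index \<alpha> = \<alpha> \<circ> case_sum Inr Inl"

lemma swap_index_apply [simp]: "swap_index \<alpha> (Inl k) = \<alpha> (Inr k)" "swap_index \<alpha> (Inr k) = \<alpha> (Inl k)"
  by (simp_all add: swap_index_def)

lemma swap_index_swap_index [simp]: "swap_index (swap_index \<alpha>) = \<alpha>"
proof
  fix x show "swap_index (swap_index \<alpha>) x = \<alpha> x"
    by (cases x) simp_all
qed

lemma swap_index_add [simp]: "swap_index (\<alpha> + \<beta>) = swap_index \<alpha> + swap_index \<beta>"
  by (auto simp: swap_index_def fun_eq_iff)

lemma swap_index_0 [simp]: "swap_index 0 = 0"
  by (auto simp: swap_index_def fun_eq_iff)

lemma swap_index_eq_iff: "swap_index \<alpha> = \<beta> \<longleftrightarrow> \<alpha> = swap_index \<beta>"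
  by auto

lemma mcoeff_mbar: "mcoeff (mbar f) \<alpha> = cnj (mcoeff f (swap_index \<alpha>))"
  by (simp add: mbar_def swap_index_def)

lemma mbar_mbar [simp]: "mbar (mbar f) = f"
  by (rule mfps_eqI) (simp add: mcoeff_mbar)

lemma mbar_add [simp]: "mbar (f + g) = mbar f + mbar g" for f :: "('n::finite + 'n) mfps"
  by (rule mfps_eqI) (simp add: mcoeff_mbar)

lemma mbar_diff [simp]: "mbar (f - g) = mbar f - mbar g" for f :: "('n::finite + 'n) mfps"
  by (rule mfps_eqI) (simp add: mcoeff_mbar)

lemma mbar_uminus [simp]: "mbar (- f) = - mbar f" for f :: "('n::finite + 'n) mfps"
  by (rule mfps_eqI) (simp add: mcoeff_mbar)

lemma mbar_0 [simp]: "mbar 0 = (0 :: ('n::finite + 'n) mfps)"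
  by (rule mfps_eqI) (simp add: mcoeff_mbar)

lemma mbar_sum [simp]: "mbar (\<Sum>i\<in>A. f i) = (\<Sum>i\<in>A. mbar (f i) :: ('n::finite + 'n) mfps)"
  by (induction A rule: infinite_finite_induct) auto

lemma mbar_mult [simp]: "mbar (f * g) = mbar f * mbar g" for f :: "('n::finite + 'n) mfps"
proof (rule mfps_eqI)
  fix \<alpha> :: "'n + 'n \<Rightarrow> nat"
  show "mcoeff (mbar (f * g)) \<alpha> = mcoeff (mbar f * mbar g) \<alpha>"
    unfolding mcoeff_mbar mcoeff_mult cnj_sum
    by (rule sum.reindex_bij_witness[of _ "\<lambda>(a, b). (swap_index a, swap_index b)"
          "\<lambda>(a, b). (swap_index a, swap_index b)"])
      (auto simp: mcoeff_mbar simp flip: swap_index_add)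
qed

lemma mbar_mconst [simp]: "mbar (mconst c) = mconst (cnj c)"
  by (rule mfps_eqI) (auto simp: mcoeff_mbar mcoeff_mconst swap_index_eq_iff)

lemma mbar_1 [simp]: "mbar 1 = (1 :: ('n::finite + 'n) mfps)"
  by (metis mbar_mconst mconst_1 complex_cnj_one)

lemma mbar_power [simp]: "mbar (f ^ n) = mbar f ^ n" for f :: "('n::finite + 'n) mfps"
  by (induction n) auto

lemma swap_index_single: "swap_index (0(Inl k := n)) = 0(Inr k := n)"
  "swap_index (0(Inr k := n)) = 0(Inl k := n)"
  by (auto simp: swap_index_def fun_eq_iff split: sum.splits)

lemma mbar_mvar [simp]: "mbar (mvar (Inl k)) = mvar (Inr k)" "mbar (mvar (Inr k)) = mvar (Inl k)"
  by (rule mfps_eqI, simp add: mcoeff_mbar mcoeff_mvar swap_index_eq_iff swap_index_single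
      del: fun_upd_apply)+

lemma mbar_mderiv: "mderiv (Inr k) (mbar f) = mbar (mderiv (Inl k) f)"
proof (rule mfps_eqI)
  fix \<alpha> :: "'a + 'a \<Rightarrow> nat"
  have "swap_index (\<alpha>(Inr k := Suc (\<alpha> (Inr k)))) = (swap_index \<alpha>)(Inl k := Suc (\<alpha> (Inr k)))"
    by (auto simp: swap_index_def fun_eq_iff split: sum.splits)
  then show "mcoeff (mderiv (Inr k) (mbar f)) \<alpha> = mcoeff (mbar (mderiv (Inl k) f)) \<alpha>"
    by (simp add: mcoeff_mderiv mcoeff_mbar)
qed

definition zdeg :: "('n::finite + 'n \<Rightarrow> nat) \<Rightarrow> nat" where
  "zdeg \<alpha> = (\<Sum>k\<in>UNIV. \<alpha> (Inl k))"

definition bdeg :: "('n::finite + 'n \<Rightarrow> nat) \<Rightarrow> nat" where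
  "bdeg \<alpha> = (\<Sum>k\<in>UNIV. \<alpha> (Inr k))"

lemma zdeg_add [simp]: "zdeg (\<alpha> + \<beta>) = zdeg \<alpha> + zdeg \<beta>"
  by (simp add: zdeg_def sum.distrib)

lemma bdeg_add [simp]: "bdeg (\<alpha> + \<beta>) = bdeg \<alpha> + bdeg \<beta>"
  by (simp add: bdeg_def sum.distrib)

lemma zdeg_0 [simp]: "zdeg 0 = 0" and bdeg_0 [simp]: "bdeg 0 = 0"
  by (simp_all add: zdeg_def bdeg_def)

lemma zdeg_swap_index [simp]: "zdeg (swap_index \<alpha>) = bdeg \<alpha>"
  and bdeg_swap_index [simp]: "bdeg (swap_index \<alpha>) = zdeg \<alpha>"
  by (simp_all add: zdeg_def bdeg_def)

definition zw :: "nat \<Rightarrow> nat \<Rightarrow> 'n + 'n \<Rightarrow> nat" where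
  "zw a b = case_sum (\<lambda>_. a) (\<lambda>_. b)"

lemma zw_simps [simp]: "zw a b (Inl k) = a" "zw a b (Inr k) = b"
  by (simp_all add: zw_def)

lemma wt_sum: "wt (zw a b) \<alpha> = a * zdeg \<alpha> + b * bdeg \<alpha>"
  by (simp add: wt_def zdeg_def bdeg_def sum_distrib_left UNIV_Plus_UNIV[symmetric] sum.Plus
      del: UNIV_Plus_UNIV)

lemma mdeg_sum: "mdeg \<alpha> = zdeg \<alpha> + bdeg \<alpha>"
proof -
  have "(\<lambda>_ :: 'a + 'a. 1) = zw 1 1"
    by (auto simp: fun_eq_iff zw_def split: sum.splits)
  then show ?thesis
    using wt_sum[of 1 1 \<alpha>] by (simp add: mdeg_eq_wt)
qed

lemma vge_mbar:
  "vge (wt (zw a b)) W (mbar f) \<longleftrightarrow> vge (wt (zw b a)) W f"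
  unfolding vge_def mcoeff_mbar wt_sum
  by (metis (no_types, lifting) add.commute bdeg_swap_index complex_cnj_zero_iff
      swap_index_swap_index zdeg_swap_index)

lemma bihomogeneous_iff:
  "bihomogeneous m n f \<longleftrightarrow> (\<forall>\<alpha>. mcoeff f \<alpha> \<noteq> 0 \<longrightarrow> zdeg \<alpha> = m \<and> bdeg \<alpha> = n)"
  by (simp add: bihomogeneous_def zdeg_def bdeg_def)

lemma bihomogeneous_mult:
  "bihomogeneous m n f \<Longrightarrow> bihomogeneous m' n' g \<Longrightarrow> bihomogeneous (m + m') (n + n') (f * g)"
  unfolding bihomogeneous_iff by (metis mcoeff_mult_nonzeroE zdeg_add bdeg_add)

lemma bihomogeneous_1: "bihomogeneous 0 0 1"
  by (auto simp: bihomogeneous_iff mcoeff_1 split: if_splits)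

lemma bihomogeneous_0 [simp]: "bihomogeneous m n 0"
  by (simp add: bihomogeneous_iff)

lemma bihomogeneous_power: "bihomogeneous m n f \<Longrightarrow> bihomogeneous (l * m) (l * n) (f ^ l)"
  by (induction l) (auto intro: bihomogeneous_mult bihomogeneous_1)

lemma bihomogeneous_add: "bihomogeneous m n f \<Longrightarrow> bihomogeneous m n g \<Longrightarrow> bihomogeneous m n (f + g)"
  unfolding bihomogeneous_iff by (metis add.right_neutral mcoeff_add)

lemma bihomogeneous_diff: "bihomogeneous m n f \<Longrightarrow> bihomogeneous m n g \<Longrightarrow> bihomogeneous m n (f - g)"
  unfolding bihomogeneous_iff by (metis diff_self eq_iff_diff_eq_0 mcoeff_diff)

lemma bihomogeneous_uminus: "bihomogeneous m n f \<Longrightarrow> bihomogeneous m n (- f)"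
  by (simp add: bihomogeneous_iff)

lemma bihomogeneous_sum: "(\<And>i. i \<in> A \<Longrightarrow> bihomogeneous m n (f i)) \<Longrightarrow> bihomogeneous m n (\<Sum>i\<in>A. f i)"
  by (induction A rule: infinite_finite_induct) (auto intro: bihomogeneous_add)

lemma bihomogeneous_mconst_mult: "bihomogeneous m n f \<Longrightarrow> bihomogeneous m n (mconst c * f)"
  by (simp add: bihomogeneous_iff)

lemma bihomogeneous_mbar: "bihomogeneous m n f \<Longrightarrow> bihomogeneous n m (mbar f)"
  unfolding bihomogeneous_iff mcoeff_mbar
  by (metis bdeg_swap_index complex_cnj_zero_iff zdeg_swap_index)

lemma zdeg_single [simp]: "zdeg ((0 :: 'n::finite + 'n \<Rightarrow> nat)(Inl k := n)) = n"
  "bdeg ((0 :: 'n::finite + 'n \<Rightarrow> nat)(Inl k := n)) = 0"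
  "zdeg ((0 :: 'n::finite + 'n \<Rightarrow> nat)(Inr k := n)) = 0"
  "bdeg ((0 :: 'n::finite + 'n \<Rightarrow> nat)(Inr k := n)) = n"
  by (simp_all add: zdeg_def bdeg_def cong: if_cong)

lemma bihomogeneous_mvar: "bihomogeneous (Suc 0) 0 (mvar (Inl k))" "bihomogeneous 0 (Suc 0) (mvar (Inr k))"
  by (auto simp: bihomogeneous_iff mcoeff_mvar simp del: fun_upd_apply split: if_splits)

lemma bihomogeneous_quadric: "bihomogeneous (Suc 0) (Suc 0) quadric"
  unfolding quadric_def
  by (rule bihomogeneous_sum) (use bihomogeneous_mult[OF bihomogeneous_mvar] in simp)

lemma bihomogeneous_quadric_power: "bihomogeneous n n (quadric ^ n)"
  using bihomogeneous_power[OF bihomogeneous_quadric, of n] by simp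

lemma mbar_quadric [simp]: "mbar quadric = (quadric :: ('n::finite + 'n) mfps)"
  by (simp add: quadric_def mult.commute)

definition bipart :: "nat \<Rightarrow> nat \<Rightarrow> ('n::finite + 'n) mfps \<Rightarrow> ('n + 'n) mfps" where
  "bipart m n f = Abs_mfps (\<lambda>\<alpha>. if zdeg \<alpha> = m \<and> bdeg \<alpha> = n then mcoeff f \<alpha> else 0)"

lemma mcoeff_bipart: "mcoeff (bipart m n f) \<alpha> = (if zdeg \<alpha> = m \<and> bdeg \<alpha> = n then mcoeff f \<alpha> else 0)"
  by (simp add: bipart_def)

lemma bihomogeneous_bipart: "bihomogeneous m n (bipart m n f)"
  by (simp add: bihomogeneous_iff mcoeff_bipart)

lemma bipart_bihomogeneous:
  "bihomogeneous m n f \<Longrightarrow> bipart m' n' f = (if m' = m \<and> n' = n then f else 0)"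
  by (rule mfps_eqI) (auto simp: bihomogeneous_iff mcoeff_bipart)

lemma bipart_add: "bipart m n (f + g) = bipart m n f + bipart m n g"
  by (rule mfps_eqI) (simp add: mcoeff_bipart)

lemma bipart_diff: "bipart m n (f - g) = bipart m n f - bipart m n g"
  by (rule mfps_eqI) (simp add: mcoeff_bipart)

lemma bipart_uminus: "bipart m n (- f) = - bipart m n f"
  by (rule mfps_eqI) (simp add: mcoeff_bipart)

lemma bipart_0 [simp]: "bipart m n 0 = 0"
  by (rule mfps_eqI) (simp add: mcoeff_bipart)

lemma mbar_bipart: "mbar (bipart m n f) = bipart n m (mbar f)"
  by (rule mfps_eqI) (auto simp: mcoeff_mbar mcoeff_bipart)

lemma bihomogeneous_finite: "bihomogeneous m n f \<Longrightarrow> finite {\<beta>. mcoeff f \<beta> \<noteq> 0}"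
  by (rule finite_subset[OF _ finite_multi_index_mdeg[of "m + n"]]) (auto simp: bihomogeneous_iff mdeg_sum)

lemma vge_bihomogeneous:
  "bihomogeneous m n f \<Longrightarrow> W \<le> a * m + b * n \<Longrightarrow> vge (wt (zw a b)) W f"
  by (auto simp: vge_def bihomogeneous_iff wt_sum)


section \<open>Holomorphic series\<close>

lemma mpow_mvar_Inl: "mpow (\<lambda>k. mvar (Inl k) :: ('n::finite + 'n) mfps) \<beta> = mmono (case_sum \<beta> (\<lambda>_. 0))"
proof -
  have "(\<Sum>v\<in>UNIV. (0 :: 'n + 'n \<Rightarrow> nat)(Inl v := \<beta> v)) = case_sum \<beta> (\<lambda>_. 0)"
    by (auto simp: fun_eq_iff sum_fun_apply if_distrib split: sum.splits cong: if_cong)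
  then show ?thesis
    by (simp add: mpow_def mvar_power flip: mmono_sum)
qed

lemma mcoeff_of_hol:
  "mcoeff (of_hol p) \<alpha> = (if bdeg \<alpha> = 0 then mcoeff p (\<alpha> \<circ> Inl) else 0)"
proof -
  have 1: "\<alpha> = case_sum \<beta> (\<lambda>_. 0) \<longleftrightarrow> bdeg \<alpha> = 0 \<and> \<beta> = \<alpha> \<circ> Inl" for \<beta>
    by (auto simp: bdeg_def fun_eq_iff split: sum.splits)
  have "mcoeff (of_hol p) \<alpha> = (\<Sum>\<beta> | mdeg \<beta> \<le> mdeg \<alpha>. mcoeff p \<beta> * (if bdeg \<alpha> = 0 \<and> \<beta> = \<alpha> \<circ> Inl then 1 else 0))"
    by (simp add: of_hol_def mcoeff_msubst mpow_mvar_Inl mcoeff_mmono 1)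
  also have "\<dots> = (\<Sum>\<beta>\<in>{\<alpha> \<circ> Inl}. mcoeff p \<beta> * (if bdeg \<alpha> = 0 \<and> \<beta> = \<alpha> \<circ> Inl then 1 else 0))"
    by (rule sum.mono_neutral_right)
      (auto simp: finite_multi_index_mdeg mdeg_sum zdeg_def mdeg_def[of "\<alpha> \<circ> Inl"])
  finally show ?thesis by simp
qed

lemma zdeg_of_hol_index: "zdeg \<alpha> = mdeg (\<alpha> \<circ> Inl)"
  by (simp add: zdeg_def mdeg_def)

lemma of_hol_add: "of_hol (p + q) = of_hol p + of_hol q"
  by (simp add: of_hol_def msubst_add)

lemma of_hol_0 [simp]: "of_hol 0 = 0"
  by (simp add: of_hol_def)

lemma of_hol_sum: "of_hol (\<Sum>i\<in>A. f i) = (\<Sum>i\<in>A. of_hol (f i))"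
  by (simp add: of_hol_def msubst_sum)

lemma mcoeff_mvar_at_0 [simp]: "mcoeff (mvar v) 0 = 0"
proof -
  have "(0 :: 'a \<Rightarrow> nat) \<noteq> 0(v := 1)"
    by (metis fun_upd_same zero_fun_apply zero_neq_one)
  then show ?thesis by (simp add: mcoeff_mvar)
qed

lemma of_hol_mult: "of_hol (p * q) = of_hol p * of_hol q"
  by (simp add: of_hol_def msubst_mult)

lemma of_hol_power: "of_hol (p ^ n) = of_hol p ^ n"
  by (simp add: of_hol_def msubst_power)

lemma of_hol_mconst_mult: "of_hol (mconst c * p) = mconst c * of_hol p"
  by (simp add: of_hol_def msubst_mconst_mult)

lemma of_hol_mvar: "of_hol (mvar k) = mvar (Inl k)"
  by (simp add: of_hol_def msubst_mvar)

lemma to_hol_of_hol [simp]: "to_hol (of_hol p) = p"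
  by (rule mfps_eqI) (simp add: to_hol_def mcoeff_of_hol bdeg_def comp_def)

lemma of_hol_eq_iff [simp]: "of_hol p = of_hol q \<longleftrightarrow> p = q"
  by (metis to_hol_of_hol)

lemma of_hol_to_hol: "bihomogeneous k 0 A \<Longrightarrow> of_hol (to_hol A) = A"
proof (rule mfps_eqI)
  fix \<alpha> :: "'a + 'a \<Rightarrow> nat"
  assume A: "bihomogeneous k 0 A"
  have "bdeg \<alpha> = 0 \<Longrightarrow> case_sum (\<alpha> \<circ> Inl) (\<lambda>_. 0) = \<alpha>"
    by (auto simp: bdeg_def fun_eq_iff split: sum.splits)
  then show "mcoeff (of_hol (to_hol A)) \<alpha> = mcoeff A \<alpha>"
    using A by (auto simp: mcoeff_of_hol to_hol_def bihomogeneous_iff)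
qed

lemma homogeneous_to_hol: "bihomogeneous k 0 A \<Longrightarrow> homogeneous k (to_hol A)"
  unfolding homogeneous_def
proof (intro allI impI)
  fix \<alpha> assume A: "bihomogeneous k 0 A" and "mcoeff (to_hol A) \<alpha> \<noteq> 0"
  then have "zdeg (case_sum \<alpha> (\<lambda>_. 0 :: nat)) = k"
    by (auto simp: bihomogeneous_iff to_hol_def)
  then show "mdeg \<alpha> = k" by (simp add: zdeg_def mdeg_def)
qed

lemma bihomogeneous_of_hol_iff: "bihomogeneous k 0 (of_hol p) \<longleftrightarrow> homogeneous k p"
proof
  assume "homogeneous k p"
  then show "bihomogeneous k 0 (of_hol p)"
    by (auto simp: bihomogeneous_iff mcoeff_of_hol homogeneous_def zdeg_of_hol_index split: if_splits)
qed (use homogeneous_to_hol in fastforce)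

lemma of_hol_mderiv: "of_hol (mderiv k p) = mderiv (Inl k) (of_hol p)"
proof (rule mfps_eqI)
  fix \<alpha> :: "'a + 'a \<Rightarrow> nat"
  have "\<alpha>(Inl k := Suc (\<alpha> (Inl k))) \<circ> Inl = (\<alpha> \<circ> Inl)(k := Suc (\<alpha> (Inl k)))"
    by (auto simp: fun_eq_iff)
  moreover have "bdeg (\<alpha>(Inl k := Suc (\<alpha> (Inl k)))) = bdeg \<alpha>"
    by (simp add: bdeg_def)
  ultimately show "mcoeff (of_hol (mderiv k p)) \<alpha> = mcoeff (mderiv (Inl k) (of_hol p)) \<alpha>"
    by (simp add: mcoeff_of_hol mcoeff_mderiv)
qed

lemma mderiv_of_hol_Inr: "mderiv (Inr k) (of_hol p) = 0"
  by (rule mfps_eqI) (auto simp: mcoeff_of_hol mcoeff_mderiv bdeg_def)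


section \<open>The Fischer inner product\<close>

definition mfact :: "('v::finite \<Rightarrow> nat) \<Rightarrow> complex" where
  "mfact \<alpha> = (\<Prod>v\<in>UNIV. fact (\<alpha> v))"

text \<open>
  The inner product on polynomials of degree \<open>d\<close> for which the monomials are orthogonal with squared
  norms \<open>\<alpha>!\<close>. The factorials make differentiation adjoint to multiplication.
\<close>

definition ip :: "nat \<Rightarrow> 'v::finite mfps \<Rightarrow> 'v mfps \<Rightarrow> complex" where
  "ip d f g = (\<Sum>\<alpha> | mdeg \<alpha> = d. mfact \<alpha> * mcoeff f \<alpha> * cnj (mcoeff g \<alpha>))"

lemma mfact_nonzero [simp]: "mfact \<alpha> \<noteq> 0"
  by (simp add: mfact_def)

lemma mfact_eq_of_real: "mfact \<alpha> = of_real (\<Prod>v\<in>UNIV. fact (\<alpha> v))"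
  by (simp add: mfact_def)

lemma cnj_mfact [simp]: "cnj (mfact \<alpha>) = mfact \<alpha>"
  unfolding mfact_eq_of_real by (rule complex_cnj_complex_of_real)

lemma finite_mdeg_eq [simp]: "finite {\<alpha> :: 'v::finite \<Rightarrow> nat. mdeg \<alpha> = d}"
  by (rule finite_subset[OF _ finite_multi_index_mdeg[of d]]) auto

lemma ip_add_left: "ip d (f + f') g = ip d f g + ip d f' g"
  by (simp add: ip_def algebra_simps sum.distrib)

lemma ip_add_right: "ip d f (g + g') = ip d f g + ip d f g'"
  by (simp add: ip_def algebra_simps sum.distrib)

lemma ip_diff_left: "ip d (f - f') g = ip d f g - ip d f' g"
  by (simp add: ip_def algebra_simps sum_subtractf)

lemma ip_0_left [simp]: "ip d 0 g = 0"
  by (simp add: ip_def)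

lemma ip_0_right [simp]: "ip d g 0 = 0"
  by (simp add: ip_def)

lemma ip_scale_left: "ip d (mconst c * f) g = c * ip d f g"
  unfolding ip_def mcoeff_mconst_mult sum_distrib_left by (simp add: mult_ac)

lemma ip_scale_right: "ip d f (mconst c * g) = cnj c * ip d f g"
  unfolding ip_def mcoeff_mconst_mult sum_distrib_left by (simp add: mult_ac)

lemma ip_sum_left: "ip d (\<Sum>i\<in>A. f i) g = (\<Sum>i\<in>A. ip d (f i) g)"
  by (induction A rule: infinite_finite_induct) (auto simp: ip_add_left)

lemma ip_sum_right: "ip d f (\<Sum>i\<in>A. g i) = (\<Sum>i\<in>A. ip d f (g i))"
  by (induction A rule: infinite_finite_induct) (auto simp: ip_add_right)

lemma ip_mmono: "mdeg \<gamma> = d \<Longrightarrow> ip d f (mmono \<gamma>) = mfact \<gamma> * mcoeff f \<gamma>"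
proof -
  assume d: "mdeg \<gamma> = d"
  have "ip d f (mmono \<gamma>) = (\<Sum>\<alpha>\<in>{\<gamma>}. mfact \<alpha> * mcoeff f \<alpha> * cnj (mcoeff (mmono \<gamma>) \<alpha>))"
    unfolding ip_def by (rule sum.mono_neutral_right) (use d in \<open>auto simp: mcoeff_mmono\<close>)
  then show ?thesis by (simp add: mcoeff_mmono)
qed

lemma ip_self_eq_0:
  assumes "ip d f f = 0" "mdeg \<alpha> = d" shows "mcoeff f \<alpha> = 0"
proof -
  define r :: "('a \<Rightarrow> nat) \<Rightarrow> real" where "r \<alpha> = (\<Prod>v\<in>UNIV. fact (\<alpha> v)) * (norm (mcoeff f \<alpha>))\<^sup>2" for \<alpha>
  have "ip d f f = of_real (\<Sum>\<alpha> | mdeg \<alpha> = d. r \<alpha>)"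
    unfolding ip_def of_real_sum
    by (rule sum.cong) (auto simp: r_def mfact_eq_of_real mult.assoc complex_norm_square[symmetric]
        simp del: of_real_prod of_real_fact)
  then have "(\<Sum>\<alpha> | mdeg \<alpha> = d. r \<alpha>) = 0"
    using assms by (simp del: of_real_sum)
  moreover have "r \<alpha> \<ge> 0" for \<alpha>
    by (simp add: r_def prod_nonneg)
  ultimately have "\<forall>\<alpha>\<in>{\<alpha>. mdeg \<alpha> = d}. r \<alpha> = 0"
    by (subst (asm) sum_nonneg_eq_0_iff) simp_all
  then have "r \<alpha> = 0"
    using assms(2) by blast
  then have "(\<Prod>v\<in>UNIV. fact (\<alpha> v)) * (norm (mcoeff f \<alpha>))\<^sup>2 = (0 :: real)"
    by (simp only: r_def)
  then show ?thesis
    by simp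
qed

lemma ip_self_eq_0_imp:
  assumes "ip d e e = 0" shows "ip d f e = 0"
  unfolding ip_def
proof (rule sum.neutral, rule ballI)
  fix \<alpha> :: "'a \<Rightarrow> nat" assume "\<alpha> \<in> {\<alpha>. mdeg \<alpha> = d}"
  then show "mfact \<alpha> * mcoeff f \<alpha> * cnj (mcoeff e \<alpha>) = 0"
    using ip_self_eq_0[OF assms, of \<alpha>] by simp
qed

lemma homogeneous_ip_self:
  assumes "homogeneous d f" "ip d f f = 0" shows "f = 0"
  by (rule mfps_eqI) (use ip_self_eq_0[OF assms(2)] assms(1) in \<open>auto simp: homogeneous_def\<close>)

text \<open>
  Orthogonal projection to a span, as in the Gram-Schmidt process. The vectors may be dependent:
  the inner product is definite, so a new vector whose component \<open>e\<close> orthogonal to the others has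
  norm 0 needs no correction.
\<close>

lemma ip_projection:
  assumes "finite I"
  shows "\<exists>c. \<forall>j\<in>I. ip d (p - (\<Sum>i\<in>I. mconst (c i) * v i)) (v j) = 0"
  using assms
proof (induction I arbitrary: p rule: finite_induct)
  case (insert x I)
  obtain a where a: "\<And>j. j \<in> I \<Longrightarrow> ip d (v x - (\<Sum>i\<in>I. mconst (a i) * v i)) (v j) = 0"
    using insert.IH by meson
  obtain b where b: "\<And>j. j \<in> I \<Longrightarrow> ip d (p - (\<Sum>i\<in>I. mconst (b i) * v i)) (v j) = 0"
    using insert.IH by meson
  define e where "e = v x - (\<Sum>i\<in>I. mconst (a i) * v i)"
  define p' where "p' = p - (\<Sum>i\<in>I. mconst (b i) * v i)"
  define t where "t = ip d p' e / ip d e e"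
  define c where "c i = (if i = x then t else b i - t * a i)" for i
  have "(\<Sum>i\<in>insert x I. mconst (c i) * v i) =
      mconst t * v x + (\<Sum>i\<in>I. mconst (b i - t * a i) * v i)"
    using insert.hyps by (auto simp: c_def intro!: sum.cong)
  also have "\<dots> = mconst t * e + (\<Sum>i\<in>I. mconst (b i) * v i)"
    by (simp add: e_def mconst_diff mconst_mult algebra_simps sum_subtractf sum_distrib_left)
  finally have eq: "p - (\<Sum>i\<in>insert x I. mconst (c i) * v i) = p' - mconst t * e"
    by (simp add: p'_def)
  have orth: "ip d (p' - mconst t * e) (v j) = 0" if "j \<in> I" for j
    using a[OF that] b[OF that] by (simp add: ip_diff_left ip_scale_left e_def p'_def)
  have "ip d (p' - mconst t * e) e = 0"
    by (cases "ip d e e = 0") (simp_all add: ip_self_eq_0_imp t_def ip_diff_left ip_scale_left)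
  moreover have "v x = e + (\<Sum>i\<in>I. mconst (a i) * v i)"
    by (simp add: e_def)
  ultimately have "ip d (p' - mconst t * e) (v x) = 0"
    using orth by (simp add: ip_add_right ip_sum_right ip_scale_right)
  then show ?case
    using eq orth by (intro exI[of _ c]) auto
qed simp

lemma mcoeff_fischer:
  assumes "homogeneous e V"
  shows "mcoeff (fischer V f) \<gamma> =
    (\<Sum>I | mdeg I = e. cnj (mcoeff V I) * (mfact (\<gamma> + I) / mfact \<gamma>) * mcoeff f (\<gamma> + I))"
proof -
  have "mcoeff (fischer V f) \<gamma> =
      (\<Sum>I | mcoeff V I \<noteq> 0. cnj (mcoeff V I) * (mfact (\<gamma> + I) / mfact \<gamma>) * mcoeff f (\<gamma> + I))"
    by (simp add: fischer_def mderivs_def mfact_def prod_dividef mult.assoc)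
  also have "\<dots> = (\<Sum>I | mdeg I = e. cnj (mcoeff V I) * (mfact (\<gamma> + I) / mfact \<gamma>) * mcoeff f (\<gamma> + I))"
    by (rule sum.mono_neutral_left) (use assms in \<open>auto simp: homogeneous_def\<close>)
  finally show ?thesis .
qed

text \<open>
  The Fischer operator of \<open>V\<close> is the adjoint of multiplication by \<open>V\<close>. This turns both kinds of
  normalization conditions into orthogonality to a space of multiples.
\<close>

lemma ip_fischer:
  assumes V: "homogeneous e V"
  shows "ip d (fischer V f) g = ip (e + d) f (V * g)"
proof -
  let ?S = "\<lambda>\<alpha> :: 'a \<Rightarrow> nat. {(\<beta>, \<gamma>). \<beta> + \<gamma> = \<alpha>}"
  let ?t = "\<lambda>I \<gamma>. mfact (I + \<gamma>) * mcoeff f (I + \<gamma>) * cnj (mcoeff V I * mcoeff g \<gamma>)"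
  have "ip d (fischer V f) g = (\<Sum>\<gamma> | mdeg \<gamma> = d. \<Sum>I | mdeg I = e. ?t I \<gamma>)"
    unfolding ip_def mcoeff_fischer[OF V] sum_distrib_right sum_distrib_left
    by (intro sum.cong) (auto simp: field_simps)
  also have "\<dots> = (\<Sum>(\<gamma>, I) \<in> {\<gamma>. mdeg \<gamma> = d} \<times> {I. mdeg I = e}. ?t I \<gamma>)"
    by (rule sum.cartesian_product)
  also have "\<dots> = (\<Sum>(\<alpha>, p) \<in> Sigma {\<alpha>. mdeg \<alpha> = e + d} (\<lambda>\<alpha>. ?S \<alpha> \<inter> {p. mdeg (fst p) = e}). ?t (fst p) (snd p))"
    by (rule sum.reindex_bij_witness[of _ "\<lambda>(\<alpha>, (I, \<gamma>)). (\<gamma>, I)" "\<lambda>(\<gamma>, I). (I + \<gamma>, (I, \<gamma>))"]) auto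
  also have "\<dots> = (\<Sum>\<alpha> | mdeg \<alpha> = e + d. \<Sum>p \<in> ?S \<alpha> \<inter> {p. mdeg (fst p) = e}. ?t (fst p) (snd p))"
    by (rule sum.Sigma[symmetric]) (auto intro: finite_subset[OF _ finite_multi_index_splits])
  also have "\<dots> = (\<Sum>\<alpha> | mdeg \<alpha> = e + d. \<Sum>p \<in> ?S \<alpha>. ?t (fst p) (snd p))"
    by (intro sum.cong sum.mono_neutral_left)
      (use V in \<open>auto simp: finite_multi_index_splits homogeneous_def\<close>)
  also have "\<dots> = ip (e + d) f (V * g)"
    unfolding ip_def mcoeff_mult cnj_sum sum_distrib_left
    by (intro sum.cong) (auto simp: case_prod_unfold)
  finally show ?thesis .
qed

lemma ip_mderiv: "ip d (mderiv v f) g = ip (Suc d) f (mvar v * g)"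
proof -
  have fact: "mfact (\<gamma>(v := Suc (\<gamma> v))) = of_nat (Suc (\<gamma> v)) * mfact \<gamma>" for \<gamma>
  proof -
    have "mfact (\<gamma>(v := Suc (\<gamma> v))) = (\<Prod>u\<in>UNIV. (if u = v then of_nat (Suc (\<gamma> v)) else 1) * fact (\<gamma> u))"
      unfolding mfact_def by (rule prod.cong) auto
    then show ?thesis
      by (simp add: prod.distrib mfact_def del: of_nat_Suc)
  qed
  have deg: "mdeg (\<gamma>(v := Suc (\<gamma> v))) = Suc (mdeg \<gamma>)" for \<gamma>
  proof -
    have "\<gamma>(v := Suc (\<gamma> v)) = \<gamma> + 0(v := 1)" by (auto simp: fun_eq_iff)
    then show ?thesis by (simp only: mdeg_eq_wt wt_add wt_single)
  qed
  have "ip d (mderiv v f) g = (\<Sum>\<alpha> | mdeg \<alpha> = Suc d \<and> \<alpha> v \<noteq> 0. mfact \<alpha> * mcoeff f \<alpha> * cnj (mcoeff (mvar v * g) \<alpha>))"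
    unfolding ip_def
  proof (rule sum.reindex_bij_witness[of _ "\<lambda>\<alpha>. \<alpha>(v := \<alpha> v - 1)" "\<lambda>\<gamma>. \<gamma>(v := Suc (\<gamma> v))"], goal_cases)
    case (4 \<alpha>)
    then have "(\<alpha>(v := \<alpha> v - 1))(v := Suc ((\<alpha>(v := \<alpha> v - 1)) v)) = \<alpha>"
      by auto
    then show ?case
      using 4 deg[of "\<alpha>(v := \<alpha> v - 1)"] by auto
  next
    case (5 \<gamma>)
    show ?case
      unfolding fact mcoeff_mderiv mcoeff_mvar_mult by (simp del: of_nat_Suc)
  qed (auto simp: deg)
  also have "\<dots> = ip (Suc d) f (mvar v * g)"
    unfolding ip_def by (rule sum.mono_neutral_left) (auto simp: mcoeff_mvar_mult)
  finally show ?thesis .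
qed

lemma ip_trace_op: "ip d (trace_op f) g = ip (d + 2) f (quadric * g)"
  by (simp add: trace_op_def quadric_def ip_sum_left ip_mderiv ip_sum_right sum_distrib_right
      mult.assoc mult.left_commute numeral_2_eq_2)

lemma ip_trace_op_power: "ip d ((trace_op ^^ j) f) g = ip (d + 2 * j) f (quadric ^ j * g)"
proof (induction j arbitrary: d g)
  case (Suc j)
  have "ip d ((trace_op ^^ Suc j) f) g = ip (d + 2) ((trace_op ^^ j) f) (quadric * g)"
    by (simp add: ip_trace_op)
  also have "\<dots> = ip (d + 2 * Suc j) f (quadric ^ Suc j * g)"
    by (simp add: Suc mult_ac add_ac)
  finally show ?case .
qed simp

lemma ip_mbar: "ip d (mbar f) (mbar g) = cnj (ip d f g)"
  unfolding ip_def cnj_sum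
proof (rule sum.reindex_bij_witness[of _ swap_index swap_index], goal_cases)
  case (5 \<alpha>)
  have "mfact (swap_index \<alpha>) = mfact \<alpha>"
    by (simp add: mfact_def prod.Plus UNIV_Plus_UNIV[symmetric] mult.commute del: UNIV_Plus_UNIV)
  then show ?case by (simp add: mcoeff_mbar)
qed (auto simp: mdeg_sum)


section \<open>Cancellation of polynomial factors\<close>

text \<open>
  A weight with large, widely spaced values (the powers of \<open>B\<close>) separates finitely many
  multi-indices, so that each polynomial has a unique monomial of least weight.
\<close>

lemma separating_weight:
  assumes "finite A"
  shows "\<exists>\<omega> :: 'v \<Rightarrow> nat. \<forall>\<alpha> \<beta>. (\<forall>v. \<alpha> v < B \<and> \<beta> v < B) \<longrightarrow>
    (\<Sum>v\<in>A. \<omega> v * \<alpha> v) = (\<Sum>v\<in>A. \<omega> v * \<beta> v) \<longrightarrow> (\<forall>v\<in>A. \<alpha> v = \<beta> v)"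
  using assms
proof (induction A rule: finite_induct)
  case (insert x A)
  then obtain \<omega> :: "'v \<Rightarrow> nat" where \<omega>: "\<And>\<alpha> \<beta>. (\<forall>v. \<alpha> v < B \<and> \<beta> v < B) \<Longrightarrow>
    (\<Sum>v\<in>A. \<omega> v * \<alpha> v) = (\<Sum>v\<in>A. \<omega> v * \<beta> v) \<Longrightarrow> (\<forall>v\<in>A. \<alpha> v = \<beta> v)"
    by blast
  \<comment> \<open>The exponent of the new variable is the last digit in base \<open>B\<close>.\<close>
  define \<eta> where "\<eta> v = (if v = x then 1 else B * \<omega> v)" for v
  have \<eta>: "(\<Sum>v\<in>insert x A. \<eta> v * \<alpha> v) = \<alpha> x + B * (\<Sum>v\<in>A. \<omega> v * \<alpha> v)" for \<alpha>
  proof -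
    have "(\<Sum>v\<in>A. \<eta> v * \<alpha> v) = B * (\<Sum>v\<in>A. \<omega> v * \<alpha> v)"
      unfolding sum_distrib_left by (rule sum.cong) (use insert in \<open>auto simp: \<eta>_def\<close>)
    then show ?thesis using insert by (simp add: \<eta>_def)
  qed
  show ?case
  proof (intro exI[of _ \<eta>] allI impI)
    fix \<alpha> \<beta> :: "'v \<Rightarrow> nat"
    assume lt: "\<forall>v. \<alpha> v < B \<and> \<beta> v < B" and eq: "(\<Sum>v\<in>insert x A. \<eta> v * \<alpha> v) = (\<Sum>v\<in>insert x A. \<eta> v * \<beta> v)"
    have "\<alpha> x = \<beta> x"
      using arg_cong[OF eq[unfolded \<eta>], of "\<lambda>k. k mod B"] lt by simp
    moreover have "B \<noteq> 0"
      using lt by (metis not_less0)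
    then have "(\<Sum>v\<in>A. \<omega> v * \<alpha> v) = (\<Sum>v\<in>A. \<omega> v * \<beta> v)"
      using arg_cong[OF eq[unfolded \<eta>], of "\<lambda>k. k div B"] lt by simp
    ultimately show "\<forall>v\<in>insert x A. \<alpha> v = \<beta> v"
      using \<omega>[OF lt] by simp
  qed
qed simp

text \<open>
  With respect to a separating weight, the product of the two monomials of least weight arises
  in the product of the polynomials in only one way and cannot cancel.
\<close>

lemma mult_polys_eq_0:
  fixes f g :: "'v::finite mfps"
  assumes fin: "finite {\<alpha>. mcoeff f \<alpha> \<noteq> 0}" "finite {\<alpha>. mcoeff g \<alpha> \<noteq> 0}" and 0: "f * g = 0"
  shows "f = 0 \<or> g = 0"
proof (rule ccontr)
  assume "\<not> (f = 0 \<or> g = 0)"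
  then have ne: "{\<alpha>. mcoeff f \<alpha> \<noteq> 0} \<noteq> {}" "{\<alpha>. mcoeff g \<alpha> \<noteq> 0} \<noteq> {}"
    by (auto intro: mfps_eqI)
  define S where "S = {\<alpha>. mcoeff f \<alpha> \<noteq> 0} \<union> {\<alpha>. mcoeff g \<alpha> \<noteq> 0}"
  \<comment> \<open>A strict bound for all exponents.\<close>
  define B where "B = Suc (Max (mdeg ` S))"
  have B: "\<alpha> v < B" if "\<alpha> \<in> S" for \<alpha> v
  proof -
    have "\<alpha> v \<le> mdeg \<alpha>" unfolding mdeg_def by (rule member_le_sum) auto
    also have "\<dots> \<le> Max (mdeg ` S)" using that fin by (intro Max_ge) (auto simp: S_def)
    finally show ?thesis by (simp add: B_def)
  qed
  obtain \<omega> :: "'v \<Rightarrow> nat" where "\<forall>\<alpha> \<beta>. (\<forall>v. \<alpha> v < B \<and> \<beta> v < B) \<longrightarrow>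
    (\<Sum>v\<in>UNIV. \<omega> v * \<alpha> v) = (\<Sum>v\<in>UNIV. \<omega> v * \<beta> v) \<longrightarrow> (\<forall>v\<in>UNIV. \<alpha> v = \<beta> v)"
    using separating_weight[OF finite_UNIV, of B] by blast
  then have inj: "\<alpha> = \<beta>" if "\<alpha> \<in> S" "\<beta> \<in> S" "wt \<omega> \<alpha> = wt \<omega> \<beta>" for \<alpha> \<beta>
    using that B unfolding wt_def by blast
  obtain a where a: "mcoeff f a \<noteq> 0" "\<And>\<alpha>. mcoeff f \<alpha> \<noteq> 0 \<Longrightarrow> wt \<omega> a \<le> wt \<omega> \<alpha>"
    using ex_min_if_finite[of "wt \<omega> ` {\<alpha>. mcoeff f \<alpha> \<noteq> 0}"] fin ne
    by (force simp: not_less)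
  obtain b where b: "mcoeff g b \<noteq> 0" "\<And>\<alpha>. mcoeff g \<alpha> \<noteq> 0 \<Longrightarrow> wt \<omega> b \<le> wt \<omega> \<alpha>"
    using ex_min_if_finite[of "wt \<omega> ` {\<alpha>. mcoeff g \<alpha> \<noteq> 0}"] fin ne
    by (force simp: not_less)
  have "mcoeff (f * g) (a + b) = (\<Sum>(\<beta>, \<gamma>)\<in>{(a, b)}. mcoeff f \<beta> * mcoeff g \<gamma>)"
    unfolding mcoeff_mult
  proof (rule sum.mono_neutral_right)
    have "mcoeff f \<beta> * mcoeff g \<gamma> = 0" if "\<beta> + \<gamma> = a + b" "(\<beta>, \<gamma>) \<noteq> (a, b)" for \<beta> \<gamma>
    proof (rule ccontr)
      assume "mcoeff f \<beta> * mcoeff g \<gamma> \<noteq> 0"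
      then have nz: "mcoeff f \<beta> \<noteq> 0" "mcoeff g \<gamma> \<noteq> 0" by auto
      have "wt \<omega> \<beta> + wt \<omega> \<gamma> = wt \<omega> a + wt \<omega> b"
        using arg_cong[OF that(1), of "wt \<omega>"] by simp
      then have "wt \<omega> \<beta> = wt \<omega> a" "wt \<omega> \<gamma> = wt \<omega> b"
        using a(2)[OF nz(1)] b(2)[OF nz(2)] by linarith+
      then have "\<beta> = a" "\<gamma> = b"
        using nz a(1) b(1) inj by (auto simp: S_def)
      then show False using that by simp
    qed
    then show "\<forall>i\<in>{(\<beta>, \<gamma>). \<beta> + \<gamma> = a + b} - {(a, b)}. (case i of (\<beta>, \<gamma>) \<Rightarrow> mcoeff f \<beta> * mcoeff g \<gamma>) = 0"
      by (intro ballI, elim DiffE CollectE case_prodE) simp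
  qed (auto simp: finite_multi_index_splits)
  then show False
    using 0 a b by simp
qed

lemma homogeneous_finite: "homogeneous d f \<Longrightarrow> finite {\<alpha>. mcoeff f \<alpha> \<noteq> 0}"
  by (rule finite_subset[OF _ finite_mdeg_eq[of d]]) (auto simp: homogeneous_def)

lemma homogeneous_mult: "homogeneous d f \<Longrightarrow> homogeneous e g \<Longrightarrow> homogeneous (d + e) (f * g)"
  unfolding homogeneous_def by (metis mcoeff_mult_nonzeroE mdeg_add)

lemma homogeneous_1: "homogeneous 0 1"
  by (auto simp: homogeneous_def mcoeff_1 split: if_splits)

lemma homogeneous_power: "homogeneous d f \<Longrightarrow> homogeneous (n * d) (f ^ n)"
  by (induction n) (auto intro: homogeneous_mult homogeneous_1)

lemma homogeneous_0 [simp]: "homogeneous d 0"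
  by (simp add: homogeneous_def)

lemma homogeneous_add: "homogeneous d f \<Longrightarrow> homogeneous d g \<Longrightarrow> homogeneous d (f + g)"
  unfolding homogeneous_def by (metis add.right_neutral mcoeff_add)

lemma homogeneous_diff: "homogeneous d f \<Longrightarrow> homogeneous d g \<Longrightarrow> homogeneous d (f - g)"
  unfolding homogeneous_def by (metis diff_self eq_iff_diff_eq_0 mcoeff_diff)

lemma homogeneous_sum: "(\<And>i. i \<in> A \<Longrightarrow> homogeneous d (f i)) \<Longrightarrow> homogeneous d (\<Sum>i\<in>A. f i)"
  by (induction A rule: infinite_finite_induct) (auto intro: homogeneous_add)

lemma homogeneous_mconst_mult: "homogeneous d f \<Longrightarrow> homogeneous d (mconst c * f)"
  by (simp add: homogeneous_def)

lemma homogeneous_mvar: "homogeneous 1 (mvar v)"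
  by (auto simp: homogeneous_def mcoeff_mvar mdeg_eq_wt simp del: fun_upd_apply split: if_splits)

lemma homogeneous_mderiv:
  assumes "homogeneous d f" shows "homogeneous (d - 1) (mderiv v f)"
  unfolding homogeneous_def
proof (intro allI impI)
  fix \<alpha> assume "mcoeff (mderiv v f) \<alpha> \<noteq> 0"
  then have "mdeg (\<alpha>(v := Suc (\<alpha> v))) = d"
    using assms by (auto simp: mcoeff_mderiv homogeneous_def)
  moreover have "\<alpha>(v := Suc (\<alpha> v)) = \<alpha> + 0(v := 1)" by (auto simp: fun_eq_iff)
  ultimately show "mdeg \<alpha> = d - 1"
    by (simp only: mdeg_eq_wt wt_add wt_single)
qed

lemma bihomogeneous_imp_homogeneous: "bihomogeneous m n f \<Longrightarrow> homogeneous (m + n) f"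
  by (auto simp: bihomogeneous_iff homogeneous_def mdeg_sum)

lemma ip_homogeneous_neq: "homogeneous e f \<Longrightarrow> e \<noteq> d \<Longrightarrow> ip d f g = 0"
  by (auto simp: ip_def homogeneous_def intro!: sum.neutral)

lemma mult_homogeneous_eq_0:
  "homogeneous d f \<Longrightarrow> homogeneous e g \<Longrightarrow> f * g = 0 \<Longrightarrow> f = 0 \<or> g = 0"
  using mult_polys_eq_0 homogeneous_finite by blast

lemma power_homogeneous_eq_0:
  "homogeneous d f \<Longrightarrow> f ^ n = 0 \<Longrightarrow> f = 0"
proof (induction n)
  case (Suc n)
  then show ?case
    using mult_homogeneous_eq_0[OF Suc.prems(1) homogeneous_power[OF Suc.prems(1), of n]] by auto
qed simp


section \<open>Fischer decompositions\<close>

lemma fischer_eq_0I: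
  assumes "homogeneous e V" "homogeneous (e + d) q"
    "\<And>\<gamma>. mdeg \<gamma> = d \<Longrightarrow> ip (e + d) q (V * mmono \<gamma>) = 0"
  shows "fischer V q = 0"
proof (rule mfps_eqI)
  fix \<gamma>
  have "ip (mdeg \<gamma>) (fischer V q) (mmono \<gamma>) = 0"
    using assms by (cases "mdeg \<gamma> = d") (auto simp: ip_fischer ip_homogeneous_neq)
  then show "mcoeff (fischer V q) \<gamma> = mcoeff 0 \<gamma>"
    by (simp add: ip_mmono)
qed

lemma fischer_orthogonal:
  "homogeneous e V \<Longrightarrow> fischer V q = 0 \<Longrightarrow> ip (e + d) q (V * g) = 0"
  using ip_fischer[of e V d q g] by simp

lemma trace_op_power_eq_0I:
  assumes "bihomogeneous m n C"
    "\<And>\<gamma>. zdeg \<gamma> + j = m \<Longrightarrow> bdeg \<gamma> + j = n \<Longrightarrow> ip (m + n) C (quadric ^ j * mmono \<gamma>) = 0"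
  shows "(trace_op ^^ j) C = 0"
proof (rule mfps_eqI)
  fix \<gamma> :: "'a + 'a \<Rightarrow> nat"
  have "ip (mdeg \<gamma> + 2 * j) C (quadric ^ j * mmono \<gamma>) = 0"
  proof (cases "zdeg \<gamma> + j = m \<and> bdeg \<gamma> + j = n")
    case True
    then have "mdeg \<gamma> + 2 * j = m + n" by (auto simp: mdeg_sum)
    then show ?thesis using True assms(2) by simp
  next
    case False
    have "bihomogeneous (zdeg \<gamma>) (bdeg \<gamma>) (mmono \<gamma>)"
      by (auto simp: bihomogeneous_iff mcoeff_mmono split: if_splits)
    from bihomogeneous_mult[OF bihomogeneous_quadric_power this]
    have "mcoeff C \<alpha> = 0 \<or> mcoeff (quadric ^ j * mmono \<gamma>) \<alpha> = 0" for \<alpha>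
      using False assms(1) unfolding bihomogeneous_iff by (metis add.commute)
    then show ?thesis
      unfolding ip_def by (intro sum.neutral) auto
  qed
  then have "ip (mdeg \<gamma>) ((trace_op ^^ j) C) (mmono \<gamma>) = 0"
    by (simp add: ip_trace_op_power)
  then show "mcoeff ((trace_op ^^ j) C) \<gamma> = mcoeff 0 \<gamma>"
    by (simp add: ip_mmono)
qed

text \<open>
  \<open>quadric ^ j * A\<close> is the orthogonal projection of \<open>P\<close> to the multiples of \<open>quadric ^ j\<close>. The rest is
  orthogonal to them, which says by adjointness that the \<open>j\<close>-th power of the trace annihilates it.
\<close>

lemma trace_decomposition:
  assumes P: "bihomogeneous (m + j) (n + j) P"
  obtains A C where "P = quadric ^ j * A + C" "bihomogeneous m n A"
    "bihomogeneous (m + j) (n + j) C" "(trace_op ^^ j) C = 0"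
proof -
  define K where "K = {\<gamma> :: 'a + 'a \<Rightarrow> nat. zdeg \<gamma> = m \<and> bdeg \<gamma> = n}"
  have K: "finite K"
    unfolding K_def by (rule finite_subset[OF _ finite_multi_index_mdeg[of "m + n"]]) (auto simp: mdeg_sum)
  obtain c where c: "\<And>\<gamma>. \<gamma> \<in> K \<Longrightarrow> ip (m + j + (n + j))
      (P - (\<Sum>\<beta>\<in>K. mconst (c \<beta>) * (quadric ^ j * mmono \<beta>))) (quadric ^ j * mmono \<gamma>) = 0"
    using ip_projection[OF K, of "m + j + (n + j)" P "\<lambda>\<gamma>. quadric ^ j * mmono \<gamma>"] by blast
  define A where "A = (\<Sum>\<beta>\<in>K. mconst (c \<beta>) * mmono \<beta>)"
  have A: "bihomogeneous m n A"
    unfolding A_def by (intro bihomogeneous_sum bihomogeneous_mconst_mult)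
      (auto simp: bihomogeneous_iff mcoeff_mmono K_def split: if_splits)
  have QA: "(\<Sum>\<beta>\<in>K. mconst (c \<beta>) * (quadric ^ j * mmono \<beta>)) = quadric ^ j * A"
    by (simp add: A_def sum_distrib_left mult_ac)
  have C: "bihomogeneous (m + j) (n + j) (P - quadric ^ j * A)"
    using bihomogeneous_mult[OF bihomogeneous_quadric_power[of j] A] P
    by (simp add: add.commute bihomogeneous_diff)
  have "(trace_op ^^ j) (P - quadric ^ j * A) = 0"
    by (rule trace_op_power_eq_0I[OF C]) (use c QA in \<open>auto simp: K_def\<close>)
  then show ?thesis
    using that[of A "P - quadric ^ j * A"] A C by simp
qed

lemma quadric_nonzero: "quadric \<noteq> (0 :: ('n::finite + 'n) mfps)"
proof
  assume 0: "quadric = (0 :: ('n + 'n) mfps)"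
  fix k :: 'n
  have "mcoeff (mvar (Inl j) * mvar (Inr j)) (0(Inl k := 1, Inr k := 1)) = (if j = k then 1 else 0)" for j :: 'n
    by (auto simp: mcoeff_mvar_mult mcoeff_mvar fun_eq_iff)
  then have "mcoeff quadric (0(Inl k := 1, Inr k := 1)) = 1"
    by (simp add: quadric_def del: fun_upd_apply)
  then show False using 0 by simp
qed

text \<open>The two summands are orthogonal, and the quadric is not a zero divisor.\<close>

lemma trace_decomposition_unique:
  assumes "bihomogeneous m n A" "bihomogeneous (m + j) (n + j) C" "(trace_op ^^ j) C = 0"
    "quadric ^ j * A + C = 0"
  shows "A = 0" "C = 0"
proof -
  have QA: "bihomogeneous (m + j) (n + j) (quadric ^ j * A)"
    using bihomogeneous_mult[OF bihomogeneous_quadric_power[of j] assms(1)] by (simp add: add.commute)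
  have eq: "quadric ^ j * A = - C"
    using assms(4) by (simp add: add_eq_0_iff2)
  have "ip (m + n + 2 * j) C (quadric ^ j * A) = ip (m + n) ((trace_op ^^ j) C) A"
    by (simp add: ip_trace_op_power)
  then have "ip (m + n + 2 * j) (quadric ^ j * A) (quadric ^ j * A) = 0"
    using assms(3) ip_diff_left[of "m + n + 2 * j" 0 C "quadric ^ j * A"] by (simp add: eq)
  then have 0: "quadric ^ j * A = 0"
    using bihomogeneous_imp_homogeneous[OF QA] homogeneous_ip_self by (metis add.assoc add.commute mult_2)
  then show "C = 0" using assms(4) by simp
  have "homogeneous 2 (quadric :: ('a + 'a) mfps)"
    using bihomogeneous_imp_homogeneous[OF bihomogeneous_quadric] by (simp add: numeral_2_eq_2)
  then show "A = 0"
    using mult_homogeneous_eq_0[OF homogeneous_power bihomogeneous_imp_homogeneous[OF assms(1)] 0]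
      power_homogeneous_eq_0 quadric_nonzero by blast
qed


section \<open>Series in $z$ and $w$ and their restrictions\<close>

lemma euler_z:
  assumes "bihomogeneous m n f"
  shows "(\<Sum>k\<in>UNIV. mvar (Inl k) * mderiv (Inl k) f) = mconst (of_nat m) * f"
proof (rule mfps_eqI)
  fix \<alpha>
  have "mcoeff (mvar (Inl k) * mderiv (Inl k) f) \<alpha> = of_nat (\<alpha> (Inl k)) * mcoeff f \<alpha>" for k
    by (cases "\<alpha> (Inl k) = 0") (simp_all add: mcoeff_mvar_mult mcoeff_mderiv)
  then have "mcoeff (\<Sum>k\<in>UNIV. mvar (Inl k) * mderiv (Inl k) f) \<alpha> = of_nat (zdeg \<alpha>) * mcoeff f \<alpha>"
    by (simp add: zdeg_def sum_distrib_right)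
  then show "mcoeff (\<Sum>k\<in>UNIV. mvar (Inl k) * mderiv (Inl k) f) \<alpha> = mcoeff (mconst (of_nat m) * f) \<alpha>"
    using assms by (auto simp: bihomogeneous_iff)
qed

lemma bihomogeneous_mderiv_Inl:
  assumes "bihomogeneous m n f" shows "bihomogeneous (m - 1) n (mderiv (Inl k) f)"
  unfolding bihomogeneous_iff
proof (intro allI impI)
  fix \<alpha> assume "mcoeff (mderiv (Inl k) f) \<alpha> \<noteq> 0"
  then have "zdeg (\<alpha>(Inl k := Suc (\<alpha> (Inl k)))) = m" "bdeg (\<alpha>(Inl k := Suc (\<alpha> (Inl k)))) = n"
    using assms by (auto simp: mcoeff_mderiv bihomogeneous_iff)
  moreover have "\<alpha>(Inl k := Suc (\<alpha> (Inl k))) = \<alpha> + 0(Inl k := 1)" by (auto simp: fun_eq_iff)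
  ultimately show "zdeg \<alpha> = m - 1 \<and> bdeg \<alpha> = n"
    by (simp only: zdeg_add bdeg_add zdeg_single) simp
qed

text \<open>\<open>lift p l\<close> is the series $p(z) w^l$.\<close>

definition lift :: "'n mfps \<Rightarrow> nat \<Rightarrow> 'n option mfps" where
  "lift p l = Abs_mfps (\<lambda>\<beta>. if \<beta> None = l then mcoeff p (\<beta> \<circ> Some) else 0)"

lemma mcoeff_lift: "mcoeff (lift p l) \<beta> = (if \<beta> None = l then mcoeff p (\<beta> \<circ> Some) else 0)"
  by (simp add: lift_def)

definition oindex :: "nat \<Rightarrow> ('n \<Rightarrow> nat) \<Rightarrow> ('n option \<Rightarrow> nat)" where
  "oindex l \<gamma> = case_option l \<gamma>"

lemma oindex_simps [simp]: "oindex l \<gamma> None = l" "oindex l \<gamma> \<circ> Some = \<gamma>" "oindex l \<gamma> (Some k) = \<gamma> k"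
  by (auto simp: oindex_def)

lemma oindex_eq: "oindex (\<beta> None) (\<beta> \<circ> Some) = \<beta>"
  by (auto simp: oindex_def fun_eq_iff split: option.splits)

lemma prod_option: "(\<Prod>x\<in>(UNIV :: 'n::finite option set). f x) = f None * (\<Prod>k\<in>UNIV. f (Some k))"
  by (simp add: UNIV_option_conv prod.reindex)

lemma sum_option: "(\<Sum>x\<in>(UNIV :: 'n::finite option set). f x) = f None + (\<Sum>k\<in>UNIV. f (Some k))"
  by (simp add: UNIV_option_conv sum.reindex)

lemma restrict_to_lift_finite:
  assumes fin: "finite {\<gamma>. mcoeff p \<gamma> \<noteq> 0}" and u: "mcoeff u 0 = 0"
  shows "restrict_to u (lift p l) = of_hol p * u ^ l"
proof -
  let ?B = "{\<gamma>. mcoeff p \<gamma> \<noteq> 0}"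
  let ?g = "case_option u (\<lambda>k. mvar (Inl k))"
  have "msubst (lift p l) ?g =
      (\<Sum>\<beta>\<in>oindex l ` ?B. mconst (mcoeff (lift p l) \<beta>) * mpow ?g \<beta>)"
  proof (rule msubst_finite)
    show "{\<beta>. mcoeff (lift p l) \<beta> \<noteq> 0} \<subseteq> oindex l ` ?B"
    proof safe
      fix \<beta> assume "mcoeff (lift p l) \<beta> \<noteq> 0"
      then show "\<beta> \<in> oindex l ` ?B"
        by (intro image_eqI[of _ _ "\<beta> \<circ> Some"]) (auto simp: mcoeff_lift oindex_eq split: if_splits)
    qed
  qed (use fin u in \<open>auto split: option.splits\<close>)
  also have "\<dots> = (\<Sum>\<gamma>\<in>?B. mconst (mcoeff p \<gamma>) * (mpow (\<lambda>k. mvar (Inl k)) \<gamma> * u ^ l))"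
  proof (subst sum.reindex)
    show "inj_on (oindex l) ?B"
      by (rule inj_onI) (metis oindex_simps(2))
  qed (auto simp: mcoeff_lift mpow_def prod_option mult_ac intro!: sum.cong)
  also have "\<dots> = of_hol p * u ^ l"
    unfolding of_hol_def
    by (subst msubst_finite[OF _ fin order_refl]) (simp_all add: sum_distrib_left mult_ac)
  finally show ?thesis by (simp add: restrict_to_def)
qed

lemma restrict_to_lift:
  "homogeneous d p \<Longrightarrow> mcoeff u 0 = 0 \<Longrightarrow> restrict_to u (lift p l) = of_hol p * u ^ l"
  by (rule restrict_to_lift_finite[OF homogeneous_finite])

lemma restrict_to_add: "restrict_to u (f + g) = restrict_to u f + restrict_to u g"
  by (simp add: restrict_to_def msubst_add)

lemma restrict_to_uminus: "restrict_to u (- f) = - restrict_to u f"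
  by (simp add: restrict_to_def msubst_uminus)

lemma restrict_to_0 [simp]: "restrict_to u 0 = 0"
  by (simp add: restrict_to_def)

definition odeg :: "('n::finite option \<Rightarrow> nat) \<Rightarrow> nat" where
  "odeg \<beta> = (\<Sum>k\<in>UNIV. \<beta> (Some k))"

lemma wt_option: "wt (case_option a (\<lambda>_. b)) \<beta> = b * odeg \<beta> + a * \<beta> None"
  by (simp add: wt_def sum_option odeg_def sum_distrib_left)

lemma mdeg_comp_Some: "mdeg (\<beta> \<circ> Some) = odeg \<beta>"
  by (simp add: mdeg_def odeg_def)

abbreviation vz :: "nat \<Rightarrow> nat \<Rightarrow> nat \<Rightarrow> ('n::finite + 'n) mfps \<Rightarrow> bool" where
  "vz a b \<equiv> vge (wt (zw a b))"

lemma vz_bihom: "bihomogeneous m n f \<Longrightarrow> W \<le> a * m + b * n \<Longrightarrow> vz a b W f"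
  by (rule vge_bihomogeneous)

lemma vz_bihom_mult:
  "bihomogeneous m n f \<Longrightarrow> vz a b V g \<Longrightarrow> W \<le> a * m + b * n + V \<Longrightarrow> vz a b W (f * g)"
  by (erule vge_mult'[OF vge_bihomogeneous[OF _ order_refl]])


section \<open>The linearized equation\<close>

definition trace_normal :: "('n::finite + 'n) mfps \<Rightarrow> bool" where
  "trace_normal r \<longleftrightarrow> (\<forall>m n. m \<noteq> 0 \<longrightarrow> n \<noteq> 0 \<longrightarrow>
     (m < n \<longrightarrow> (trace_op ^^ (m - 1)) (bipart m n r) = 0) \<and>
     (n \<le> m \<longrightarrow> (trace_op ^^ n) (bipart m n r) = 0))"

definition mixed :: "('n::finite + 'n) mfps \<Rightarrow> bool" where
  "mixed r \<longleftrightarrow> (\<forall>\<alpha>. mcoeff r \<alpha> \<noteq> 0 \<longrightarrow> zdeg \<alpha> \<noteq> 0 \<and> bdeg \<alpha> \<noteq> 0)"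

lemma trace_op_add: "trace_op (f + g) = trace_op f + trace_op g"
  by (simp add: trace_op_def mderiv_add sum.distrib)

lemma trace_op_power_add: "(trace_op ^^ j) (f + g) = (trace_op ^^ j) f + (trace_op ^^ j) g"
  by (induction j) (simp_all add: trace_op_add)

lemma trace_op_uminus: "trace_op (- f) = - trace_op f"
proof -
  have "trace_op (0 :: ('a + 'a) mfps) = 0"
    using trace_op_add[of 0 0] by simp
  then have "trace_op f + trace_op (- f) = 0"
    by (simp flip: trace_op_add)
  then show ?thesis
    by (simp add: eq_neg_iff_add_eq_0 add.commute)
qed

lemma trace_op_power_uminus: "(trace_op ^^ j) (- f) = - (trace_op ^^ j) f"
  by (induction j) (simp_all add: trace_op_uminus)

lemma trace_op_power_0 [simp]: "(trace_op ^^ j) 0 = 0"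
  using trace_op_power_add[of j 0 0] by simp

lemma trace_normal_add: "trace_normal r \<Longrightarrow> trace_normal r' \<Longrightarrow> trace_normal (r + r')"
  unfolding trace_normal_def bipart_add trace_op_power_add by simp

lemma trace_normal_uminus: "trace_normal r \<Longrightarrow> trace_normal (- r)"
  unfolding trace_normal_def bipart_uminus trace_op_power_uminus by simp

lemma trace_normal_0 [simp]: "trace_normal 0"
  by (simp add: trace_normal_def)

lemma mixed_add: "mixed r \<Longrightarrow> mixed r' \<Longrightarrow> mixed (r + r')"
  unfolding mixed_def by (metis add.right_neutral mcoeff_add)

lemma mixed_uminus: "mixed r \<Longrightarrow> mixed (- r)"
  by (simp add: mixed_def)

lemma mixed_0 [simp]: "mixed 0"
  by (simp add: mixed_def)

text \<open>
  \<open>D\<close> is the lowest pure term \<open>\<phi>\<^sub>s\<^sub>,\<^sub>0\<close>, as a series in $(z, \overline z)$. The given equation agrees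
  to leading order with the model \<open>w = u\<close>.
\<close>

locale model =
  fixes D :: "('n::finite + 'n) mfps" and s :: nat
  assumes D: "bihomogeneous s 0 D" and s3: "s \<ge> 3"
begin

abbreviation Db where "Db \<equiv> mbar D"
abbreviation Q where "Q \<equiv> quadric :: ('n + 'n) mfps"
abbreviation Dk where "Dk k \<equiv> mderiv (Inl k) D"

definition u :: "('n + 'n) mfps" where "u = Q + D + Db"

lemma Db: "bihomogeneous 0 s Db"
  using D by (rule bihomogeneous_mbar)

lemma Q: "bihomogeneous 1 1 Q"
  using bihomogeneous_quadric by simp

lemma Dk: "bihomogeneous (s - 1) 0 (Dk k)"
  using D by (rule bihomogeneous_mderiv_Inl)

lemma mbar_u [simp]: "mbar u = u"
  by (simp add: u_def add_ac)

lemma s_sq: "2 * s \<le> s * (s - 1)"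
  using s3 by (metis mult.commute mult_le_mono1 One_nat_def Suc_1 diff_le_mono numeral_3_eq_3 diff_Suc_1)

lemma s_mult: "2 * k \<le> (s - 1) * k" "k + (s - 2) * k = (s - 1) * k"
proof -
  show "2 * k \<le> (s - 1) * k" using s3 by (intro mult_le_mono1) simp
  have "s - 1 = Suc (s - 2)" using s3 by simp
  then show "k + (s - 2) * k = (s - 1) * k" by simp
qed

lemma weight_side: "n \<le> m \<Longrightarrow> m + (s - 1) * n \<le> (s - 1) * m + n"
proof -
  assume "n \<le> m"
  then obtain k where m: "m = n + k" using le_Suc_ex by blast
  show ?thesis
    using s_mult(1)[of k] unfolding m add_mult_distrib2 by linarith
qed

lemma u_ord: "vz 1 (s - 1) s u" "vz (s - 1) 1 s u" "vz 1 1 2 u"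
  unfolding u_def using s3 s_sq
  by (auto intro!: vge_add vz_bihom[OF D] vz_bihom[OF Db] vz_bihom[OF Q] simp: mult.commute)

lemma u_pow_ord: "vz 1 (s - 1) (l * s) (u ^ l)" "vz (s - 1) 1 (l * s) (u ^ l)" "vz 1 1 (l * 2) (u ^ l)"
  by (intro vge_power u_ord)+

lemma u_Q_ord: "vz 1 (s - 1) (l * s) (u ^ l - Q ^ l)" "vz (s - 1) 1 (l * s) (u ^ l - Q ^ l)"
  "vz 1 1 (l * 2 + 1) (u ^ l - Q ^ l)"
proof -
  have Ql: "vz 1 (s - 1) (l * s) (Q ^ l)" "vz (s - 1) 1 (l * s) (Q ^ l)"
    using s3 by (auto intro!: vz_bihom[OF bihomogeneous_quadric_power] simp: algebra_simps diff_mult_distrib2)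
  then show "vz 1 (s - 1) (l * s) (u ^ l - Q ^ l)" "vz (s - 1) 1 (l * s) (u ^ l - Q ^ l)"
    by (intro vge_diff u_pow_ord; simp)+
  have "vz 1 1 (2 + 1) (u - Q)"
    unfolding u_def using s3 by (auto intro!: vge_add vz_bihom[OF D] vz_bihom[OF Db])
  then show "vz 1 1 (l * 2 + 1) (u ^ l - Q ^ l)"
    using vge_power_diff[OF vz_bihom[OF Q, of 2 1 1] u_ord(3), of 1 l] by simp
qed

lemma u_0 [simp]: "mcoeff u 0 = 0"
  using vgeD[OF u_ord(3), of 0] by simp

text \<open>
  Of the two weights $(1, s - 1)$ and $(s - 1, 1)$ for $(z, \overline z)$, the first gives \<open>Q\<close> and \<open>D\<close> order
  \<open>s\<close> and makes $\overline D$ negligible, and the second exchanges the roles of \<open>D\<close> and $\overline D$.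
  Bounding both orders gives a filtration that is invariant under conjugation.
\<close>

definition small :: "nat \<Rightarrow> ('n + 'n) mfps \<Rightarrow> bool" where
  "small W h \<longleftrightarrow> vz 1 (s - 1) W h \<and> vz (s - 1) 1 W h"

abbreviation levR :: "('n + 'n \<Rightarrow> nat) \<Rightarrow> nat" where
  "levR \<alpha> \<equiv> min (wt (zw 1 (s - 1)) \<alpha>) (wt (zw (s - 1) 1) \<alpha>)"

lemma smallI: "vz 1 (s - 1) W h \<Longrightarrow> vz (s - 1) 1 W h \<Longrightarrow> small W h"
  by (simp add: small_def)

lemma small_add: "small W f \<Longrightarrow> small W g \<Longrightarrow> small W (f + g)"
  by (auto simp: small_def intro: vge_add)

lemma small_diff: "small W f \<Longrightarrow> small W g \<Longrightarrow> small W (f - g)"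
  by (auto simp: small_def intro: vge_diff)

lemma small_uminus [simp]: "small W (- f) \<longleftrightarrow> small W f"
  by (auto simp: small_def)

lemma small_0 [simp]: "small W 0"
  by (auto simp: small_def)

lemma small_sum: "(\<And>i. i \<in> A \<Longrightarrow> small W (f i)) \<Longrightarrow> small W (\<Sum>i\<in>A. f i)"
  by (auto simp: small_def intro: vge_sum)

lemma small_mono: "small W f \<Longrightarrow> V \<le> W \<Longrightarrow> small V f"
  by (auto simp: small_def intro: vge_mono)

lemma small_mbar [simp]: "small W (mbar f) \<longleftrightarrow> small W f"
  by (auto simp: small_def vge_mbar)

lemma small_bihom: "bihomogeneous m n f \<Longrightarrow> W \<le> m + (s - 1) * n \<Longrightarrow> W \<le> (s - 1) * m + n \<Longrightarrow> small W f"
  by (rule smallI; erule vz_bihom) simp_all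

lemma small_bihom_u:
  assumes "bihomogeneous m n f" "W \<le> m + (s - 1) * n + l * s" "W \<le> (s - 1) * m + n + l * s"
  shows "small W (f * u ^ l)"
  by (rule smallI; rule vz_bihom_mult[OF assms(1)], rule u_pow_ord) (use assms(2,3) in simp_all)

lemma small_bihom_uQ:
  assumes "bihomogeneous m n f" "W \<le> m + (s - 1) * n + l * s" "W \<le> (s - 1) * m + n + l * s"
  shows "small W (f * (u ^ l - Q ^ l))"
  by (rule smallI; rule vz_bihom_mult[OF assms(1)], rule u_Q_ord) (use assms(2,3) in simp_all)

lemma deg_bihom_u:
  assumes "bihomogeneous m n f" "d \<le> m + n + 2 * l"
  shows "vz 1 1 d (f * u ^ l)"
  by (rule vz_bihom_mult[OF assms(1)], rule u_pow_ord) (use assms(2) in simp)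

lemma deg_bihom_uQ:
  assumes "bihomogeneous m n f" "d \<le> m + n + 2 * l + 1"
  shows "vz 1 1 d (f * (u ^ l - Q ^ l))"
  by (rule vz_bihom_mult[OF assms(1)], rule u_Q_ord) (use assms(2) in simp)

lemma small_bihom_iff:
  assumes "bihomogeneous m n f" "f \<noteq> 0"
  shows "small W f \<longleftrightarrow> W \<le> m + (s - 1) * n \<and> W \<le> (s - 1) * m + n"
proof
  assume sm: "small W f"
  obtain \<alpha> where \<alpha>: "mcoeff f \<alpha> \<noteq> 0" using assms(2) by (metis mcoeff_0 mfps_eqI)
  then have "zdeg \<alpha> = m" "bdeg \<alpha> = n" using assms(1) by (auto simp: bihomogeneous_iff)
  then show "W \<le> m + (s - 1) * n \<and> W \<le> (s - 1) * m + n"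
    using sm \<alpha> by (auto simp: small_def vge_def wt_sum)
qed (use small_bihom[OF assms(1)] in auto)

lemma small_mcoeff:
  "small W f \<longleftrightarrow> (\<forall>\<alpha>. mcoeff f \<alpha> \<noteq> 0 \<longrightarrow> W \<le> zdeg \<alpha> + (s - 1) * bdeg \<alpha> \<and> W \<le> (s - 1) * zdeg \<alpha> + bdeg \<alpha>)"
  by (auto simp: small_def vge_def wt_sum)

lemma small_bipart: "small W f \<Longrightarrow> small W (bipart m n f)"
  by (auto simp: small_mcoeff mcoeff_bipart)

abbreviation rs :: "'n option mfps \<Rightarrow> ('n + 'n) mfps" where "rs \<equiv> restrict_to u"

text \<open>
  The level of a monomial of $F_k$ is the lowest level of its contribution to the linearized operator
  below. There it is multiplied by $\overline z_k + D_k$, which has the order \<open>s - 1\<close> in one weight and 1 in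
  the other; the minimum of the two orders is attained in the first weight for monomials with a
  factor $z_j$, and in the second for powers of $w$.
\<close>

definition levF :: "('n option \<Rightarrow> nat) \<Rightarrow> nat" where
  "levF \<beta> = (if odeg \<beta> = 0 then \<beta> None * s + 1 else odeg \<beta> + \<beta> None * s + s - 1)"

definition levG :: "('n option \<Rightarrow> nat) \<Rightarrow> nat" where
  "levG \<beta> = odeg \<beta> + \<beta> None * s"

text \<open>
  The terms by which $F = z + f$ enters the linearized equation: $\overline z_k + D_k$ is the derivative
  of \<open>u\<close> in $z_k$.
\<close>

definition H :: "('n \<Rightarrow> 'n option mfps) \<Rightarrow> ('n + 'n) mfps" where
  "H f = (\<Sum>k\<in>UNIV. (mvar (Inr k) + Dk k) * rs (f k))"

definition L :: "('n \<Rightarrow> 'n option mfps) \<Rightarrow> 'n option mfps \<Rightarrow> ('n + 'n) mfps \<Rightarrow> ('n + 'n) mfps" where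
  "L f g r = rs g - H f - mbar (H f) - r"

lemma H_add: "H (\<lambda>k. f k + f' k) = H f + H f'"
  by (simp add: H_def restrict_to_add distrib_left sum.distrib)

lemma H_uminus: "H (\<lambda>k. - f k) = - H f"
  by (simp add: H_def restrict_to_uminus sum_negf)

lemma H_0 [simp]: "H (\<lambda>k. 0) = 0"
  by (simp add: H_def)

lemma L_add: "L (\<lambda>k. f k + f' k) (g + g') (r + r') = L f g r + L f' g' r'"
  by (simp add: L_def H_add restrict_to_add)

lemma L_uminus: "L (\<lambda>k. - f k) (- g) (- r) = - L f g r"
  by (simp add: L_def H_uminus restrict_to_uminus)

text \<open>
  The image, to leading order at level \<open>W\<close>, of the linearized operator on those unknowns in which
  \<open>F\<close> has only terms of degree at least 2 in \<open>z\<close> and the normal form has no pure terms. The terms of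
  \<open>F\<close> of degree at most 1 in \<open>z\<close> are the parameters that remain to be fixed by the Fischer conditions.
\<close>

definition Im0 :: "nat \<Rightarrow> ('n + 'n) mfps \<Rightarrow> bool" where
  "Im0 W y \<longleftrightarrow> (\<exists>f g r. (\<forall>k. vge levF W (f k) \<and> vge odeg 2 (f k)) \<and> vge levG W g \<and>
     small W r \<and> trace_normal r \<and> mixed r \<and> small (W + 1) (y - L f g r))"

lemma Im0_small: "small (W + 1) y \<Longrightarrow> Im0 W y"
  unfolding Im0_def
  by (rule exI[of _ "\<lambda>_. 0"], rule exI[of _ 0], rule exI[of _ 0]) (simp add: L_def)

lemma Im0_add: assumes "Im0 W y" "Im0 W y'" shows "Im0 W (y + y')"
proof -
  obtain f g r where 1: "\<And>k. vge levF W (f k)" "\<And>k. vge odeg 2 (f k)" "vge levG W g"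
     "small W r" "trace_normal r" "mixed r" "small (W + 1) (y - L f g r)"
    using assms(1) unfolding Im0_def by blast
  obtain f' g' r' where 2: "\<And>k. vge levF W (f' k)" "\<And>k. vge odeg 2 (f' k)" "vge levG W g'"
     "small W r'" "trace_normal r'" "mixed r'" "small (W + 1) (y' - L f' g' r')"
    using assms(2) unfolding Im0_def by blast
  have "small (W + 1) (y + y' - L (\<lambda>k. f k + f' k) (g + g') (r + r'))"
    using small_add[OF 1(7) 2(7)] by (simp add: L_add algebra_simps)
  then show ?thesis
    unfolding Im0_def using 1 2
    by (intro exI[of _ "\<lambda>k. f k + f' k"] exI[of _ "g + g'"] exI[of _ "r + r'"])
      (auto intro: vge_add small_add trace_normal_add mixed_add)
qed

lemma Im0_uminus: assumes "Im0 W y" shows "Im0 W (- y)"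
proof -
  obtain f g r where 1: "\<And>k. vge levF W (f k)" "\<And>k. vge odeg 2 (f k)" "vge levG W g"
     "small W r" "trace_normal r" "mixed r" "small (W + 1) (y - L f g r)"
    using assms(1) unfolding Im0_def by blast
  have "- (y - L f g r) = - y - L (\<lambda>k. - f k) (- g) (- r)"
    by (simp add: L_uminus)
  then have "small (W + 1) (- y - L (\<lambda>k. - f k) (- g) (- r))"
    using 1(7) small_uminus by metis
  then show ?thesis
    unfolding Im0_def using 1
    by (intro exI[of _ "\<lambda>k. - f k"] exI[of _ "- g"] exI[of _ "- r"])
      (auto intro: trace_normal_uminus mixed_uminus)
qed

lemma Im0_diff: "Im0 W y \<Longrightarrow> Im0 W y' \<Longrightarrow> Im0 W (y - y')"
  using Im0_add[OF _ Im0_uminus] by fastforce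

lemma Im0_sum: "(\<And>i. i \<in> A \<Longrightarrow> Im0 W (f i)) \<Longrightarrow> Im0 W (\<Sum>i\<in>A. f i)"
  by (induction A rule: infinite_finite_induct) (auto intro: Im0_add Im0_small)

lemma rs_lift: "bihomogeneous k 0 p \<Longrightarrow> rs (lift (to_hol p) l) = p * u ^ l"
  using restrict_to_lift[OF homogeneous_to_hol u_0] by (simp add: of_hol_to_hol)

lemma mcoeff_lift_nonzero:
  "bihomogeneous k 0 p \<Longrightarrow> mcoeff (lift (to_hol p) l) \<beta> \<noteq> 0 \<Longrightarrow> \<beta> None = l \<and> odeg \<beta> = k"
  using homogeneous_to_hol[of k p] unfolding homogeneous_def
  by (auto simp: mcoeff_lift mdeg_comp_Some split: if_splits)

lemma Im0_hol: assumes "bihomogeneous k 0 p" "k + l * s = W" shows "Im0 W (p * u ^ l)"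
proof -
  have "vge levG W (lift (to_hol p) l)"
    using mcoeff_lift_nonzero[OF assms(1)] assms(2) by (auto simp: vge_def levG_def)
  then show ?thesis
    unfolding Im0_def
    by (intro exI[of _ "\<lambda>_. 0"] exI[of _ "lift (to_hol p) l"] exI[of _ 0])
      (simp add: L_def rs_lift[OF assms(1)])
qed

text \<open>The contribution to \<open>H\<close> of $F_k = f_k(z) w^l$.\<close>

definition Hw :: "('n \<Rightarrow> ('n + 'n) mfps) \<Rightarrow> nat \<Rightarrow> ('n + 'n) mfps" where
  "Hw f l = (\<Sum>k\<in>UNIV. (mvar (Inr k) + Dk k) * (f k * u ^ l))"

lemma H_lift:
  assumes "\<And>k. bihomogeneous d 0 (f k)"
  shows "H (\<lambda>k. lift (to_hol (f k)) l) = Hw f l"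
  by (simp add: H_def Hw_def rs_lift[OF assms])

lemma Im0_field:
  assumes f: "\<And>k. bihomogeneous d 0 (f k)" and d: "d \<ge> 2" "d + l * s + s = W + 1"
  shows "Im0 W (Hw f l + mbar (Hw f l))"
proof -
  have "levF \<beta> = W" if "\<beta> None = l" "odeg \<beta> = d" for \<beta> :: "'n option \<Rightarrow> nat"
    unfolding levF_def that using d by simp
  then have "vge levF W (lift (to_hol (f k)) l)" "vge odeg 2 (lift (to_hol (f k)) l)" for k
    using mcoeff_lift_nonzero[OF f[of k], of l] d unfolding vge_def by (metis order_refl)+
  then have "Im0 W (- (Hw f l + mbar (Hw f l)))"
    unfolding Im0_def
    by (intro exI[of _ "\<lambda>k. lift (to_hol (f k)) l"] exI[of _ 0]) (simp add: L_def H_lift[OF f])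
  from Im0_uminus[OF this] show ?thesis
    by (simp only: minus_minus)
qed

lemma Im0_normal:
  assumes "small W r" "trace_normal r" "mixed r" shows "Im0 W r"
proof -
  have "Im0 W (- r)"
    unfolding Im0_def using assms
    by (intro exI[of _ "\<lambda>_. 0"] exI[of _ 0] exI[of _ r]) (simp add: L_def)
  from Im0_uminus[OF this] show ?thesis by simp
qed

lemma trace_normal_bihom:
  assumes "bihomogeneous m n C" "m < n \<Longrightarrow> (trace_op ^^ (m - 1)) C = 0"
    "n \<le> m \<Longrightarrow> (trace_op ^^ n) C = 0"
  shows "trace_normal C"
  unfolding trace_normal_def using assms(2,3) by (auto simp: bipart_bihomogeneous[OF assms(1)])

lemma mixed_bihom: "bihomogeneous m n C \<Longrightarrow> m \<noteq> 0 \<Longrightarrow> n \<noteq> 0 \<Longrightarrow> mixed C"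
  by (auto simp: mixed_def bihomogeneous_iff)

lemma euler_D: "(\<Sum>k\<in>UNIV. mvar (Inl k) * Dk k) = mconst (of_nat s) * D"
  by (rule euler_z[OF D])

text \<open>
  On antiholomorphic multiples a factor \<open>u\<close> may be traded for $(1 - s) \overline D$. For the radial field
  $p(z) z w^j$, Euler's identity gives $\sum_k (\overline z_k + D_k) z_k p = (Q + s D) p = (u + (s - 1) D - \overline D) p$.
  Here $\overline D p$ is of higher level, and the holomorphic multiples of \<open>u ^ j\<close> are produced by \<open>G\<close>.
  Of the conjugate there remains $\overline p (u + (s - 1) \overline D) u^j$.
\<close>

lemma Im0_radial:
  assumes "bihomogeneous k 0 p" "k \<ge> 1" "k + j * s = W"
  shows "Im0 W (mbar p * u ^ j - mconst ((1 - of_nat s) ^ j) * (mbar p * Db ^ j))"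
  using assms
proof (induction j arbitrary: k p)
  case 0
  then show ?case by (simp add: Im0_small)
next
  case (Suc j)
  \<comment> \<open>The radial vector field $p(z) z$.\<close>
  define f where "f k = mvar (Inl k) * p" for k
  have f: "bihomogeneous (Suc k) 0 (f i)" for i
    using bihomogeneous_mult[OF bihomogeneous_mvar(1) Suc.prems(1)] by (simp add: f_def)
  have "Hw f j = (\<Sum>k\<in>UNIV. mvar (Inl k) * mvar (Inr k)) * (p * u ^ j) + (\<Sum>k\<in>UNIV. mvar (Inl k) * Dk k) * (p * u ^ j)"
    unfolding Hw_def f_def sum_distrib_right sum.distrib[symmetric]
    by (rule sum.cong) (auto simp: algebra_simps)
  then have Hw: "Hw f j = (Q + mconst (of_nat s) * D) * (p * u ^ j)"
    unfolding euler_D by (simp add: quadric_def distrib_right)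
  define c :: complex where "c = 1 - of_nat s"
  have c: "mconst (of_nat s) = 1 - mconst c"
    by (simp add: c_def mconst_diff)
  define p' where "p' = mconst c * (p * D)"
  have p': "bihomogeneous (k + s) 0 p'"
    unfolding p'_def using bihomogeneous_mult[OF Suc.prems(1) D] by (simp add: bihomogeneous_mconst_mult)
  have cc: "cnj c = c" by (simp add: c_def)
  define E where "E = Db * (p * u ^ j)"
  have E: "small (W + 1) E"
  proof -
    have W: "k + (s + j * s) = W" using Suc.prems(3) by simp
    then have 1: "W + 1 \<le> k + (s - 1) * s + j * s"
      using s_sq s3 by (simp only: mult.commute[of "s - 1"])
    have "W + 1 \<le> (s - 1) * k + s + j * s"
      using W Suc.prems(2) s_mult(1)[of k] by linarith
    then show ?thesis
      using small_bihom_u[OF bihomogeneous_mult[OF Suc.prems(1) Db], of "W + 1" j] 1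
      by (simp add: E_def mult_ac)
  qed
  have "Im0 W (Hw f j + mbar (Hw f j))"
    by (rule Im0_field[OF f]) (use Suc.prems in auto)
  moreover have "Im0 W (p * u ^ Suc j)"
    by (rule Im0_hol[OF Suc.prems(1,3)])
  moreover have "Im0 W (p' * u ^ j)"
    by (rule Im0_hol[OF p']) (use Suc.prems in auto)
  moreover have "Im0 W (E + mbar E)"
    by (rule Im0_small) (use E in \<open>auto intro: small_add\<close>)
  moreover have "Im0 W (mbar p' * u ^ j - mconst (c ^ j) * (mbar p' * Db ^ j))"
    unfolding c_def by (rule Suc.IH[OF p']) (use Suc.prems in auto)
  ultimately have "Im0 W ((Hw f j + mbar (Hw f j)) - p * u ^ Suc j + p' * u ^ j + (E + mbar E) +
      (mbar p' * u ^ j - mconst (c ^ j) * (mbar p' * Db ^ j)))"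
    by - (assumption | rule Im0_add | rule Im0_diff)+
  also have "(Hw f j + mbar (Hw f j)) - p * u ^ Suc j + p' * u ^ j + (E + mbar E) +
      (mbar p' * u ^ j - mconst (c ^ j) * (mbar p' * Db ^ j)) =
    mbar p * u ^ Suc j - mconst (c ^ Suc j) * (mbar p * Db ^ Suc j)"
  proof -
    have Qu: "Q = u - D - Db" by (simp add: u_def)
    show ?thesis
      unfolding Hw E_def p'_def
      by (simp add: Qu c cc mconst_power mconst_mult algebra_simps)
  qed
  finally show ?case by (simp add: c_def)
qed

section \<open>Solvability up to antiholomorphic polynomials\<close>

text \<open>
  Solvability at level \<open>W\<close> up to an antiholomorphic polynomial. Every series of level \<open>W\<close> turns out to
  have this property, so only antiholomorphic polynomials are left for the parameters.
\<close>

definition Im0_pure :: "nat \<Rightarrow> ('n + 'n) mfps \<Rightarrow> bool" where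
  "Im0_pure W y \<longleftrightarrow> (\<exists>q. bihomogeneous W 0 q \<and> Im0 W (y - mbar q))"

lemma Im0_pure_Im0: "Im0 W y \<Longrightarrow> Im0_pure W y"
  unfolding Im0_pure_def by (intro exI[of _ 0]) simp

lemma Im0_pure_add: "Im0_pure W y \<Longrightarrow> Im0_pure W y' \<Longrightarrow> Im0_pure W (y + y')"
  unfolding Im0_pure_def
proof (elim exE conjE, goal_cases)
  case (1 q q')
  then show ?case
    using Im0_add[OF 1(2,4)] by (intro exI[of _ "q + q'"]) (simp add: bihomogeneous_add algebra_simps)
qed

lemma Im0_pure_uminus: "Im0_pure W y \<Longrightarrow> Im0_pure W (- y)"
  unfolding Im0_pure_def
proof (elim exE conjE, goal_cases)
  case (1 q)
  then show ?case
    using Im0_uminus[OF 1(2)] by (intro exI[of _ "- q"]) (simp add: bihomogeneous_uminus)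
qed

lemma Im0_pure_diff: "Im0_pure W y \<Longrightarrow> Im0_pure W y' \<Longrightarrow> Im0_pure W (y - y')"
  using Im0_pure_add[OF _ Im0_pure_uminus] by fastforce

lemma Im0_pure_0: "Im0_pure W 0"
  by (intro Im0_pure_Im0 Im0_small) simp

lemma Im0_pure_sum: "(\<And>i. i \<in> A \<Longrightarrow> Im0_pure W (f i)) \<Longrightarrow> Im0_pure W (\<Sum>i\<in>A. f i)"
  by (induction A rule: infinite_finite_induct) (auto intro: Im0_pure_add Im0_pure_0)

context
  fixes W d :: nat
  assumes IH: "\<And>y. small W y \<Longrightarrow> vz 1 1 (d + 1) y \<Longrightarrow> Im0_pure W y"
begin

text \<open>
  In the trace decomposition $y = A Q^n + C$ the polynomial \<open>A\<close> is holomorphic and \<open>C\<close> is in normal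
  form. The term $A(z) w^n$ of \<open>G\<close> contributes $A u^n$, which differs from $A Q^n$ by terms of higher total
  degree.
\<close>

lemma Im0_pure_bihom_holomorphic_side:
  assumes y: "bihomogeneous m n y" "m + n = d" "small W y" and mn: "n \<le> m" "m + (s - 1) * n = W" "n \<noteq> 0"
  shows "Im0_pure W y"
proof -
  have W: "(m - n) + n * s = W"
    using mn s3 by (simp add: algebra_simps diff_mult_distrib2)
  have "bihomogeneous (m - n + n) (0 + n) y"
    using y(1) mn(1) by simp
  from trace_decomposition[OF this] have "\<exists>A C. y = Q ^ n * A + C \<and> bihomogeneous (m - n) 0 A \<and>
      bihomogeneous (m - n + n) (0 + n) C \<and> (trace_op ^^ n) C = 0"
    by blast
  then obtain A C where AC: "y = Q ^ n * A + C" "bihomogeneous (m - n) 0 A" "bihomogeneous m n C"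
    "(trace_op ^^ n) C = 0"
    using mn by auto
  have "small W C"
    by (rule small_bihom[OF AC(3)]) (use mn weight_side[of n m] in linarith)+
  then have "Im0 W C"
    by (intro Im0_normal trace_normal_bihom[OF AC(3)] mixed_bihom[OF AC(3)]) (use mn AC in auto)
  moreover have "Im0 W (A * u ^ n)"
    by (rule Im0_hol[OF AC(2) W])
  moreover have "Im0_pure W (A * (u ^ n - Q ^ n))"
  proof (rule IH)
    show "small W (A * (u ^ n - Q ^ n))"
      by (rule small_bihom_uQ[OF AC(2)]) (use W s_mult(1)[of "m - n"] in linarith)+
    show "vz 1 1 (d + 1) (A * (u ^ n - Q ^ n))"
      by (rule deg_bihom_uQ[OF AC(2)]) (use y mn in simp)
  qed
  moreover have "y = A * u ^ n + C - A * (u ^ n - Q ^ n)"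
    by (simp add: AC(1) algebra_simps)
  ultimately show ?thesis
    by (metis Im0_pure_Im0 Im0_add Im0_pure_diff)
qed

text \<open>
  In the trace decomposition $y = A Q^{m-1} + C$ the polynomial \<open>A\<close> is linear in \<open>z\<close>, so that
  $A = \sum_k z_k \overline{f_k}$ with $f_k$ holomorphic. The conjugate of the contribution of $f_k(z) w^{m-1}$
  to $F_k$ produces $A Q^{m-1}$ in lowest total degree, and that contribution itself lies on the
  holomorphic side.
\<close>

lemma Im0_pure_bihom_antiholomorphic_side:
  assumes y: "bihomogeneous m n y" "m + n = d" "small W y" and mn: "m < n" "(s - 1) * m + n = W" "m \<noteq> 0"
  shows "Im0_pure W y"
proof -
  have idx: "1 + (m - 1) = m" "n - m + 1 + (m - 1) = n"
    using mn by simp_all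
  then have "bihomogeneous (1 + (m - 1)) (n - m + 1 + (m - 1)) y"
    using y by simp
  from trace_decomposition[OF this] have "\<exists>A C. y = Q ^ (m - 1) * A + C \<and>
      bihomogeneous 1 (n - m + 1) A \<and> bihomogeneous (1 + (m - 1)) (n - m + 1 + (m - 1)) C \<and>
      (trace_op ^^ (m - 1)) C = 0"
    by blast
  then obtain A C where AC: "y = Q ^ (m - 1) * A + C" "bihomogeneous 1 (n - m + 1) A" "bihomogeneous m n C"
    "(trace_op ^^ (m - 1)) C = 0"
    unfolding idx by blast
  define e where "e = n - m + 1"
  define l where "l = m - 1"
  define f where "f k = mbar (mderiv (Inl k) A)" for k
  have e2: "e \<ge> 2" using mn by (simp add: e_def)
  have f: "bihomogeneous e 0 (f k)" for k
    using bihomogeneous_mbar[OF bihomogeneous_mderiv_Inl[OF AC(2)]] by (simp add: f_def e_def)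
  have "s * m = (s - 1) * m + m"
    using s3 by (simp add: diff_mult_distrib)
  moreover have "s * m = l * s + s"
    using mn by (simp add: l_def diff_mult_distrib algebra_simps)
  ultimately have W: "e + l * s + s = W + 1"
    using mn by (simp add: e_def)
  have "(s - 2) * 1 \<le> (s - 2) * e"
    by (rule mult_le_mono2) (use e2 in simp)
  then have se: "e + (s - 2) \<le> (s - 1) * e"
    using s_mult(2)[of e] by linarith
  have A: "A = (\<Sum>k\<in>UNIV. mvar (Inl k) * mbar (f k))"
    using euler_z[OF AC(2)] by (simp add: f_def)
  define y2 where "y2 = (\<Sum>k\<in>UNIV. mvar (Inr k) * f k) * Q ^ l"
  have "y = Q ^ l * A + C" using AC(1) by (simp add: l_def)
  then have yC: "y = mbar y2 + C" by (simp add: y2_def A mult.commute)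
  have C: "small W C"
    by (rule small_bihom[OF AC(3)]) (use mn weight_side[of m n] in linarith)+
  have mbar_y2: "bihomogeneous m n (mbar y2)"
    using bihomogeneous_diff[OF y(1) AC(3)] yC by simp
  have y2: "bihomogeneous n m y2"
    using bihomogeneous_mbar[OF mbar_y2] by simp
  define R where "R = Hw f l - y2"
  have R: "R = (\<Sum>k\<in>UNIV. Dk k * f k * u ^ l) + (\<Sum>k\<in>UNIV. mvar (Inr k) * f k * (u ^ l - Q ^ l))"
    unfolding R_def Hw_def y2_def sum_distrib_right sum.distrib[symmetric] sum_subtractf[symmetric]
    by (rule sum.cong) (auto simp: algebra_simps)
  have Df: "bihomogeneous (s - 1 + e) 0 (Dk k * f k)" for k
    using bihomogeneous_mult[OF Dk f] by simp
  have zf: "bihomogeneous e 1 (mvar (Inr k) * f k)" for k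
    using bihomogeneous_mult[OF bihomogeneous_mvar(2) f] by simp
  have "e \<le> (s - 1) * (s - 1 + e)"
    using s_mult(1)[of e] unfolding add_mult_distrib2 by linarith
  moreover have "(s - 1) * e + s \<le> (s - 1) * (s - 1 + e) + 1"
    using s_mult(1)[of "s - 1"] s3 unfolding add_mult_distrib2 by linarith
  moreover have "e + s \<le> (s - 1) * e + 2"
    using se by linarith
  ultimately have "small W R"
    unfolding R
    by (intro small_add small_sum small_bihom_u[OF Df] small_bihom_uQ[OF zf]) (use W s3 in auto)
  note R_small = this
  have d: "d = e + 2 * l + 1" using y mn by (simp add: e_def l_def)
  have R_deg: "vz 1 1 (d + 1) R"
    unfolding R
    by (intro vge_add vge_sum deg_bihom_u[OF Df] deg_bihom_uQ[OF zf]) (use d s3 in auto)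
  have "Im0_pure W R"
    by (rule IH[OF R_small R_deg])
  moreover have "Im0_pure W (mbar R)"
    using R_small R_deg by (intro IH) (auto simp: vge_mbar)
  moreover have "Im0 W C"
    by (intro Im0_normal trace_normal_bihom[OF AC(3)] mixed_bihom[OF AC(3)] C) (use mn AC in auto)
  moreover have "Im0 W (Hw f l + mbar (Hw f l))"
    by (rule Im0_field[OF f e2 W])
  moreover have "Im0_pure W y2"
  proof (rule Im0_pure_bihom_holomorphic_side[OF y2])
    have "small W (mbar y2)" using small_diff[OF y(3) C] yC by simp
    then show "small W y2" by simp
  qed (use mn y in auto)
  moreover have "y = C + (Hw f l + mbar (Hw f l)) - y2 - R - mbar R"
    by (simp add: R_def yC)
  ultimately show ?thesis
    by (metis Im0_pure_Im0 Im0_add Im0_pure_diff)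
qed

lemma Im0_pure_bihom:
  assumes y: "bihomogeneous m n y" "m + n = d" "small W y"
  shows "Im0_pure W y"
proof (cases "y = 0 \<or> small (W + 1) y")
  case True
  then show ?thesis by (auto intro!: Im0_pure_Im0 Im0_small)
next
  case False
  then have ge: "W \<le> m + (s - 1) * n" "W \<le> (s - 1) * m + n"
    and eq: "m + (s - 1) * n = W \<or> (s - 1) * m + n = W"
    using y small_bihom_iff[OF y(1)] by fastforce+
  consider "n = 0" | "m = 0" "n \<noteq> 0" | "n \<noteq> 0" "n \<le> m" | "m \<noteq> 0" "m < n" by linarith
  then show ?thesis
  proof cases
    case 1
    have "m = W"
    proof (rule ccontr)
      assume "m \<noteq> W"
      then have "(s - 1) * m = W" "W < m" using eq ge 1 by auto
      then show False using s_mult(1)[of m] by simp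
    qed
    then have "Im0 W (y * u ^ 0)" by (intro Im0_hol[of m]) (use y 1 in auto)
    then show ?thesis by (simp add: Im0_pure_Im0)
  next
    case 2
    have "n = W"
    proof (rule ccontr)
      assume "n \<noteq> W"
      then have "(s - 1) * n = W" "W < n" using eq ge 2 by auto
      then show False using s_mult(1)[of n] by simp
    qed
    then show ?thesis
      unfolding Im0_pure_def using bihomogeneous_mbar[OF y(1)] 2
      by (intro exI[of _ "mbar y"]) (simp add: Im0_small)
  next
    case 3
    have "m + (s - 1) * n = W"
    proof (rule ccontr)
      assume ne: "m + (s - 1) * n \<noteq> W"
      have "(s - 1) * n \<le> (s - 1) * m" using 3 by simp
      moreover have "(s - 1) * (m - n) = (s - 1) * m - (s - 1) * n" by (simp add: diff_mult_distrib2)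
      ultimately show False
        using ne eq ge 3 s_mult(1)[of "m - n"] by simp
    qed
    then show ?thesis using Im0_pure_bihom_holomorphic_side[OF y] 3 by simp
  next
    case 4
    have "(s - 1) * m + n = W"
    proof (rule ccontr)
      assume ne: "(s - 1) * m + n \<noteq> W"
      have "(s - 1) * m \<le> (s - 1) * n" using 4 by simp
      moreover have "(s - 1) * (n - m) = (s - 1) * n - (s - 1) * m" by (simp add: diff_mult_distrib2)
      ultimately show False
        using ne eq ge 4 s_mult(1)[of "n - m"] by simp
    qed
    then show ?thesis using Im0_pure_bihom_antiholomorphic_side[OF y] 4 by simp
  qed
qed

end

text \<open>
  Induction on the total degree, downwards: at level \<open>W\<close> only the total degrees up to \<open>W\<close> occur, since
  a monomial of total degree \<open>d\<close> has level at least \<open>d\<close>.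
\<close>

lemma Im0_pure_all:
  assumes "small W y" shows "Im0_pure W y"
proof -
  have "Im0_pure W y" if "small W y" "vz 1 1 d y" for d y
    using that
  proof (induction "W + 1 - d" arbitrary: d y)
    case 0
    have "small (W + 1) y"
      unfolding small_mcoeff
    proof (intro allI impI)
      fix \<alpha> assume "mcoeff y \<alpha> \<noteq> 0"
      then have "d \<le> zdeg \<alpha> + bdeg \<alpha>"
        using 0 by (auto simp: vge_def wt_sum)
      then show "W + 1 \<le> zdeg \<alpha> + (s - 1) * bdeg \<alpha> \<and> W + 1 \<le> (s - 1) * zdeg \<alpha> + bdeg \<alpha>"
        using 0(1) s_mult(1)[of "zdeg \<alpha>"] s_mult(1)[of "bdeg \<alpha>"] by (intro conjI; linarith)
    qed
    then show ?case by (intro Im0_pure_Im0 Im0_small)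
  next
    case (Suc x)
    define y0 where "y0 = (\<Sum>n\<le>d. bipart (d - n) n y)"
    have IH: "Im0_pure W y'" if "small W y'" "vz 1 1 (d + 1) y'" for y'
      using Suc(1)[of "d + 1" y'] Suc(2) that by simp
    have "Im0_pure W y0"
      unfolding y0_def
    proof (rule Im0_pure_sum)
      fix n assume "n \<in> {..d}"
      then show "Im0_pure W (bipart (d - n) n y)"
        using Im0_pure_bihom[OF IH bihomogeneous_bipart _ small_bipart[OF Suc.prems(1)]] by simp
    qed
    moreover have "Im0_pure W (y - y0)"
    proof (rule IH)
      show "small W (y - y0)"
        unfolding y0_def by (intro small_diff small_sum small_bipart Suc.prems)
      have "mcoeff y0 \<alpha> = (if zdeg \<alpha> + bdeg \<alpha> = d then mcoeff y \<alpha> else 0)" for \<alpha>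
      proof -
        have "mcoeff y0 \<alpha> = (\<Sum>n\<le>d. if n = bdeg \<alpha> then (if zdeg \<alpha> + bdeg \<alpha> = d then mcoeff y \<alpha> else 0) else 0)"
          unfolding y0_def mcoeff_sum mcoeff_bipart by (rule sum.cong) auto
        then show ?thesis by simp
      qed
      then show "vz 1 1 (d + 1) (y - y0)"
        using Suc.prems(2) by (force simp: vge_def wt_sum)
    qed
    ultimately have "Im0_pure W (y0 + (y - y0))"
      by (rule Im0_pure_add)
    then show ?case by simp
  qed
  from this[of y 0] assms show ?thesis by simp
qed

end


section \<open>Injectivity without parameters\<close>

definition keep :: "(('v \<Rightarrow> nat) \<Rightarrow> bool) \<Rightarrow> 'v mfps \<Rightarrow> 'v mfps" where
  "keep P h = Abs_mfps (\<lambda>\<beta>. if P \<beta> then mcoeff h \<beta> else 0)"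

lemma mcoeff_keep: "mcoeff (keep P h) \<beta> = (if P \<beta> then mcoeff h \<beta> else 0)"
  by (simp add: keep_def)

lemma keep_add_keep: "keep P h + keep (\<lambda>\<beta>. \<not> P \<beta>) h = h"
  by (rule mfps_eqI) (simp add: mcoeff_keep)

definition cpart :: "nat \<Rightarrow> nat \<Rightarrow> 'n::finite option mfps \<Rightarrow> 'n mfps" where
  "cpart j l h = Abs_mfps (\<lambda>\<gamma>. if mdeg \<gamma> = j then mcoeff h (oindex l \<gamma>) else 0)"

lemma homogeneous_cpart: "homogeneous j (cpart j l h)"
  by (simp add: homogeneous_def cpart_def)

lemma mcoeff_lift_cpart:
  "mcoeff (lift (cpart j l h) l) \<beta> = (if odeg \<beta> = j \<and> \<beta> None = l then mcoeff h \<beta> else 0)"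
  using oindex_eq[of \<beta>] by (auto simp: mcoeff_lift cpart_def mdeg_comp_Some)

definition pure_real :: "('n::finite + 'n) mfps \<Rightarrow> bool" where
  "pure_real r \<longleftrightarrow> (\<forall>m. bipart 0 m r = mbar (bipart m 0 r))"

lemma pure_real_add: "pure_real r \<Longrightarrow> pure_real r' \<Longrightarrow> pure_real (r + r')"
  by (simp add: pure_real_def bipart_add)

lemma pure_real_uminus: "pure_real r \<Longrightarrow> pure_real (- r)"
  by (simp add: pure_real_def bipart_uminus)

lemma bipart_mixed: "mixed r \<Longrightarrow> bipart m 0 r = 0 \<and> bipart 0 m r = 0"
  by (intro conjI mfps_eqI; force simp: mixed_def mcoeff_bipart)

lemma pure_real_mixed: "mixed r \<Longrightarrow> pure_real r"
  using bipart_mixed[of r] by (simp add: pure_real_def)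

context model
begin

lemma s_split: "l * s = 2 * l + l * (s - 2)"
proof -
  have "s = 2 + (s - 2)" using s3 by simp
  then show ?thesis by (metis add_mult_distrib2 mult.commute)
qed

lemma vge_rs1:
  assumes "\<And>\<beta>. mcoeff h \<beta> \<noteq> 0 \<Longrightarrow> a \<le> odeg \<beta> + \<beta> None * s"
  shows "vz 1 (s - 1) a (rs h)"
  unfolding restrict_to_def
proof (rule vge_msubst[where \<eta> = "case_option s (\<lambda>_. 1)"])
  show "vz 1 (s - 1) (case_option s (\<lambda>_. 1) v) (case v of None \<Rightarrow> u | Some k \<Rightarrow> mvar (Inl k))" for v :: "'n option"
    using u_ord(1) vge_mvar[of "zw 1 (s - 1)" "Inl _"] by (cases v) auto
  show "vge (wt (case_option s (\<lambda>_. 1))) a h"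
    using assms by (auto simp: vge_def wt_option mult.commute)
qed

lemma vge_rs2:
  assumes "\<And>\<beta>. mcoeff h \<beta> \<noteq> 0 \<Longrightarrow> a \<le> (s - 1) * odeg \<beta> + \<beta> None * s"
  shows "vz (s - 1) 1 a (rs h)"
  unfolding restrict_to_def
proof (rule vge_msubst[where \<eta> = "case_option s (\<lambda>_. s - 1)"])
  show "vz (s - 1) 1 (case_option s (\<lambda>_. s - 1) v) (case v of None \<Rightarrow> u | Some k \<Rightarrow> mvar (Inl k))" for v :: "'n option"
    using u_ord(2) vge_mvar[of "zw (s - 1) 1" "Inl _"] by (cases v) auto
  show "vge (wt (case_option s (\<lambda>_. s - 1))) a h"
    using assms by (auto simp: vge_def wt_option mult.commute)
qed

lemma vge_rs0:
  assumes "\<And>\<beta>. mcoeff h \<beta> \<noteq> 0 \<Longrightarrow> a \<le> odeg \<beta> + 2 * \<beta> None"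
  shows "vz 1 1 a (rs h)"
  unfolding restrict_to_def
proof (rule vge_msubst[where \<eta> = "case_option 2 (\<lambda>_. 1)"])
  show "vz 1 1 (case_option 2 (\<lambda>_. 1) v) (case v of None \<Rightarrow> u | Some k \<Rightarrow> mvar (Inl k))" for v :: "'n option"
    using u_ord(3) vge_mvar[of "zw 1 1" "Inl _"] by (cases v) auto
  show "vge (wt (case_option 2 (\<lambda>_. 1))) a h"
    using assms by (auto simp: vge_def wt_option mult.commute)
qed

lemma levF_bounds:
  assumes "W \<le> levF \<beta>"
  shows "W + 1 - s \<le> odeg \<beta> + \<beta> None * s" "W - 1 \<le> (s - 1) * odeg \<beta> + \<beta> None * s"
proof -
  show "W + 1 - s \<le> odeg \<beta> + \<beta> None * s"
    using assms s3 by (auto simp: levF_def split: if_splits)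
  show "W - 1 \<le> (s - 1) * odeg \<beta> + \<beta> None * s"
  proof (cases "odeg \<beta> = 0")
    case True
    then show ?thesis using assms by (simp add: levF_def)
  next
    case False
    then have "(s - 2) * 1 \<le> (s - 2) * odeg \<beta>" by (intro mult_le_mono2) simp
    then have "odeg \<beta> + s - 2 \<le> (s - 1) * odeg \<beta>" using s_mult(2)[of "odeg \<beta>"] by linarith
    then show ?thesis using assms False s3 by (simp add: levF_def)
  qed
qed

lemma coeff_ord: "vz 1 (s - 1) (s - 1) (mvar (Inr k) + Dk k)" "vz (s - 1) 1 1 (mvar (Inr k) + Dk k)"
  "vz 1 1 1 (mvar (Inr k) + Dk k)"
proof -
  have zb: "bihomogeneous 0 1 (mvar (Inr k) :: ('n + 'n) mfps)"
    using bihomogeneous_mvar(2) by simp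
  show "vz 1 (s - 1) (s - 1) (mvar (Inr k) + Dk k)" "vz (s - 1) 1 1 (mvar (Inr k) + Dk k)"
    "vz 1 1 1 (mvar (Inr k) + Dk k)"
    using s3 by (auto intro!: vge_add vz_bihom[OF zb] vz_bihom[OF Dk])
qed

lemma small_H:
  assumes "\<And>k. vge levF W (f k)" shows "small W (H f)"
  unfolding H_def
proof (intro small_sum smallI)
  fix k
  show "vz 1 (s - 1) W ((mvar (Inr k) + Dk k) * rs (f k))"
    by (rule vge_mult'[OF coeff_ord(1) vge_rs1[of _ "W + 1 - s"]])
      (use assms levF_bounds(1) in \<open>auto simp: vge_def\<close>)
  show "vz (s - 1) 1 W ((mvar (Inr k) + Dk k) * rs (f k))"
    by (rule vge_mult'[OF coeff_ord(2) vge_rs2[of _ "W - 1"]])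
      (use assms levF_bounds(2) in \<open>auto simp: vge_def\<close>)
qed

lemma small_rs:
  assumes "vge levG W g" shows "small W (rs g)"
proof (rule smallI)
  show "vz 1 (s - 1) W (rs g)"
    by (rule vge_rs1) (use assms in \<open>auto simp: vge_def levG_def\<close>)
  have "W \<le> (s - 1) * odeg \<beta> + \<beta> None * s" if "mcoeff g \<beta> \<noteq> 0" for \<beta>
  proof -
    have "W \<le> odeg \<beta> + \<beta> None * s"
      using assms that by (auto simp: vge_def levG_def)
    then show ?thesis
      using s_mult(1)[of "odeg \<beta>"] by linarith
  qed
  then show "vz (s - 1) 1 W (rs g)"
    by (rule vge_rs2)
qed

lemma small_L:
  assumes "\<And>k. vge levF W (f k)" "vge levG W g" "small W r"
  shows "small W (L f g r)"
  unfolding L_def using assms by (intro small_diff small_rs) (auto intro: small_H)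

lemma deg_L:
  assumes "\<And>k \<beta>. mcoeff (f k) \<beta> \<noteq> 0 \<Longrightarrow> d \<le> odeg \<beta> + 2 * \<beta> None + 1"
    "\<And>\<beta>. mcoeff g \<beta> \<noteq> 0 \<Longrightarrow> d \<le> odeg \<beta> + 2 * \<beta> None" "vz 1 1 d r"
  shows "vz 1 1 d (L f g r)"
proof -
  have "vz 1 1 d (H f)"
    unfolding H_def
  proof (rule vge_sum)
    fix k
    show "vz 1 1 d ((mvar (Inr k) + Dk k) * rs (f k))"
      by (rule vge_mult'[OF coeff_ord(3) vge_rs0[of _ "d - 1"]]) (use assms(1)[of k] in force)+
  qed
  then show ?thesis
    unfolding L_def using assms by (intro vge_diff vge_rs0) (auto simp: vge_mbar)
qed

text \<open>
  At level \<open>W\<close> and total degree \<open>d\<close> only the bidegrees \<open>(m, n)\<close> and \<open>(n, m)\<close> with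
  \<open>m + n = d\<close>, \<open>m \<ge> n\<close> and \<open>d + n (s - 2) = W\<close> occur, and there the operator reduces to its
  counterpart for the quadric. The trace decomposition makes that injective: in bidegree \<open>(n, m)\<close> it
  separates \<open>f\<close> from the normal form, and then in bidegree \<open>(m, n)\<close> it separates \<open>g\<close>.
\<close>

lemma L_injective_bidegree:
  assumes mn: "n \<le> m" "m \<noteq> 0"
    and f: "\<And>k. bihomogeneous (m - n + 1) 0 (f k)" "n = 0 \<or> m = n \<Longrightarrow> f = (\<lambda>k. 0)"
    and g: "bihomogeneous (m - n) 0 g"
    and r: "r = bipart m n r + (if m = n then 0 else bipart n m r)" "trace_normal r" "pure_real r"
    and zero: "g * Q ^ n - (\<Sum>k\<in>UNIV. mvar (Inr k) * f k) * Q ^ (n - 1) -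
      mbar ((\<Sum>k\<in>UNIV. mvar (Inr k) * f k) * Q ^ (n - 1)) - r = 0"
  shows "f = (\<lambda>k. 0)" "g = 0" "r = 0"
proof -
  define y2 where "y2 = (\<Sum>k\<in>UNIV. mvar (Inr k) * f k) * Q ^ (n - 1)"
  have gQ: "bihomogeneous m n (g * Q ^ n)"
    using bihomogeneous_mult[OF g bihomogeneous_quadric_power[of n]] mn by simp
  have y2: "bihomogeneous m n y2"
  proof (cases "n = 0 \<or> m = n")
    case True
    then show ?thesis using f(2) by (simp add: y2_def)
  next
    case False
    have "bihomogeneous (m - n + 1) 1 (mvar (Inr k) * f k)" for k
      using bihomogeneous_mult[OF bihomogeneous_mvar(2) f(1)] by simp
    from bihomogeneous_mult[OF bihomogeneous_sum[OF this] bihomogeneous_quadric_power[of "n - 1"]]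
    show ?thesis using mn False by (simp add: y2_def)
  qed
  note mbar_y2 = bihomogeneous_mbar[OF y2]
  have zero': "g * Q ^ n - y2 - mbar y2 - r = 0"
    using zero by (simp add: y2_def)
  have part: "bipart a b (g * Q ^ n) - bipart a b y2 - bipart a b (mbar y2) - bipart a b r = 0" for a b
    using arg_cong[OF zero', of "bipart a b"] by (simp add: bipart_diff)
  have f0: "f = (\<lambda>k. 0)" and r0: "m \<noteq> n \<Longrightarrow> bipart n m r = 0"
  proof -
    have "f = (\<lambda>k. 0) \<and> bipart n m r = 0" if ne: "n \<noteq> 0" "m \<noteq> n"
    proof -
      define A where "A = (\<Sum>k\<in>UNIV. mvar (Inl k) * mbar (f k))"
      have A: "bihomogeneous 1 (m - n + 1) A"
        unfolding A_def using bihomogeneous_mult[OF bihomogeneous_mvar(1) bihomogeneous_mbar[OF f(1)]]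
        by (intro bihomogeneous_sum) simp
      have "mbar y2 = Q ^ (n - 1) * A"
        by (simp add: y2_def A_def mult.commute)
      moreover have "- (mbar y2 + bipart n m r) = 0"
        using part[of n m] ne by (simp add: bipart_bihomogeneous[OF gQ] bipart_bihomogeneous[OF y2]
            bipart_bihomogeneous[OF mbar_y2])
      ultimately have eq: "Q ^ (n - 1) * A + bipart n m r = 0"
        by (simp only: neg_equal_0_iff_equal)
      have idx: "1 + (n - 1) = n" "m - n + 1 + (n - 1) = m"
        using ne mn by simp_all
      have "(trace_op ^^ (n - 1)) (bipart n m r) = 0"
        using r(2) ne mn unfolding trace_normal_def by simp
      then have "A = 0" "bipart n m r = 0"
        using trace_decomposition_unique[OF A, of "n - 1" "bipart n m r"] eq bihomogeneous_bipart[of n m r]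
        unfolding idx by blast+
      have "mbar (f j) = mderiv (Inl j) A" for j
      proof -
        have "mderiv (Inl j) (mbar (f k)) = 0" for k
        proof -
          have "mderiv (Inr j) (f k) = 0"
            using mderiv_of_hol_Inr[of j "to_hol (f k)"] by (simp add: of_hol_to_hol[OF f(1)])
          then show ?thesis using mbar_mderiv[of j "mbar (f k)"] by (metis mbar_0 mbar_mbar)
        qed
        then have "mderiv (Inl j) A = (\<Sum>k\<in>UNIV. if j = k then mbar (f k) else 0)"
          unfolding A_def mderiv_sum mderiv_mvar_mult by (intro sum.cong) auto
        then show ?thesis by simp
      qed
      then have "mbar (f j) = 0" for j
        using \<open>A = 0\<close> mderiv_sum[of _ _ "{}"] by simp
      then show ?thesis using \<open>bipart n m r = 0\<close> by (metis mbar_0 mbar_mbar)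
    qed
    moreover have "bipart n m r = 0" if "n = 0" "m \<noteq> n"
    proof -
      have "y2 = 0" using f(2) that by (simp add: y2_def)
      then show ?thesis
        using part[of n m] that by (simp add: bipart_bihomogeneous[OF g])
    qed
    ultimately have "f = (\<lambda>k. 0) \<and> (m \<noteq> n \<longrightarrow> bipart n m r = 0)"
      using f(2) by (cases "n = 0"; cases "m = n"; simp)
    then show "f = (\<lambda>k. 0)" "m \<noteq> n \<Longrightarrow> bipart n m r = 0"
      by auto
  qed
  show "f = (\<lambda>k. 0)" by (rule f0)
  have "y2 = 0" by (simp add: y2_def f0)
  then have eq: "Q ^ n * g + (- bipart m n r) = 0"
    using part[of m n] by (simp add: bipart_bihomogeneous[OF gQ] mult.commute)
  have "g = 0 \<and> bipart m n r = 0"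
  proof (cases "n = 0")
    case True
    then have "mbar (bipart m 0 r) = 0"
      using r0 mn r(3) unfolding pure_real_def by (metis mbar_0)
    then have "bipart m n r = 0" using True by (metis mbar_0 mbar_mbar)
    then show ?thesis using eq True by simp
  next
    case False
    have "(trace_op ^^ n) (- bipart m n r) = 0"
      using r(2) mn False unfolding trace_normal_def trace_op_power_uminus by simp
    moreover have "bihomogeneous (m - n + n) (0 + n) (- bipart m n r)"
      using bihomogeneous_uminus[OF bihomogeneous_bipart[of m n r]] mn by simp
    ultimately have "g = 0" "- bipart m n r = 0"
      using trace_decomposition_unique[OF g _ _ eq] by blast+
    then show ?thesis by simp
  qed
  then show "g = 0" "r = 0"
    using r(1) r0 by (auto split: if_splits)
qed

text \<open>
  If the unknowns have no terms of level \<open>W\<close> below the total degree \<open>d\<close>, then in total degree \<open>d\<close> the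
  equation is the one for the quadric, and the terms of degree \<open>d\<close> vanish too. A term of \<open>F\<close> counts
  one degree more than it has, because of the factor $\overline z_k$.
\<close>

lemma linearization_injective0_step:
  assumes F: "\<And>k. vge levF W (f k)" and par0: "\<And>k \<beta>. mcoeff (f k) \<beta> \<noteq> 0 \<Longrightarrow> levF \<beta> = W \<Longrightarrow> 2 \<le> odeg \<beta>"
    and G: "vge levG W g" and r: "small W r" "trace_normal r" "pure_real r"
    and L: "small (W + 1) (L f g r)" and W: "W \<ge> 1"
    and dF: "\<And>k \<beta>. mcoeff (f k) \<beta> \<noteq> 0 \<Longrightarrow> levF \<beta> = W \<Longrightarrow> d \<le> odeg \<beta> + 2 * \<beta> None + 1"
    and dG: "\<And>\<beta>. mcoeff g \<beta> \<noteq> 0 \<Longrightarrow> levG \<beta> = W \<Longrightarrow> d \<le> odeg \<beta> + 2 * \<beta> None"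
    and dr: "\<And>\<alpha>. mcoeff r \<alpha> \<noteq> 0 \<Longrightarrow> levR \<alpha> = W \<Longrightarrow> d \<le> zdeg \<alpha> + bdeg \<alpha>"
  shows "(\<forall>k \<beta>. mcoeff (f k) \<beta> \<noteq> 0 \<longrightarrow> levF \<beta> = W \<longrightarrow> d + 1 \<le> odeg \<beta> + 2 * \<beta> None + 1) \<and>
    (\<forall>\<beta>. mcoeff g \<beta> \<noteq> 0 \<longrightarrow> levG \<beta> = W \<longrightarrow> d + 1 \<le> odeg \<beta> + 2 * \<beta> None) \<and>
    (\<forall>\<alpha>. mcoeff r \<alpha> \<noteq> 0 \<longrightarrow> levR \<alpha> = W \<longrightarrow> d + 1 \<le> zdeg \<alpha> + bdeg \<alpha>)"
proof (cases "\<exists>n. d + n * (s - 2) = W \<and> 2 * n \<le> d")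
  case False
  note e = s_split
  have F0: "odeg \<beta> + 2 * \<beta> None + 1 \<noteq> d" if "mcoeff (f k) \<beta> \<noteq> 0" "levF \<beta> = W" for k \<beta>
  proof
    assume d: "odeg \<beta> + 2 * \<beta> None + 1 = d"
    have o: "2 \<le> odeg \<beta>" using par0 that by blast
    then have "odeg \<beta> + \<beta> None * s + s - 1 = W" using that(2) by (simp add: levF_def)
    then have "d + (\<beta> None + 1) * (s - 2) = W"
      using d s3 e[of "\<beta> None"] unfolding distrib_right by linarith
    moreover have "2 * (\<beta> None + 1) \<le> d" unfolding d[symmetric] distrib_left using o by simp
    ultimately show False using False by blast
  qed
  have G0: "odeg \<beta> + 2 * \<beta> None \<noteq> d" if "levG \<beta> = W" for \<beta> :: "'n option \<Rightarrow> nat"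
  proof
    assume d: "odeg \<beta> + 2 * \<beta> None = d"
    then have "d + \<beta> None * (s - 2) = W"
      using that e[of "\<beta> None"] unfolding levG_def by linarith
    moreover have "2 * \<beta> None \<le> d" using d by linarith
    ultimately show False using False by blast
  qed
  have r0: "zdeg \<alpha> + bdeg \<alpha> \<noteq> d" if "levR \<alpha> = W" for \<alpha> :: "'n + 'n \<Rightarrow> nat"
  proof
    assume d: "zdeg \<alpha> + bdeg \<alpha> = d"
    show False
    proof (cases "bdeg \<alpha> \<le> zdeg \<alpha>")
      case True
      then have "zdeg \<alpha> + (s - 1) * bdeg \<alpha> = W"
        using that weight_side[of "bdeg \<alpha>" "zdeg \<alpha>"] by (simp add: wt_sum)
      then have "d + bdeg \<alpha> * (s - 2) = W"
        using d s_mult(2)[of "bdeg \<alpha>"] by (simp add: mult.commute[of "bdeg \<alpha>"])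
      moreover have "2 * bdeg \<alpha> \<le> d" using d True by linarith
      ultimately show False using False by blast
    next
      case F: False
      then have "(s - 1) * zdeg \<alpha> + bdeg \<alpha> = W"
        using that weight_side[of "zdeg \<alpha>" "bdeg \<alpha>"] by (simp add: wt_sum)
      then have "d + zdeg \<alpha> * (s - 2) = W"
        using d s_mult(2)[of "zdeg \<alpha>"] by (simp add: mult.commute[of "zdeg \<alpha>"])
      moreover have "2 * zdeg \<alpha> \<le> d" using d F by linarith
      ultimately show False using False by blast
    qed
  qed
  show ?thesis
  proof (intro conjI allI impI)
    fix k \<beta> assume "mcoeff (f k) \<beta> \<noteq> 0" "levF \<beta> = W"
    then show "d + 1 \<le> odeg \<beta> + 2 * \<beta> None + 1"
      using dF[of k \<beta>] F0[of k \<beta>] by linarith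
  next
    fix \<beta> assume "mcoeff g \<beta> \<noteq> 0" "levG \<beta> = W"
    then show "d + 1 \<le> odeg \<beta> + 2 * \<beta> None"
      using dG[of \<beta>] G0[of \<beta>] by linarith
  next
    fix \<alpha> assume "mcoeff r \<alpha> \<noteq> 0" "levR \<alpha> = W"
    then show "d + 1 \<le> zdeg \<alpha> + bdeg \<alpha>"
      using dr[of \<alpha>] r0[of \<alpha>] by linarith
  qed
next
  case True
  then obtain n where n: "d + n * (s - 2) = W" "2 * n \<le> d" by blast
  define m where "m = d - n"
  have m: "m + n = d" "n \<le> m" using n by (auto simp: m_def)
  have m0: "m \<noteq> 0" using m n W by (cases "n = 0") auto
  note e = s_split
  have mW: "m + (s - 1) * n = W"
    using n m s_mult(2)[of n] by (simp add: mult.commute[of n])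
  define c where "c k = (if n = 0 \<or> m = n then 0 else of_hol (cpart (m - n + 1) (n - 1) (f k)))" for k
  define fd where "fd k = (if n = 0 \<or> m = n then 0 else lift (cpart (m - n + 1) (n - 1) (f k)) (n - 1))" for k
  define \<gamma> where "\<gamma> = of_hol (cpart (m - n) n g)"
  define gd where "gd = lift (cpart (m - n) n g) n"
  define rd where "rd = bipart m n r + (if m = n then 0 else bipart n m r)"
  have c: "bihomogeneous (m - n + 1) 0 (c k)" for k
    using homogeneous_cpart by (auto simp: c_def bihomogeneous_of_hol_iff)
  have \<gamma>: "bihomogeneous (m - n) 0 \<gamma>"
    using homogeneous_cpart by (simp add: \<gamma>_def bihomogeneous_of_hol_iff)
  have fd_c: "rs (fd k) = c k * u ^ (n - 1)" for k
    using restrict_to_lift[OF homogeneous_cpart u_0] by (auto simp: fd_def c_def)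
  have gd_\<gamma>: "rs gd = \<gamma> * u ^ n"
    unfolding gd_def \<gamma>_def by (rule restrict_to_lift[OF homogeneous_cpart u_0])
  \<comment> \<open>The remaining terms of level \<open>W\<close> have total degree beyond \<open>d\<close>.\<close>
  have F': "d + 1 \<le> odeg \<beta> + 2 * \<beta> None + 1 \<or> W + 1 \<le> levF \<beta>" if nz: "mcoeff (f k - fd k) \<beta> \<noteq> 0" for k \<beta>
  proof (rule ccontr)
    assume "\<not> ?thesis"
    then have not: "\<not> d + 1 \<le> odeg \<beta> + 2 * \<beta> None + 1" "\<not> W + 1 \<le> levF \<beta>" by auto
    have "mcoeff (f k) \<beta> \<noteq> 0"
      using nz by (auto simp: fd_def mcoeff_lift_cpart split: if_splits)
    then have lev: "levF \<beta> = W" and o: "2 \<le> odeg \<beta>" and d: "odeg \<beta> + 2 * \<beta> None + 1 = d"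
      using F[of k] not par0[of k \<beta>] dF[of k \<beta>] by (force simp: vge_def)+
    have "odeg \<beta> + \<beta> None * s + s - 1 = W" using lev o by (simp add: levF_def)
    then have "d + (\<beta> None + 1) * (s - 2) = W"
      using d s3 e[of "\<beta> None"] unfolding distrib_right by linarith
    then have "(\<beta> None + 1) * (s - 2) = n * (s - 2)" using n by linarith
    then have "\<beta> None + 1 = n" using s3 unfolding mult_cancel2 by linarith
    then have "n \<noteq> 0" "\<beta> None = n - 1" "odeg \<beta> = m - n + 1" "m \<noteq> n" using d m o by auto
    then show False using nz by (simp add: fd_def mcoeff_lift_cpart)
  qed
  have G': "d + 1 \<le> odeg \<beta> + 2 * \<beta> None \<or> W + 1 \<le> levG \<beta>" if nz: "mcoeff (g - gd) \<beta> \<noteq> 0" for \<beta>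
  proof (rule ccontr)
    assume "\<not> ?thesis"
    then have not: "\<not> d + 1 \<le> odeg \<beta> + 2 * \<beta> None" "\<not> W + 1 \<le> levG \<beta>" by auto
    have "mcoeff g \<beta> \<noteq> 0"
      using nz by (auto simp: gd_def mcoeff_lift_cpart split: if_splits)
    then have lev: "levG \<beta> = W" and d: "odeg \<beta> + 2 * \<beta> None = d"
      using G not dG[of \<beta>] by (force simp: vge_def)+
    have "d + \<beta> None * (s - 2) = W"
      using d lev e[of "\<beta> None"] unfolding levG_def by linarith
    then have "\<beta> None * (s - 2) = n * (s - 2)" using n by linarith
    then have "\<beta> None = n" using s3 by simp
    then have "odeg \<beta> = m - n" using d m by auto
    then show False using nz \<open>\<beta> None = n\<close> by (simp add: gd_def mcoeff_lift_cpart)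
  qed
  have R': "d + 1 \<le> zdeg \<alpha> + bdeg \<alpha> \<or> W + 1 \<le> levR \<alpha>"
    if nz: "mcoeff (r - rd) \<alpha> \<noteq> 0" for \<alpha>
  proof (rule ccontr)
    assume "\<not> ?thesis"
    then have not: "\<not> d + 1 \<le> zdeg \<alpha> + bdeg \<alpha>" "\<not> W + 1 \<le> levR \<alpha>" by auto
    have nz': "mcoeff r \<alpha> \<noteq> 0"
      using nz by (auto simp: rd_def mcoeff_bipart split: if_splits)
    then have "W \<le> levR \<alpha>" using r(1) by (auto simp: small_mcoeff wt_sum)
    then have lev: "levR \<alpha> = W" using not(2) by linarith
    then have d: "zdeg \<alpha> + bdeg \<alpha> = d" using not dr[OF nz'] by simp
    show False
    proof (cases "bdeg \<alpha> \<le> zdeg \<alpha>")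
      case True
      then have "zdeg \<alpha> + (s - 1) * bdeg \<alpha> = W"
        using lev weight_side[of "bdeg \<alpha>" "zdeg \<alpha>"] by (simp add: wt_sum)
      then have "d + bdeg \<alpha> * (s - 2) = W"
        using d s_mult(2)[of "bdeg \<alpha>"] by (simp add: mult.commute[of "bdeg \<alpha>"])
      then have "bdeg \<alpha> * (s - 2) = n * (s - 2)" using n by linarith
      then have "bdeg \<alpha> = n" using s3 by simp
      moreover from this have "zdeg \<alpha> = m" using d m(1) by linarith
      ultimately have "mcoeff rd \<alpha> = mcoeff r \<alpha>"
        by (simp add: rd_def mcoeff_bipart)
      then show False using nz by simp
    next
      case False
      then have "(s - 1) * zdeg \<alpha> + bdeg \<alpha> = W"
        using lev weight_side[of "zdeg \<alpha>" "bdeg \<alpha>"] by (simp add: wt_sum)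
      then have "d + zdeg \<alpha> * (s - 2) = W"
        using d s_mult(2)[of "zdeg \<alpha>"] by (simp add: mult.commute[of "zdeg \<alpha>"])
      then have "zdeg \<alpha> * (s - 2) = n * (s - 2)" using n by linarith
      then have "zdeg \<alpha> = n" using s3 by simp
      moreover from this have "bdeg \<alpha> = m" using d m(1) by linarith
      moreover from calculation have "m \<noteq> n" using False by simp
      ultimately have "mcoeff rd \<alpha> = mcoeff r \<alpha>"
        by (simp add: rd_def mcoeff_bipart)
      then show False using nz by simp
    qed
  qed
  have rest0: "mcoeff (L (\<lambda>k. f k - fd k) (g - gd) (r - rd)) \<alpha> = 0"
    if \<alpha>: "zdeg \<alpha> + bdeg \<alpha> = d" "levR \<alpha> = W" for \<alpha>
  proof -
    define f1 where "f1 k = keep (\<lambda>\<beta>. W + 1 \<le> levF \<beta>) (f k - fd k)" for k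
    define f2 where "f2 k = keep (\<lambda>\<beta>. \<not> W + 1 \<le> levF \<beta>) (f k - fd k)" for k
    define g1 where "g1 = keep (\<lambda>\<beta>. W + 1 \<le> levG \<beta>) (g - gd)"
    define g2 where "g2 = keep (\<lambda>\<beta>. \<not> W + 1 \<le> levG \<beta>) (g - gd)"
    define r1 where "r1 = keep (\<lambda>\<alpha>. W + 1 \<le> levR \<alpha>) (r - rd)"
    define r2 where "r2 = keep (\<lambda>\<alpha>. \<not> W + 1 \<le> levR \<alpha>) (r - rd)"
    have sum: "f k - fd k = f1 k + f2 k" "g - gd = g1 + g2" "r - rd = r1 + r2" for k
      unfolding f1_def f2_def g1_def g2_def r1_def r2_def keep_add_keep by (rule refl)+
    have "small (W + 1) (L f1 g1 r1)"
      by (rule small_L)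
        (auto simp: vge_def small_mcoeff f1_def g1_def r1_def mcoeff_keep wt_sum split: if_splits)
    then have 1: "mcoeff (L f1 g1 r1) \<alpha> = 0"
      using \<alpha> by (force simp: small_mcoeff wt_sum)
    have "vz 1 1 (d + 1) (L f2 g2 r2)"
    proof (rule deg_L)
      fix k \<beta> assume "mcoeff (f2 k) \<beta> \<noteq> 0"
      then show "d + 1 \<le> odeg \<beta> + 2 * \<beta> None + 1"
        unfolding f2_def mcoeff_keep using F'[of k \<beta>] by (auto split: if_splits)
    next
      fix \<beta> assume "mcoeff g2 \<beta> \<noteq> 0"
      then show "d + 1 \<le> odeg \<beta> + 2 * \<beta> None"
        unfolding g2_def mcoeff_keep using G'[of \<beta>] by (auto split: if_splits)
    next
      show "vz 1 1 (d + 1) r2"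
        unfolding vge_def
      proof (intro allI impI)
        fix \<alpha> assume "mcoeff r2 \<alpha> \<noteq> 0"
        then have "mcoeff (r - rd) \<alpha> \<noteq> 0" "\<not> W + 1 \<le> levR \<alpha>"
          unfolding r2_def mcoeff_keep by (auto split: if_splits)
        from R'[OF this(1)] this(2) have "d + 1 \<le> zdeg \<alpha> + bdeg \<alpha>"
          by blast
        then show "d + 1 \<le> wt (zw 1 1) \<alpha>"
          by (simp add: wt_sum)
      qed
    qed
    then have "mcoeff (L f2 g2 r2) \<alpha> = 0"
      by (rule vgeD) (use \<alpha> in \<open>simp add: wt_sum\<close>)
    then show ?thesis
      using 1 L_add[of f1 f2 g1 g2 r1 r2] by (simp add: sum)
  qed
  define y2 where "y2 = (\<Sum>k\<in>UNIV. mvar (Inr k) * c k) * Q ^ (n - 1)"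
  define \<Lambda> where "\<Lambda> = \<gamma> * Q ^ n - y2 - mbar y2 - rd"
  have y2: "bihomogeneous m n y2"
  proof (cases "n = 0 \<or> m = n")
    case True
    then show ?thesis by (simp add: y2_def c_def)
  next
    case False
    have "bihomogeneous (m - n + 1) 1 (mvar (Inr k) * c k)" for k
      using bihomogeneous_mult[OF bihomogeneous_mvar(2) c] by simp
    from bihomogeneous_mult[OF bihomogeneous_sum[OF this] bihomogeneous_quadric_power[of "n - 1"]]
    show ?thesis using m(2) False by (simp add: y2_def)
  qed
  have diff: "vz 1 1 (d + 1) (L fd gd rd - \<Lambda>)"
  proof -
    have R: "H fd - y2 = (\<Sum>k\<in>UNIV. Dk k * c k * u ^ (n - 1)) +
        (\<Sum>k\<in>UNIV. mvar (Inr k) * c k * (u ^ (n - 1) - Q ^ (n - 1)))"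
      unfolding H_def fd_c y2_def sum_distrib_right sum.distrib[symmetric] sum_subtractf[symmetric]
      by (rule sum.cong) (auto simp: algebra_simps)
    have "vz 1 1 (d + 1) (H fd - y2)"
    proof (cases "n = 0 \<or> m = n")
      case True
      then show ?thesis unfolding R by (simp add: c_def)
    next
      case False
      have Df: "bihomogeneous (s - 1 + (m - n + 1)) 0 (Dk k * c k)" for k
        using bihomogeneous_mult[OF Dk c] by simp
      have zf: "bihomogeneous (m - n + 1) 1 (mvar (Inr k) * c k)" for k
        using bihomogeneous_mult[OF bihomogeneous_mvar(2) c] by simp
      show ?thesis
        unfolding R
        by (intro vge_add vge_sum deg_bihom_u[OF Df] deg_bihom_uQ[OF zf]) (use False m s3 in auto)
    qed
    moreover have "L fd gd rd - \<Lambda> = \<gamma> * (u ^ n - Q ^ n) - (H fd - y2) - mbar (H fd - y2)"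
      unfolding L_def \<Lambda>_def gd_\<gamma> by (simp add: algebra_simps)
    moreover have "vz 1 1 (d + 1) (\<gamma> * (u ^ n - Q ^ n))"
      by (rule deg_bihom_uQ[OF \<gamma>]) (use m in simp)
    ultimately show ?thesis
      by (metis vge_diff vge_mbar)
  qed
  have "\<Lambda> = 0"
  proof (rule mfps_eqI)
    fix \<alpha> :: "'n + 'n \<Rightarrow> nat"
    show "mcoeff \<Lambda> \<alpha> = mcoeff 0 \<alpha>"
    proof (cases "(zdeg \<alpha> = m \<and> bdeg \<alpha> = n) \<or> (zdeg \<alpha> = n \<and> bdeg \<alpha> = m)")
      case True
      then have d: "zdeg \<alpha> + bdeg \<alpha> = d" using m by auto
      have "levR \<alpha> = W"
        using True mW weight_side[OF m(2)] by (auto simp: wt_sum add.commute)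
      note \<alpha> = d this
      have "mcoeff (L f g r) \<alpha> = 0"
        using L \<alpha> by (force simp: small_mcoeff wt_sum)
      moreover have "L f g r = L (\<lambda>k. f k - fd k) (g - gd) (r - rd) + L fd gd rd"
        using L_add[of "\<lambda>k. f k - fd k" fd "g - gd" gd "r - rd" rd] by simp
      moreover have "mcoeff (L fd gd rd - \<Lambda>) \<alpha> = 0"
        by (rule vgeD[OF diff]) (use d in \<open>simp add: wt_sum\<close>)
      ultimately show ?thesis using rest0[OF \<alpha>] by simp
    next
      case False
      have "bihomogeneous m n (\<gamma> * Q ^ n)"
        using bihomogeneous_mult[OF \<gamma> bihomogeneous_quadric_power[of n]] m(2) by simp
      then have "mcoeff (\<gamma> * Q ^ n) \<alpha> = 0" "mcoeff y2 \<alpha> = 0" "mcoeff (mbar y2) \<alpha> = 0" "mcoeff rd \<alpha> = 0"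
        using False y2 bihomogeneous_mbar[OF y2]
        by (auto simp: bihomogeneous_iff rd_def mcoeff_bipart)
      then show ?thesis by (simp add: \<Lambda>_def)
    qed
  qed
  have rd_parts: "bipart a b rd = (if (a, b) = (m, n) \<or> (a, b) = (n, m) then bipart a b r else 0)" for a b
    by (cases "m = n")
      (simp_all add: rd_def bipart_add bipart_bihomogeneous[OF bihomogeneous_bipart])
  have rd1: "trace_normal rd"
    using r(2) unfolding trace_normal_def rd_parts by auto
  have rd2: "pure_real rd"
    using r(3) unfolding pure_real_def rd_parts by auto
  have rd3: "rd = bipart m n rd + (if m = n then 0 else bipart n m rd)"
    unfolding rd_parts by (simp add: rd_def)
  have c0: "c = (\<lambda>k. 0)" if "n = 0 \<or> m = n"
    using that by (auto simp: c_def)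
  note inj = L_injective_bidegree[where f = c and r = rd, OF m(2) m0 c c0 \<gamma> rd3 rd1 rd2
      \<open>\<Lambda> = 0\<close>[unfolded \<Lambda>_def y2_def]]
  have "c = (\<lambda>k. 0)" "\<gamma> = 0" and rd0: "rd = 0"
    by (rule inj; assumption)+
  then have "fd = (\<lambda>k. 0)"
  proof -
    have "lift (0 :: 'n mfps) l = 0" for l
      by (rule mfps_eqI) (simp add: mcoeff_lift)
    then have "fd k = 0" for k
      using fun_cong[OF \<open>c = (\<lambda>k. 0)\<close>, of k] unfolding c_def fd_def
      by (metis of_hol_0 of_hol_eq_iff)
    then show ?thesis by auto
  qed
  have gd0: "gd = 0"
  proof -
    have "cpart (m - n) n g = 0" using \<open>\<gamma> = 0\<close> unfolding \<gamma>_def by (metis of_hol_0 of_hol_eq_iff)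
    then show ?thesis unfolding gd_def by (intro mfps_eqI) (simp add: mcoeff_lift)
  qed
  show ?thesis
  proof (intro conjI allI impI)
    fix k \<beta> assume "mcoeff (f k) \<beta> \<noteq> 0" "levF \<beta> = W"
    then show "d + 1 \<le> odeg \<beta> + 2 * \<beta> None + 1"
      using F'[of k \<beta>] \<open>fd = (\<lambda>k. 0)\<close> by simp
  next
    fix \<beta> assume "mcoeff g \<beta> \<noteq> 0" "levG \<beta> = W"
    then show "d + 1 \<le> odeg \<beta> + 2 * \<beta> None"
      using G'[of \<beta>] gd0 by simp
  next
    fix \<alpha> assume "mcoeff r \<alpha> \<noteq> 0" "levR \<alpha> = W"
    then show "d + 1 \<le> zdeg \<alpha> + bdeg \<alpha>"
      using R'[of \<alpha>] rd0 by simp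
  qed
qed

lemma linearization_injective0:
  assumes F: "\<And>k. vge levF W (f k)" and par0: "\<And>k \<beta>. mcoeff (f k) \<beta> \<noteq> 0 \<Longrightarrow> levF \<beta> = W \<Longrightarrow> 2 \<le> odeg \<beta>"
    and G: "vge levG W g" and r: "small W r" "trace_normal r" "pure_real r"
    and L: "small (W + 1) (L f g r)" and W: "W \<ge> 1"
  shows "(\<forall>k. vge levF (W + 1) (f k)) \<and> vge levG (W + 1) g \<and> small (W + 1) r"
proof -
  have *: "(\<forall>k \<beta>. mcoeff (f k) \<beta> \<noteq> 0 \<longrightarrow> levF \<beta> = W \<longrightarrow> d \<le> odeg \<beta> + 2 * \<beta> None + 1) \<and>
    (\<forall>\<beta>. mcoeff g \<beta> \<noteq> 0 \<longrightarrow> levG \<beta> = W \<longrightarrow> d \<le> odeg \<beta> + 2 * \<beta> None) \<and>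
    (\<forall>\<alpha>. mcoeff r \<alpha> \<noteq> 0 \<longrightarrow> levR \<alpha> = W \<longrightarrow> d \<le> zdeg \<alpha> + bdeg \<alpha>)" for d
  proof (induction d)
    case (Suc d)
    then show ?case
      using linearization_injective0_step[where d = d, OF F par0 G r L W] by simp
  qed simp
  have ls: "2 * l \<le> l * s" for l using s3 by (simp add: mult.commute)
  have nF: "levF \<beta> \<noteq> W" if "mcoeff (f k) \<beta> \<noteq> 0" for k \<beta>
  proof
    assume l: "levF \<beta> = W"
    then have "W + 1 \<le> odeg \<beta> + 2 * \<beta> None + 1" "2 \<le> odeg \<beta>"
      using * par0 that by blast+
    moreover from this have "odeg \<beta> + \<beta> None * s + s - 1 = W" using l by (simp add: levF_def)
    ultimately show False using ls[of "\<beta> None"] s3 by linarith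
  qed
  have nG: "levG \<beta> \<noteq> W" if "mcoeff g \<beta> \<noteq> 0" for \<beta>
  proof
    assume l: "levG \<beta> = W"
    then have "W + 1 \<le> odeg \<beta> + 2 * \<beta> None" using * that by blast
    then show False using l ls[of "\<beta> None"] unfolding levG_def by linarith
  qed
  have nr: "levR \<alpha> \<noteq> W" if "mcoeff r \<alpha> \<noteq> 0" for \<alpha>
  proof
    assume l: "levR \<alpha> = W"
    then have "W + 1 \<le> zdeg \<alpha> + bdeg \<alpha>" using * that by blast
    then show False
      using l s_mult(1)[of "zdeg \<alpha>"] s_mult(1)[of "bdeg \<alpha>"] unfolding wt_sum by linarith
  qed
  have wr: "W \<le> levR \<alpha>" if "mcoeff r \<alpha> \<noteq> 0" for \<alpha>
    using r(1) that by (auto simp: small_mcoeff wt_sum)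
  have "W + 1 \<le> levF \<beta>" if "mcoeff (f k) \<beta> \<noteq> 0" for k \<beta>
  proof -
    have "W \<le> levF \<beta>" using F[of k] that by (simp add: vge_def)
    then show ?thesis using nF[OF that] by simp
  qed
  moreover have "W + 1 \<le> levG \<beta>" if "mcoeff g \<beta> \<noteq> 0" for \<beta>
  proof -
    have "W \<le> levG \<beta>" using G that by (simp add: vge_def)
    then show ?thesis using nG[OF that] by simp
  qed
  moreover have "W + 1 \<le> levR \<alpha>" if "mcoeff r \<alpha> \<noteq> 0" for \<alpha>
    using nr[OF that] wr[OF that] by linarith
  ultimately show ?thesis
    unfolding vge_def small_mcoeff wt_sum by (simp only: min.bounded_iff mult_1) blast
qed

end


section \<open>The effect of the parameters\<close>

definition adj :: "('n \<Rightarrow> 'n \<Rightarrow> complex) \<Rightarrow> 'n \<Rightarrow> 'n \<Rightarrow> complex" where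
  "adj M k j = cnj (M j k)"

definition idm :: "complex \<Rightarrow> 'n \<Rightarrow> 'n \<Rightarrow> complex" where
  "idm c k j = (if k = j then c else 0)"

definition lin :: "('n::finite \<Rightarrow> complex) \<Rightarrow> ('n + 'n) mfps" where
  "lin a = (\<Sum>j\<in>UNIV. mconst (a j) * mvar (Inl j))"

definition bil :: "('n::finite \<Rightarrow> 'n \<Rightarrow> complex) \<Rightarrow> ('n + 'n) mfps" where
  "bil M = (\<Sum>k\<in>UNIV. mvar (Inr k) * lin (M k))"

lemma lin_add: "lin (\<lambda>j. a j + b j) = lin a + lin b"
  by (simp add: lin_def mconst_add distrib_right sum.distrib)

lemma lin_scale: "lin (\<lambda>j. c * a j) = mconst c * lin a"
  by (simp add: lin_def mconst_mult sum_distrib_left mult.assoc)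

lemma lin_idm: "lin (idm c k) = mconst c * mvar (Inl k)"
proof -
  have "lin (idm c k) = (\<Sum>j\<in>UNIV. if k = j then mconst c * mvar (Inl j) else 0)"
    unfolding lin_def idm_def by (rule sum.cong) auto
  then show ?thesis by simp
qed

lemma bihomogeneous_lin: "bihomogeneous 1 0 (lin a)"
  unfolding lin_def
  by (intro bihomogeneous_sum bihomogeneous_mconst_mult) (simp add: bihomogeneous_mvar)

lemma bihomogeneous_bil: "bihomogeneous 1 1 (bil M)"
  unfolding bil_def
  by (intro bihomogeneous_sum) (use bihomogeneous_mult[OF bihomogeneous_mvar(2) bihomogeneous_lin] in simp)

lemma bil_add: "bil (\<lambda>k j. M k j + M' k j) = bil M + bil M'"
  by (simp add: bil_def lin_add distrib_left sum.distrib)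

lemma bil_scale: "bil (\<lambda>k j. c * M k j) = mconst c * bil M"
  by (simp add: bil_def lin_scale sum_distrib_left mult_mconst_left_commute)

lemma bil_idm: "bil (idm c) = mconst c * quadric"
  by (simp add: bil_def lin_idm quadric_def sum_distrib_left mult_ac)

lemma mbar_bil: "mbar (bil M) = bil (adj M)"
proof -
  have "mbar (bil M) = (\<Sum>k\<in>UNIV. \<Sum>j\<in>UNIV. mvar (Inl k) * (mconst (cnj (M k j)) * mvar (Inr j)))"
    by (simp add: bil_def lin_def sum_distrib_left)
  also have "\<dots> = (\<Sum>j\<in>UNIV. \<Sum>k\<in>UNIV. mvar (Inl k) * (mconst (cnj (M k j)) * mvar (Inr j)))"
    by (rule sum.swap)
  also have "\<dots> = bil (adj M)"
    by (simp add: bil_def lin_def adj_def sum_distrib_left mult_ac)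
  finally show ?thesis .
qed

text \<open>
  The coefficient for which $\langle M z, \overline z \rangle Q^t - \tau Q^{t+1}$ is orthogonal to $Q^{t+1}$, and
  therefore a normal form (it is the normalized trace of \<open>M\<close>). Its linearity, its value on
  multiples of the identity and its behaviour under adjoints suffice below.
\<close>

definition tau :: "nat \<Rightarrow> ('n::finite \<Rightarrow> 'n \<Rightarrow> complex) \<Rightarrow> complex" where
  "tau t M = ip (2 * t + 2) (bil M * quadric ^ t) (quadric ^ (t + 1)) /
     ip (2 * t + 2) (quadric ^ (t + 1)) (quadric ^ (t + 1) :: ('n + 'n) mfps)"

lemma ip_quadric_nonzero:
  "ip (2 * t + 2) (quadric ^ (t + 1)) (quadric ^ (t + 1) :: ('n::finite + 'n) mfps) \<noteq> 0"
proof
  assume 0: "ip (2 * t + 2) (quadric ^ (t + 1)) (quadric ^ (t + 1) :: ('n + 'n) mfps) = 0"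
  have "t + 1 + (t + 1) = 2 * t + 2" by simp
  then have "homogeneous (2 * t + 2) (quadric ^ (t + 1) :: ('n + 'n) mfps)"
    using bihomogeneous_imp_homogeneous[OF bihomogeneous_quadric_power[of "t + 1"]] by metis
  then have "quadric ^ (t + 1) = (0 :: ('n + 'n) mfps)"
    using 0 by (rule homogeneous_ip_self)
  then show False
    using power_homogeneous_eq_0[OF bihomogeneous_imp_homogeneous[OF bihomogeneous_quadric]] quadric_nonzero
    by blast
qed

lemma tau_add: "tau t (\<lambda>k j. M k j + M' k j) = tau t M + tau t M'"
  by (simp add: tau_def bil_add distrib_right ip_add_left add_divide_distrib)

lemma tau_scale: "tau t (\<lambda>k j. c * M k j) = c * tau t M"
  by (simp add: tau_def bil_scale mult.assoc ip_scale_left)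

lemma tau_idm: "tau t (idm c :: 'n::finite \<Rightarrow> 'n \<Rightarrow> complex) = c"
  using ip_quadric_nonzero[of t, where ?'n = 'n]
  by (simp add: tau_def bil_idm mult.assoc ip_scale_left)

lemma tau_adj: "tau t (adj M) = cnj (tau t M)"
proof -
  have "ip d (mbar f * quadric ^ t) (quadric ^ (t + 1)) = cnj (ip d (f * quadric ^ t) (quadric ^ (t + 1)))"
    for d and f :: "('a + 'a) mfps"
    using ip_mbar[of d "f * quadric ^ t" "quadric ^ (t + 1)"] by simp
  from this[of "2 * t + 2" "bil M"] this[of "2 * t + 2" "quadric"]
  show ?thesis by (simp add: tau_def mbar_bil)
qed

context model
begin

text \<open>The derivative of \<open>D\<close> along the linear vector field \<open>M z\<close>.\<close>

definition dil :: "('n \<Rightarrow> 'n \<Rightarrow> complex) \<Rightarrow> ('n + 'n) mfps" where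
  "dil M = (\<Sum>k\<in>UNIV. Dk k * lin (M k))"

lemma bihomogeneous_dil: "bihomogeneous s 0 (dil M)"
  unfolding dil_def
  by (intro bihomogeneous_sum) (use bihomogeneous_mult[OF Dk bihomogeneous_lin] s3 in simp)

lemma dil_add: "dil (\<lambda>k j. M k j + M' k j) = dil M + dil M'"
  by (simp add: dil_def lin_add distrib_left sum.distrib)

lemma dil_scale: "dil (\<lambda>k j. c * M k j) = mconst c * dil M"
  by (simp add: dil_def lin_scale sum_distrib_left mult_mconst_left_commute)

lemma dil_idm: "dil (idm c) = mconst (c * of_nat s) * D"
proof -
  have "dil (idm c) = mconst c * (\<Sum>k\<in>UNIV. mvar (Inl k) * Dk k)"
    by (simp add: dil_def lin_idm sum_distrib_left mult_ac)
  then show ?thesis by (simp add: euler_D mconst_mult mult.assoc)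
qed

lemma Hw_lin: "Hw (\<lambda>k. lin (M k) * p) l = (bil M + dil M) * (p * u ^ l)"
  unfolding Hw_def bil_def dil_def sum.distrib[symmetric] sum_distrib_right
  by (rule sum.cong) (auto simp: algebra_simps)

definition cs :: complex where "cs = 1 - of_nat s"

lemma cnj_cs [simp]: "cnj cs = cs" by (simp add: cs_def)

lemma Im0_radial':
  "bihomogeneous k 0 p \<Longrightarrow> k \<ge> 1 \<Longrightarrow> k + j * s = W \<Longrightarrow>
    Im0 W (mbar p * u ^ j - mconst (cs ^ j) * (mbar p * Db ^ j))"
  unfolding cs_def by (rule Im0_radial)

context
  fixes t W :: nat
  assumes W: "W = (t + 1) * s"
begin

text \<open>
  The vector field $B z D^i w^l$ with a hermitian matrix \<open>B\<close>. Its other contribution is the derivative of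
  \<open>D\<close> along \<open>B z\<close>, a holomorphic multiple of \<open>u ^ l\<close> whose conjugate is subject to the radial rule.
\<close>

lemma Im0_bil_power:
  assumes B: "adj B = B" and i: "i \<ge> 1" "i + l = t"
  shows "Im0 W (bil B * ((D ^ i + Db ^ i) * u ^ l) + mconst (cs ^ l) * (mbar (dil B) * Db ^ t))"
proof -
  define f where "f k = lin (B k) * D ^ i" for k
  define p where "p = dil B * D ^ i"
  have f: "bihomogeneous (1 + i * s) 0 (f k)" for k
    unfolding f_def using bihomogeneous_mult[OF bihomogeneous_lin bihomogeneous_power[OF D, of i]] by simp
  have p: "bihomogeneous (s + i * s) 0 p"
    unfolding p_def using bihomogeneous_mult[OF bihomogeneous_dil bihomogeneous_power[OF D, of i]] by simp
  have W': "s + i * s + l * s = W"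
    using W i by (simp flip: distrib_right add: add.assoc)
  have "i * s \<ge> 1" using i s3 by (simp add: Suc_leI)
  then have "Im0 W (Hw f l + mbar (Hw f l))"
    by (intro Im0_field[OF f]) (use W' in linarith)+
  moreover have "Im0 W (p * u ^ l)"
    by (rule Im0_hol[OF p W'])
  moreover have "Im0 W (mbar p * u ^ l - mconst (cs ^ l) * (mbar p * Db ^ l))"
    by (rule Im0_radial'[OF p _ W']) (use s3 in simp)
  ultimately have "Im0 W ((Hw f l + mbar (Hw f l)) - p * u ^ l - (mbar p * u ^ l - mconst (cs ^ l) * (mbar p * Db ^ l)))"
    by - (assumption | rule Im0_diff)+
  also have "(Hw f l + mbar (Hw f l)) - p * u ^ l - (mbar p * u ^ l - mconst (cs ^ l) * (mbar p * Db ^ l)) =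
    bil B * ((D ^ i + Db ^ i) * u ^ l) + mconst (cs ^ l) * (mbar (dil B) * Db ^ t)"
    unfolding f_def Hw_lin p_def i(2)[symmetric]
    by (simp add: mbar_bil B algebra_simps power_add)
  finally show ?thesis .
qed

lemma adj_scale: "adj B = B \<Longrightarrow> cnj c = c \<Longrightarrow> adj (\<lambda>k j. c * B k j) = (\<lambda>k j. c * B k j)"
  by (auto simp: adj_def fun_eq_iff)

text \<open>
  As the product $D \overline D$ is of higher level, $Q^t = (u - D - \overline D)^t$ may be replaced by
  $(u - D)^t + (u - \overline D)^t - u^t$. The binomial expansion of this consists of the terms treated in
  \<open>Im0_bil_power\<close>, and their constants $(1 - s)^{t-i}$ add up to a binomial sum again.
\<close>

lemma Im0_bil_u:
  assumes B: "adj B = B"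
  shows "Im0 W (bil B * u ^ t - bil B * Q ^ t -
    mconst ((- of_nat s) ^ t - cs ^ t) * (mbar (dil B) * Db ^ t))"
proof -
  \<comment> \<open>The coefficients of $(u - x)^t$ as a polynomial in \<open>x\<close>.\<close>
  define \<kappa> :: "nat \<Rightarrow> complex" where "\<kappa> i = of_nat (t choose i) * (- 1) ^ i" for i
  define S where "S = (\<Sum>i\<in>{1..t}. mconst (\<kappa> i) * (bil B * ((D ^ i + Db ^ i) * u ^ (t - i)) +
    mconst (cs ^ (t - i)) * (mbar (dil B) * Db ^ t)))"
  have "Im0 W S"
    unfolding S_def
  proof (rule Im0_sum)
    fix i assume i: "i \<in> {1..t}"
    have ck: "cnj (\<kappa> i) = \<kappa> i" by (simp add: \<kappa>_def)
    have "Im0 W (bil (\<lambda>k j. \<kappa> i * B k j) * ((D ^ i + Db ^ i) * u ^ (t - i)) +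
        mconst (cs ^ (t - i)) * (mbar (dil (\<lambda>k j. \<kappa> i * B k j)) * Db ^ t))"
      by (rule Im0_bil_power[OF adj_scale[OF B ck]]) (use i in auto)
    also have "bil (\<lambda>k j. \<kappa> i * B k j) * ((D ^ i + Db ^ i) * u ^ (t - i)) +
        mconst (cs ^ (t - i)) * (mbar (dil (\<lambda>k j. \<kappa> i * B k j)) * Db ^ t) =
      mconst (\<kappa> i) * (bil B * ((D ^ i + Db ^ i) * u ^ (t - i)) +
        mconst (cs ^ (t - i)) * (mbar (dil B) * Db ^ t))"
      unfolding bil_scale dil_scale by (simp add: ck algebra_simps)
    finally show "Im0 W (mconst (\<kappa> i) * (bil B * ((D ^ i + Db ^ i) * u ^ (t - i)) +
        mconst (cs ^ (t - i)) * (mbar (dil B) * Db ^ t)))" .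
  qed
  have set: "{..t} = insert 0 {1..t}" by auto
  have bin: "(\<Sum>i\<in>{1..t}. mconst (\<kappa> i) * (x ^ i * u ^ (t - i))) = (u - x) ^ t - u ^ t" for x :: "('n + 'n) mfps"
  proof -
    have "(- x + u) ^ t = (\<Sum>i\<le>t. of_nat (t choose i) * (- x) ^ i * u ^ (t - i))"
      by (rule binomial_ring)
    also have "\<dots> = (\<Sum>i\<le>t. mconst (\<kappa> i) * (x ^ i * u ^ (t - i)))"
    proof (rule sum.cong[OF refl])
      fix i
      have "(- x) ^ i = mconst ((- 1) ^ i) * x ^ i"
        using power_mult_distrib[of "- 1" x i] by (simp add: mconst_power mconst_uminus)
      then show "of_nat (t choose i) * (- x) ^ i * u ^ (t - i) = mconst (\<kappa> i) * (x ^ i * u ^ (t - i))"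
        by (simp add: \<kappa>_def mconst_mult mconst_of_nat mult.assoc)
    qed
    also have "\<dots> = u ^ t + (\<Sum>i\<in>{1..t}. mconst (\<kappa> i) * (x ^ i * u ^ (t - i)))"
      unfolding set by (simp add: \<kappa>_def)
    finally show ?thesis by simp
  qed
  have binc: "(\<Sum>i\<in>{1..t}. \<kappa> i * cs ^ (t - i)) = (- of_nat s) ^ t - cs ^ t"
  proof -
    \<comment> \<open>Note that \<open>cs - 1 = - s\<close>.\<close>
    have "(- 1 + cs) ^ t = (\<Sum>i\<le>t. of_nat (t choose i) * (- 1) ^ i * cs ^ (t - i))"
      by (rule binomial_ring)
    also have "\<dots> = cs ^ t + (\<Sum>i\<in>{1..t}. \<kappa> i * cs ^ (t - i))"
      unfolding set by (simp add: \<kappa>_def)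
    finally show ?thesis by (simp add: cs_def)
  qed
  have "S = bil B * ((\<Sum>i\<in>{1..t}. mconst (\<kappa> i) * (D ^ i * u ^ (t - i))) +
      (\<Sum>i\<in>{1..t}. mconst (\<kappa> i) * (Db ^ i * u ^ (t - i)))) +
    (\<Sum>i\<in>{1..t}. mconst (\<kappa> i) * mconst (cs ^ (t - i))) * (mbar (dil B) * Db ^ t)"
    unfolding S_def sum.distrib[symmetric] sum_distrib_left sum_distrib_right
    by (rule sum.cong) (auto simp: algebra_simps)
  then have S: "S = bil B * (((u - D) ^ t - u ^ t) + ((u - Db) ^ t - u ^ t)) +
      mconst ((- of_nat s) ^ t - cs ^ t) * (mbar (dil B) * Db ^ t)"
    by (simp only: bin mconst_mult[symmetric] mconst_sum[symmetric] binc)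
  \<comment> \<open>The error of the replacement of $Q^t$. In either weight one of the two powers is close to $Q^t$ and the other to $u^t$.\<close>
  define E where "E = bil B * (((u - D) ^ t - Q ^ t) + ((u - Db) ^ t - u ^ t))"
  have E: "small (W + 1) E"
  proof (rule smallI)
    have DbQ: "u - D = Q + Db" and DQ: "u - Db = Q + D" by (simp_all add: u_def)
    have ge: "s + 1 \<le> (s - 1) * s" using s_sq s3 unfolding mult.commute[of s "s - 1"] by linarith
    have o1: "vz 1 (s - 1) s Q" "vz 1 (s - 1) s D" "vz 1 (s - 1) (s + 1) Db"
      and o2: "vz (s - 1) 1 s Q" "vz (s - 1) 1 (s + 1) D" "vz (s - 1) 1 s Db"
      using s3 ge by (auto intro!: vz_bihom[OF Q] vz_bihom[OF D] vz_bihom[OF Db])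
    have o3: "vz 1 (s - 1) s (Q + Db)" "vz 1 (s - 1) s (Q + D)" "vz (s - 1) 1 s (Q + Db)" "vz (s - 1) 1 s (Q + D)"
      using o1 o2 vge_mono[OF o1(3), of s] vge_mono[OF o2(2), of s] by (auto intro: vge_add)
    have o4: "Q + Db - Q = Db" "Q + D - Q = D" "Q + D - u = - Db" "Q + Db - u = - D"
      by (simp_all add: u_def)
    have b: "vz 1 (s - 1) s (bil B)" "vz (s - 1) 1 s (bil B)"
      using s3 by (auto intro!: vz_bihom[OF bihomogeneous_bil])
    have "vz 1 (s - 1) (t * s + 1) ((u - D) ^ t - Q ^ t)"
      unfolding DbQ by (rule vge_power_diff) (simp_all only: o4 o1 o3)
    moreover have "vz 1 (s - 1) (t * s + 1) ((u - Db) ^ t - u ^ t)"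
      unfolding DQ by (rule vge_power_diff) (simp_all only: o4 o1 o3 u_ord vge_uminus_iff)
    ultimately show "vz 1 (s - 1) (W + 1) E"
      unfolding E_def by (intro vge_mult'[OF b(1) vge_add]) (use W in auto)
    have "vz (s - 1) 1 (t * s + 1) ((u - Db) ^ t - Q ^ t)"
      unfolding DQ by (rule vge_power_diff) (simp_all only: o4 o2 o3)
    moreover have "vz (s - 1) 1 (t * s + 1) ((u - D) ^ t - u ^ t)"
      unfolding DbQ by (rule vge_power_diff) (simp_all only: o4 o2 o3 u_ord vge_uminus_iff)
    ultimately have "vz (s - 1) 1 (W + 1) (bil B * (((u - Db) ^ t - Q ^ t) + ((u - D) ^ t - u ^ t)))"
      by (intro vge_mult'[OF b(2) vge_add]) (use W in auto)
    then show "vz (s - 1) 1 (W + 1) E"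
      unfolding E_def by (simp add: algebra_simps)
  qed
  have "bil B * u ^ t - bil B * Q ^ t - mconst ((- of_nat s) ^ t - cs ^ t) * (mbar (dil B) * Db ^ t) = E - S"
    unfolding E_def S by (simp add: algebra_simps)
  then show ?thesis
    using Im0_diff[OF Im0_small[OF E] \<open>Im0 W S\<close>] by simp
qed

lemma Im0_bil_tau: "Im0 W (bil B * Q ^ t - mconst (tau t B) * Q ^ (t + 1))"
proof (rule Im0_normal)
  let ?C = "bil B * Q ^ t - mconst (tau t B) * Q ^ (t + 1)"
  have C: "bihomogeneous (t + 1) (t + 1) ?C"
  proof (rule bihomogeneous_diff)
    show "bihomogeneous (t + 1) (t + 1) (bil B * Q ^ t)"
      using bihomogeneous_mult[OF bihomogeneous_bil[of B] bihomogeneous_quadric_power[of t]] by simp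
  qed (rule bihomogeneous_mconst_mult[OF bihomogeneous_quadric_power])
  have "W = (t + 1) + (s - 1) * (t + 1)"
    using W s3 by (metis Suc_diff_1 add.commute gr0I mult.commute mult_Suc not_numeral_le_zero)
  then show "small W ?C" by (intro small_bihom[OF C]) simp_all
  show "mixed ?C" by (rule mixed_bihom[OF C]) simp_all
  have "ip (t + 1 + (t + 1)) ?C (Q ^ (t + 1)) = 0"
    using ip_quadric_nonzero[of t, where ?'n = 'n]
    by (simp add: ip_diff_left ip_scale_left tau_def mult_2)
  moreover have "mmono \<gamma> = 1" if "zdeg \<gamma> = 0" "bdeg \<gamma> = 0" for \<gamma> :: "'n + 'n \<Rightarrow> nat"
  proof -
    have "\<gamma> v = 0" for v
      using that by (cases v) (auto simp: zdeg_def bdeg_def)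
    then have "\<gamma> = 0" by (simp add: fun_eq_iff)
    then show ?thesis by (simp only: mmono_0)
  qed
  ultimately have "(trace_op ^^ (t + 1)) ?C = 0"
    by (intro trace_op_power_eq_0I[OF C]) auto
  then show "trace_normal ?C"
    by (intro trace_normal_bihom[OF C]) auto
qed

text \<open>
  The previous reduction for a multiple of the identity, combined with $Q = u - D - \overline D$.
\<close>

lemma Im0_quadric_power:
  assumes \<kappa>: "cnj \<kappa> = \<kappa>"
  shows "Im0 W (mconst \<kappa> * Q ^ (t + 1) +
    mconst (\<kappa> * (cs ^ t + of_nat s * ((- of_nat s) ^ t - cs ^ t))) * Db ^ (t + 1))"
proof -
  have "adj (idm \<kappa>) = (idm \<kappa> :: 'n \<Rightarrow> 'n \<Rightarrow> complex)"
    using \<kappa> by (auto simp: adj_def idm_def fun_eq_iff)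
  note 1 = Im0_bil_u[OF this]
  have one: "bihomogeneous 0 0 (mconst \<kappa> * 1)"
    by (intro bihomogeneous_mconst_mult bihomogeneous_1)
  have 2: "Im0 W ((mconst \<kappa> * 1) * u ^ (t + 1))"
    by (rule Im0_hol[OF one]) (use W in simp)
  have \<kappa>D: "bihomogeneous s 0 (mconst \<kappa> * D)"
    by (intro bihomogeneous_mconst_mult D)
  have 3: "Im0 W ((mconst \<kappa> * D) * u ^ t)"
    by (rule Im0_hol[OF \<kappa>D]) (use W in simp)
  have 4: "Im0 W (mbar (mconst \<kappa> * D) * u ^ t - mconst (cs ^ t) * (mbar (mconst \<kappa> * D) * Db ^ t))"
    by (rule Im0_radial'[OF \<kappa>D]) (use W s3 in auto)
  have Qu: "Q = u - D - Db" by (simp add: u_def)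
  have "mconst \<kappa> * Q ^ (t + 1) + mconst (\<kappa> * (cs ^ t + of_nat s * ((- of_nat s) ^ t - cs ^ t))) * Db ^ (t + 1) =
    (mconst \<kappa> * 1) * u ^ (t + 1) - (mconst \<kappa> * D) * u ^ t -
    (mbar (mconst \<kappa> * D) * u ^ t - mconst (cs ^ t) * (mbar (mconst \<kappa> * D) * Db ^ t)) -
    (bil (idm \<kappa>) * u ^ t - bil (idm \<kappa>) * Q ^ t -
      mconst ((- of_nat s) ^ t - cs ^ t) * (mbar (dil (idm \<kappa>)) * Db ^ t))"
  proof -
    have "mconst \<kappa> * Q * u ^ t = (mconst \<kappa> * 1) * u ^ (t + 1) - (mconst \<kappa> * D) * u ^ t - mconst \<kappa> * Db * u ^ t"
      by (simp add: Qu algebra_simps)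
    then show ?thesis
      unfolding bil_idm dil_idm
      by (simp add: \<kappa> mconst_mult mconst_add mconst_diff algebra_simps)
  qed
  then show ?thesis
    using Im0_diff[OF Im0_diff[OF Im0_diff[OF 2 3] 4] 1] by simp
qed

text \<open>
  The matrix by which the parameter \<open>A\<close> of the field $A z w^t$ acts on pure terms, by \<open>Im0_matrix_parameter\<close>
  below.
\<close>

definition matrix_map :: "('n \<Rightarrow> 'n \<Rightarrow> complex) \<Rightarrow> 'n \<Rightarrow> 'n \<Rightarrow> complex" where
  "matrix_map A k j = cs ^ t * A k j + ((- of_nat s) ^ t - cs ^ t) * (A k j + adj A k j) +
     idm (- tau t (\<lambda>k j. A k j + adj A k j) * (cs ^ t + of_nat s * ((- of_nat s) ^ t - cs ^ t)) / of_nat s) k j"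

text \<open>
  With $B = A + A^*$, the contribution of the field $A z w^t$ and its conjugate is
  $\langle B z, \overline z \rangle u^t$ plus the derivatives of \<open>D\<close> and $\overline D$ along \<open>A z\<close>, times \<open>u ^ t\<close>. The first is
  reduced to $\langle B z, \overline z \rangle Q^t$, then to $Q^{t+1}$ and then to a multiple of $\overline D^{t+1}$; the last is
  subject to the radial rule.
\<close>

lemma Im0_matrix_parameter:
  "Im0 W (Hw (\<lambda>k. lin (A k)) t + mbar (Hw (\<lambda>k. lin (A k)) t) - mbar (dil (matrix_map A) * D ^ t))"
proof -
  define B where "B k j = A k j + adj A k j" for k j
  define x where "x = cs ^ t"
  define y where "y = (- of_nat s) ^ t - cs ^ t"
  define \<kappa> where "\<kappa> = tau t B"
  define v where "v = \<kappa> * (x + of_nat s * y)"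
  have B: "adj B = B" by (auto simp: B_def adj_def fun_eq_iff)
  have xy: "cnj x = x" "cnj y = y" by (simp_all add: x_def y_def)
  have \<kappa>: "cnj \<kappa> = \<kappa>" unfolding \<kappa>_def using tau_adj[of t B] B by simp
  have v: "cnj v = v" by (simp add: v_def xy \<kappa>)
  have bB: "bil B = bil A + mbar (bil A)"
    unfolding B_def bil_add mbar_bil ..
  have Bf: "(\<lambda>k j. A k j + adj A k j) = B"
    by (simp add: B_def fun_eq_iff)
  have matrix_map: "matrix_map A = (\<lambda>k j. x * A k j + y * B k j + idm (- v / of_nat s) k j)"
    by (simp add: matrix_map_def fun_eq_iff x_def y_def Bf \<kappa>_def v_def) (simp add: B_def)
  have dM: "dil (matrix_map A) = mconst x * dil A + mconst y * dil B - mconst v * D"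
    unfolding matrix_map dil_add dil_scale dil_idm using s3 by (simp add: mconst_uminus)
  have Hw: "Hw (\<lambda>k. lin (A k)) t = (bil A + dil A) * u ^ t"
    using Hw_lin[of A 1 t] by simp
  have W': "s + t * s = W" using W by simp
  have 1: "Im0 W (bil B * u ^ t - bil B * Q ^ t - mconst y * (mbar (dil B) * Db ^ t))"
    unfolding y_def by (rule Im0_bil_u[OF B])
  have 2: "Im0 W (bil B * Q ^ t - mconst \<kappa> * Q ^ (t + 1))"
    unfolding \<kappa>_def by (rule Im0_bil_tau)
  have 3: "Im0 W (mconst \<kappa> * Q ^ (t + 1) + mconst v * Db ^ (t + 1))"
    using Im0_quadric_power[OF \<kappa>] unfolding v_def x_def y_def .
  have 4: "Im0 W (dil A * u ^ t)"
    by (rule Im0_hol[OF bihomogeneous_dil W'])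
  have 5: "Im0 W (mbar (dil A) * u ^ t - mconst x * (mbar (dil A) * Db ^ t))"
    unfolding x_def by (rule Im0_radial'[OF bihomogeneous_dil _ W']) (use s3 in simp)
  have "Hw (\<lambda>k. lin (A k)) t + mbar (Hw (\<lambda>k. lin (A k)) t) - mbar (dil (matrix_map A) * D ^ t) =
    (bil B * u ^ t - bil B * Q ^ t - mconst y * (mbar (dil B) * Db ^ t)) +
    (bil B * Q ^ t - mconst \<kappa> * Q ^ (t + 1)) + (mconst \<kappa> * Q ^ (t + 1) + mconst v * Db ^ (t + 1)) +
    dil A * u ^ t + (mbar (dil A) * u ^ t - mconst x * (mbar (dil A) * Db ^ t))"
    unfolding Hw dM bB by (simp add: xy v algebra_simps)
  then show ?thesis
    using Im0_add[OF Im0_add[OF Im0_add[OF Im0_add[OF 1 2] 3] 4] 5] by simp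
qed

text \<open>
  Put $x = (1 - s)^t$ and $y = (-s)^t - x$. Then \<open>matrix_map\<close> multiplies antihermitian matrices by \<open>x\<close>,
  hermitian ones on which \<open>tau\<close> vanishes by \<open>x + 2 y\<close>, and real multiples of the identity by
  \<open>x (1 - 2 / s)\<close>.
\<close>

lemma matrix_map_constants_nonzero:
  "cs ^ t \<noteq> 0" "cs ^ t + 2 * ((- of_nat s) ^ t - cs ^ t) \<noteq> 0" "1 - 2 / (of_nat s :: complex) \<noteq> 0"
proof -
  have cs: "cs = - of_nat (s - 1)"
    using s3 by (simp add: cs_def of_nat_diff)
  show "cs ^ t \<noteq> 0" using s3 by (simp add: cs)
  show "cs ^ t + 2 * ((- of_nat s) ^ t - cs ^ t) \<noteq> 0"
  proof
    assume "cs ^ t + 2 * ((- of_nat s) ^ t - cs ^ t) = 0"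
    then have "cs ^ t = 2 * (- of_nat s) ^ t" by (simp add: algebra_simps)
    then have "norm (cs ^ t) = 2 * norm ((- of_nat s :: complex) ^ t)"
      by (simp add: norm_mult)
    then have "real (s - 1) ^ t = 2 * real s ^ t"
      by (simp add: norm_power cs)
    moreover have "real (s - 1) ^ t \<le> real s ^ t"
      by (rule power_mono) auto
    moreover have "real s ^ t > 0" using s3 by simp
    ultimately show False by linarith
  qed
  have "(of_nat s :: complex) \<noteq> of_nat 2" using s3 by (subst of_nat_eq_iff) simp
  then show "1 - 2 / (of_nat s :: complex) \<noteq> 0" using s3 by auto
qed

text \<open>
  \<open>matrix_map\<close> is inverted by solving successively for \<open>tau\<close> of $A + A^*$, for $A + A^*$ and for \<open>A\<close>.
\<close>

lemma matrix_map_surj: "\<exists>A. matrix_map A = M"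
proof -
  define x where "x = cs ^ t"
  define y where "y = (- of_nat s) ^ t - cs ^ t"
  define w where "w = (x + of_nat s * y) / of_nat s"
  note nz = matrix_map_constants_nonzero[folded x_def y_def]
  define H where "H k j = M k j + adj M k j" for k j
  define \<kappa> where "\<kappa> = tau t H / (x * (1 - 2 / of_nat s))"
  define B where "B k j = 1 / (x + 2 * y) * (H k j + idm (2 * \<kappa> * w) k j)" for k j
  define A where "A k j = 1 / x * (M k j + (- y) * B k j + idm (\<kappa> * w) k j)" for k j
  have H: "adj H = H" by (auto simp: H_def adj_def fun_eq_iff)
  have xy: "cnj x = x" "cnj y = y" by (simp_all add: x_def y_def)
  then have w: "cnj w = w" by (simp add: w_def)
  have \<kappa>: "cnj \<kappa> = \<kappa>" unfolding \<kappa>_def using tau_adj[of t H] H by (simp add: xy)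
  have adjB: "adj B k j = B k j" for k j
    using fun_cong[OF fun_cong[OF H, of k], of j] by (simp add: B_def adj_def idm_def xy \<kappa> w)
  have HB: "H k j = (x + 2 * y) * B k j - idm (2 * \<kappa> * w) k j" for k j
    using nz(2) by (simp add: B_def)
  have AB: "A k j + adj A k j = B k j" for k j
  proof -
    have "A k j + adj A k j = 1 / x * (H k j - 2 * y * B k j + idm (2 * \<kappa> * w) k j)"
      using adjB[of k j] by (simp add: A_def H_def adj_def idm_def xy \<kappa> w algebra_simps)
    then show ?thesis using nz(1) by (simp add: HB algebra_simps)
  qed
  have "tau t H = \<kappa> * (x * (1 - 2 / of_nat s))"
    using nz by (simp add: \<kappa>_def)
  moreover have "x * (1 - 2 / of_nat s) + 2 * w = x + 2 * y"
    using s3 by (simp add: w_def field_simps)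
  moreover have "tau t B = 1 / (x + 2 * y) * (tau t H + 2 * \<kappa> * w)"
    unfolding B_def tau_scale tau_add tau_idm ..
  ultimately have "tau t B = 1 / (x + 2 * y) * (\<kappa> * (x + 2 * y))"
    by (metis (no_types, opaque_lifting) distrib_left mult.assoc mult.commute)
  then have tB: "tau t B = \<kappa>" using nz(2) by simp
  have "matrix_map A k j = M k j" for k j
  proof -
    have "matrix_map A k j = x * A k j + y * B k j + idm (- \<kappa> * w) k j"
      unfolding matrix_map_def AB tB y_def[symmetric] unfolding x_def[symmetric] by (simp add: w_def)
    then show ?thesis using nz(1) by (simp add: A_def idm_def algebra_simps)
  qed
  then show ?thesis by (intro exI[of _ A]) (simp add: fun_eq_iff)
qed

lemma matrix_map_inj:
  assumes "matrix_map A = (\<lambda>k j. 0)" shows "A = (\<lambda>k j. 0)"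
proof -
  define x where "x = cs ^ t"
  define y where "y = (- of_nat s) ^ t - cs ^ t"
  define w where "w = (x + of_nat s * y) / of_nat s"
  note nz = matrix_map_constants_nonzero[folded x_def y_def]
  define B where "B k j = A k j + adj A k j" for k j
  define \<kappa> where "\<kappa> = tau t B"
  have B: "adj B = B" by (auto simp: B_def adj_def fun_eq_iff)
  have xy: "cnj x = x" "cnj y = y" by (simp_all add: x_def y_def)
  then have w: "cnj w = w" by (simp add: w_def)
  have \<kappa>: "cnj \<kappa> = \<kappa>" unfolding \<kappa>_def using tau_adj[of t B] B by simp
  have Bf: "(\<lambda>k j. A k j + adj A k j) = B"
    by (simp add: B_def fun_eq_iff)
  have 0: "x * A k j + y * B k j + idm (- \<kappa> * w) k j = 0" for k j
    using fun_cong[OF fun_cong[OF assms, of k], of j]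
    unfolding matrix_map_def Bf B_def[symmetric] \<kappa>_def[symmetric] y_def[symmetric] unfolding x_def[symmetric]
    by (simp add: w_def)
  have "(x + 2 * y) * B k j + idm (- 2 * \<kappa> * w) k j = 0" for k j
  proof -
    have "cnj (x * A j k + y * B j k + idm (- \<kappa> * w) j k) = 0"
      unfolding 0 by simp
    then have "x * adj A k j + y * adj B k j + idm (- \<kappa> * w) k j = 0"
      by (simp add: xy \<kappa> w adj_def idm_def split: if_splits)
    then have "(x * A k j + y * B k j + idm (- \<kappa> * w) k j) +
        (x * adj A k j + y * adj B k j + idm (- \<kappa> * w) k j) = 0"
      unfolding 0 by simp
    moreover have "(x * A k j + y * B k j + idm (- \<kappa> * w) k j) +
        (x * adj A k j + y * adj B k j + idm (- \<kappa> * w) k j) =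
      (x + 2 * y) * B k j + idm (- 2 * \<kappa> * w) k j"
      unfolding B by (simp add: B_def idm_def algebra_simps)
    ultimately show ?thesis by simp
  qed
  note eqB = this
  then have "tau t (\<lambda>k j. (x + 2 * y) * B k j + idm (- 2 * \<kappa> * w) k j) = tau t (\<lambda>(k :: 'n) (j :: 'n). 0)"
    by simp
  moreover have "tau t (\<lambda>(k :: 'n) (j :: 'n). 0) = 0"
    using tau_scale[of t 0 "\<lambda>(k :: 'n) (j :: 'n). 0"] by simp
  ultimately have "(x + 2 * y) * \<kappa> - 2 * \<kappa> * w = 0"
    unfolding tau_add tau_scale tau_idm \<kappa>_def[symmetric] by simp
  moreover have "x * (1 - 2 / of_nat s) + 2 * w = x + 2 * y"
    using s3 by (simp add: w_def field_simps)
  ultimately have "\<kappa> * (x * (1 - 2 / of_nat s)) = 0"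
    by (metis (no_types, opaque_lifting) add_diff_cancel_right' left_diff_distrib mult.commute mult.left_commute)
  then have "\<kappa> = 0" using nz(1,3) by (metis mult_eq_0_iff)
  then have "B k j = 0" for k j
    using eqB[of k j] nz(2) by (simp add: idm_def split: if_splits)
  then have "A k j = 0" for k j
    using 0[of k j] nz(1) \<open>\<kappa> = 0\<close> by (simp add: idm_def split: if_splits)
  then show ?thesis by (simp add: fun_eq_iff)
qed

end

text \<open>
  The field $a w^t$ contributes $\langle z, \overline a \rangle u^t$ and its conjugate, up to terms of higher level; one
  is a holomorphic multiple of \<open>u ^ t\<close> and the other is subject to the radial rule.
\<close>

lemma Im0_vector_parameter:
  assumes W: "W = t * s + 1"
  shows "Im0 W (Hw (\<lambda>k. mconst (a k)) t + mbar (Hw (\<lambda>k. mconst (a k)) t) -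
    mbar (mconst (cs ^ t) * (lin (\<lambda>k. cnj (a k)) * D ^ t)))"
proof -
  define \<alpha> where "\<alpha> = lin (\<lambda>k. cnj (a k))"
  define E where "E = (\<Sum>k\<in>UNIV. mconst (a k) * Dk k)"
  have \<alpha>: "bihomogeneous 1 0 \<alpha>" unfolding \<alpha>_def by (rule bihomogeneous_lin)
  have mb: "mbar \<alpha> = (\<Sum>k\<in>UNIV. mvar (Inr k) * mconst (a k))"
    by (simp add: \<alpha>_def lin_def mult.commute)
  have Hw: "Hw (\<lambda>k. mconst (a k)) t = (mbar \<alpha> + E) * u ^ t"
    unfolding Hw_def mb E_def sum.distrib[symmetric] sum_distrib_right
    by (rule sum.cong) (auto simp: algebra_simps)
  have Eb: "bihomogeneous (s - 1) 0 E"
    unfolding E_def by (intro bihomogeneous_sum bihomogeneous_mconst_mult Dk)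
  have "2 \<le> (s - 1) * (s - 1)" using s_mult(1)[of "s - 1"] s3 by linarith
  then have "small (W + 1) (E * u ^ t)"
    by (intro small_bihom_u[OF Eb]) (use W s3 in auto)
  then have "Im0 W (E * u ^ t + mbar (E * u ^ t))"
    by (intro Im0_small small_add) (simp_all only: small_mbar)
  moreover have "Im0 W (\<alpha> * u ^ t)"
    by (rule Im0_hol[OF \<alpha>]) (use W in simp)
  moreover have "Im0 W (mbar \<alpha> * u ^ t - mconst (cs ^ t) * (mbar \<alpha> * Db ^ t))"
    by (rule Im0_radial'[OF \<alpha>]) (use W in auto)
  ultimately have "Im0 W ((E * u ^ t + mbar (E * u ^ t)) + \<alpha> * u ^ t +
      (mbar \<alpha> * u ^ t - mconst (cs ^ t) * (mbar \<alpha> * Db ^ t)))"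
    by - (assumption | rule Im0_add)+
  also have "(E * u ^ t + mbar (E * u ^ t)) + \<alpha> * u ^ t +
      (mbar \<alpha> * u ^ t - mconst (cs ^ t) * (mbar \<alpha> * Db ^ t)) =
    Hw (\<lambda>k. mconst (a k)) t + mbar (Hw (\<lambda>k. mconst (a k)) t) - mbar (mconst (cs ^ t) * (\<alpha> * D ^ t))"
    unfolding Hw by (simp add: algebra_simps)
  finally show ?thesis unfolding \<alpha>_def .
qed

end


section \<open>Bijectivity of the linearized operator\<close>

lemma mmono_mdeg_1:
  assumes "mdeg \<gamma> = 1" obtains j where "mmono \<gamma> = mvar (j :: 'n::finite)"
proof -
  have "\<gamma> \<noteq> 0" using assms by auto
  then obtain j where j: "\<gamma> j \<noteq> 0" by (auto simp: fun_eq_iff)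
  define \<delta> where "\<delta> = \<gamma>(j := \<gamma> j - 1)"
  have eq: "\<gamma> = 0(j := 1) + \<delta>" using j by (auto simp: \<delta>_def fun_eq_iff)
  have "mdeg \<gamma> = 1 + mdeg \<delta>" unfolding eq by (simp only: mdeg_eq_wt wt_add wt_single)
  then have "mdeg \<delta> = 0" using assms by simp
  then have "\<delta> = 0" by (auto simp: mdeg_def fun_eq_iff)
  then have "mmono \<gamma> = mvar j" unfolding eq mvar_eq_mmono by (simp only: add_0_right)
  then show ?thesis by (rule that)
qed

lemma fischer_add: "fischer V (f + g) = fischer V f + fischer V g"
  by (rule mfps_eqI) (simp add: fischer_def mderivs_def algebra_simps sum.distrib)

lemma fischer_uminus: "fischer V (- f) = - fischer V f"
  by (rule mfps_eqI) (simp add: fischer_def mderivs_def sum_negf)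

lemma fischer_0 [simp]: "fischer V 0 = 0"
  by (rule mfps_eqI) (simp add: fischer_def mderivs_def)

text \<open>
  Orthogonal projection to the span of the polynomials \<open>V k * mvar j\<close>: the rest is orthogonal to all
  multiples of \<open>V k\<close> in its degree, and so it is annihilated by the Fischer operator of \<open>V k\<close>.
\<close>

lemma fischer_projection:
  assumes V: "\<And>k. homogeneous e (V k)" and q: "homogeneous (e + 1) q"
  obtains M q0 where "q = (\<Sum>k\<in>UNIV. V k * (\<Sum>j\<in>UNIV. mconst (M k j) * mvar j)) + q0"
    "homogeneous (e + 1) q0" "\<And>k :: 'i::finite. fischer (V k) q0 = 0"
proof -
  define v where "v = (\<lambda>(k, j). V k * mvar j)"
  obtain c where c: "\<And>x. x \<in> UNIV \<Longrightarrow> ip (e + 1) (q - (\<Sum>i\<in>UNIV. mconst (c i) * v i)) (v x) = 0"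
    using ip_projection[of "UNIV :: ('i \<times> 'a) set" "e + 1" q v] by auto
  define q1 where "q1 = (\<Sum>k\<in>UNIV. V k * (\<Sum>j\<in>UNIV. mconst (c (k, j)) * mvar j))"
  have "q1 = (\<Sum>k\<in>UNIV. \<Sum>j\<in>UNIV. mconst (c (k, j)) * v (k, j))"
    by (simp add: q1_def v_def sum_distrib_left mult_ac)
  also have "\<dots> = (\<Sum>i\<in>UNIV \<times> UNIV. mconst (c i) * v i)"
    by (simp add: sum.cartesian_product case_prod_unfold)
  finally have q1: "q1 = (\<Sum>i\<in>UNIV. mconst (c i) * v i)" by simp
  have h1: "homogeneous (e + 1) q1"
    unfolding q1_def by (intro homogeneous_sum homogeneous_mult V homogeneous_mconst_mult homogeneous_mvar)
  have h0: "homogeneous (e + 1) (q - q1)" by (rule homogeneous_diff[OF q h1])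
  have "fischer (V k) (q - q1) = 0" for k
  proof (rule fischer_eq_0I[OF V h0])
    fix \<gamma> :: "'a \<Rightarrow> nat" assume "mdeg \<gamma> = 1"
    then obtain j where "mmono \<gamma> = mvar j" by (rule mmono_mdeg_1)
    then show "ip (e + 1) (q - q1) (V k * mmono \<gamma>) = 0"
      using c[of "(k, j)"] by (simp add: q1 v_def)
  qed
  then show ?thesis
    using that[of "\<lambda>k j. c (k, j)" "q - q1"] h0 by (simp add: q1_def)
qed

text \<open>\<open>q\<close> is orthogonal to each of its summands.\<close>

lemma fischer_projection_unique:
  assumes V: "\<And>k. homogeneous e (V k)" and q: "q = (\<Sum>k\<in>(UNIV :: 'i::finite set). V k * L k)"
    and L: "\<And>k. homogeneous 1 (L k)" and 0: "\<And>k. fischer (V k) q = 0"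
  shows "q = 0"
proof -
  have "ip (e + 1) q q = (\<Sum>k\<in>UNIV. ip (e + 1) q (V k * L k))"
    by (subst (2) q) (rule ip_sum_right)
  also have "\<dots> = 0"
    by (intro sum.neutral ballI fischer_orthogonal[OF V 0])
  finally have "ip (e + 1) q q = 0" .
  moreover have "homogeneous (e + 1) q"
    unfolding q by (intro homogeneous_sum homogeneous_mult V L)
  ultimately show ?thesis by (intro homogeneous_ip_self)
qed

lemma mderiv_0 [simp]: "mderiv v 0 = 0"
  by (rule mfps_eqI) (simp add: mcoeff_mderiv)

lemma mcoeff_mvar_single: "mcoeff (mvar j) (0(i := 1)) = (if j = i then 1 else 0)"
proof -
  have "i = j" if "(0 :: 'a \<Rightarrow> nat)(i := 1) = 0(j := 1)"
    using fun_cong[OF that, of i] by (simp split: if_splits)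
  then show ?thesis by (auto simp only: mcoeff_mvar split: if_splits)
qed

lemma of_hol_mconst: "of_hol (mconst c) = mconst c"
  using of_hol_mconst_mult[of c 1] by (simp add: of_hol_def msubst_1)

lemma linear_form_eq_0:
  assumes "(\<Sum>j\<in>(UNIV :: 'n::finite set). mconst (a j) * mvar j) = 0" shows "a i = 0"
proof -
  have "mcoeff (\<Sum>j\<in>UNIV. mconst (a j) * mvar j) (0(i := 1)) = (\<Sum>j\<in>UNIV. if j = i then a j else 0)"
    unfolding mcoeff_sum mcoeff_mconst_mult mcoeff_mvar_single by (rule sum.cong) auto
  then show ?thesis using assms by simp
qed

locale nondegenerate_model = model D s for D :: "('n::finite + 'n) mfps" and s +
  assumes nondeg: "nondegenerate (to_hol D)"
begin

definition \<Delta> :: "'n mfps" where "\<Delta> = to_hol D"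

lemma of_hol_\<Delta>: "of_hol \<Delta> = D"
  unfolding \<Delta>_def by (rule of_hol_to_hol[OF D])

lemma Dk_eq: "Dk k = of_hol (mderiv k \<Delta>)"
  by (simp only: of_hol_\<Delta> of_hol_mderiv)

lemma \<Delta>_hom: "homogeneous s \<Delta>"
  unfolding \<Delta>_def by (rule homogeneous_to_hol[OF D])

lemma \<Delta>k_hom: "homogeneous (s - 1) (mderiv k \<Delta>)"
  by (rule homogeneous_mderiv[OF \<Delta>_hom])

lemma lin_eq: "lin a = of_hol (\<Sum>j\<in>UNIV. mconst (a j) * mvar j)"
  by (simp add: lin_def of_hol_sum of_hol_mconst_mult of_hol_mvar)

lemma linear_form_hom: "homogeneous 1 (\<Sum>j\<in>UNIV. mconst (a j) * mvar j)"
  by (intro homogeneous_sum homogeneous_mconst_mult homogeneous_mvar)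

lemma nondegD:
  assumes "\<And>k. homogeneous 1 (l k)" "(\<Sum>k\<in>UNIV. l k * mderiv k \<Delta>) = 0" shows "l k = 0"
  using nondeg assms unfolding nondegenerate_def \<Delta>_def[symmetric] by blast

lemma \<Delta>_nonzero: "\<Delta> \<noteq> 0"
proof
  assume "\<Delta> = 0"
  then have "(\<Sum>k\<in>UNIV. mvar k * mderiv k \<Delta>) = 0"
    by simp
  then have 0: "mvar k = (0 :: 'n mfps)" for k
    by (rule nondegD[OF homogeneous_mvar])
  fix k :: 'n
  have "mcoeff (mvar k) (0(k := 1)) = 1"
    by (simp only: mcoeff_mvar_single simp_thms if_True)
  then show False
    unfolding 0 by simp
qed

definition fischer_normal :: "nat \<Rightarrow> 'n mfps \<Rightarrow> bool" where
  "fischer_normal k q \<longleftrightarrow> (\<forall>t\<ge>1. k = t * s + 1 \<longrightarrow> fischer (\<Delta> ^ t) q = 0) \<and>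
    (\<forall>t\<ge>1. k = (t + 1) * s \<longrightarrow> (\<forall>j. fischer (mderiv j \<Delta> * \<Delta> ^ t) q = 0))"

lemma fischer_normal_0 [simp]: "fischer_normal k 0"
  by (simp add: fischer_normal_def)

lemma fischer_normal_add: "fischer_normal k p \<Longrightarrow> fischer_normal k q \<Longrightarrow> fischer_normal k (p + q)"
  by (simp add: fischer_normal_def fischer_add)

lemma fischer_normal_uminus: "fischer_normal k q \<Longrightarrow> fischer_normal k (- q)"
  by (simp add: fischer_normal_def fischer_uminus)

lemma parameter_levels_disjoint: "t * s + 1 \<noteq> t' * s"
proof
  assume "t * s + 1 = t' * s"
  then have "s dvd t * s + 1" by simp
  then have "s dvd 1" by (metis dvd_add_right_iff dvd_triv_right)
  then show False using s3 by simp
qed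

lemma fischer_normal_1:
  assumes "fischer (\<Delta> ^ t) q = 0" shows "fischer_normal (t * s + 1) q"
  unfolding fischer_normal_def
proof (intro conjI allI impI)
  fix t' assume "t * s + 1 = t' * s + 1"
  then have "t' = t" using s3 by simp
  then show "fischer (\<Delta> ^ t') q = 0" using assms by simp
next
  fix t' j assume "t * s + 1 = (t' + 1) * s"
  then show "fischer (mderiv j \<Delta> * \<Delta> ^ t') q = 0" using parameter_levels_disjoint by blast
qed

lemma fischer_normal_2:
  assumes "\<And>j. fischer (mderiv j \<Delta> * \<Delta> ^ t) q = 0" shows "fischer_normal ((t + 1) * s) q"
  unfolding fischer_normal_def
proof (intro conjI allI impI)
  fix t' assume "(t + 1) * s = t' * s + 1"
  then have False using parameter_levels_disjoint[of t' "t + 1"] by simp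
  then show "fischer (\<Delta> ^ t') q = 0" ..
next
  fix t' j assume "(t + 1) * s = (t' + 1) * s"
  then have "t' = t" using s3 by simp
  then show "fischer (mderiv j \<Delta> * \<Delta> ^ t') q = 0" using assms by simp
qed

definition full_normal :: "('n + 'n) mfps \<Rightarrow> bool" where
  "full_normal r \<longleftrightarrow> trace_normal r \<and> pure_real r \<and> (\<forall>k. fischer_normal k (to_hol (bipart k 0 r)))"

lemma to_hol_add: "to_hol (f + g) = to_hol f + to_hol g"
  by (rule mfps_eqI) (simp add: to_hol_def)

lemma to_hol_uminus: "to_hol (- f) = - to_hol f"
  by (rule mfps_eqI) (simp add: to_hol_def)

lemma to_hol_0 [simp]: "to_hol 0 = 0"
  by (rule mfps_eqI) (simp add: to_hol_def)

lemma full_normal_add: "full_normal r \<Longrightarrow> full_normal r' \<Longrightarrow> full_normal (r + r')"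
  by (simp add: full_normal_def trace_normal_add pure_real_add bipart_add to_hol_add fischer_normal_add)

lemma full_normal_uminus: "full_normal r \<Longrightarrow> full_normal (- r)"
  by (simp add: full_normal_def trace_normal_uminus pure_real_uminus bipart_uminus to_hol_uminus fischer_normal_uminus)

lemma full_normal_0 [simp]: "full_normal 0"
  by (simp add: full_normal_def pure_real_def)

lemma full_normal_mixed: "trace_normal r \<Longrightarrow> mixed r \<Longrightarrow> full_normal r"
  by (simp add: full_normal_def pure_real_mixed bipart_mixed)

lemma L_lift:
  assumes "\<And>k. bihomogeneous d 0 (f k)"
  shows "L (\<lambda>k. lift (to_hol (f k)) l) 0 0 = - (Hw f l + mbar (Hw f l))"
  by (simp add: L_def H_lift[OF assms])

lemma vge_levF_lift:
  assumes "bihomogeneous d 0 p" "d = 0 \<Longrightarrow> W \<le> l * s + 1" "d \<noteq> 0 \<Longrightarrow> W \<le> d + l * s + s - 1"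
  shows "vge levF W (lift (to_hol p) l)"
  unfolding vge_def
proof (intro allI impI)
  fix \<beta> assume "mcoeff (lift (to_hol p) l) \<beta> \<noteq> 0"
  then have "\<beta> None = l" "odeg \<beta> = d"
    using mcoeff_lift_nonzero[OF assms(1)] by blast+
  then show "W \<le> levF \<beta>" using assms(2,3) by (simp add: levF_def)
qed

text \<open>
  At the levels \<open>t * s + 1\<close> and \<open>(t + 1) * s\<close> the projection of \<open>q\<close> to the space that the Fischer
  conditions exclude is exactly of the form produced by a vector or matrix parameter of \<open>F\<close>. At the
  other levels there is neither a parameter nor a condition.
\<close>

lemma parameters_exist:
  assumes q: "bihomogeneous W 0 q"
  shows "\<exists>f q0. (\<forall>k. vge levF W (f k)) \<and> bihomogeneous W 0 q0 \<and> fischer_normal W (to_hol q0) \<and>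
    Im0 W (mbar q - mbar q0 - L f 0 0)"
proof -
  consider t where "t \<ge> 1" "W = t * s + 1" | t where "t \<ge> 1" "W = (t + 1) * s"
    | "\<And>t. t \<ge> 1 \<Longrightarrow> W \<noteq> t * s + 1" "\<And>t. t \<ge> 1 \<Longrightarrow> W \<noteq> (t + 1) * s" by blast
  then show ?thesis
  proof cases
    case 1
    have V: "homogeneous (t * s) (\<Delta> ^ t)" by (rule homogeneous_power[OF \<Delta>_hom])
    have hq: "homogeneous (t * s + 1) (to_hol q)"
      using homogeneous_to_hol[OF q] 1 by simp
    obtain M q0 where M: "to_hol q = (\<Sum>k\<in>(UNIV :: unit set). \<Delta> ^ t * (\<Sum>j\<in>UNIV. mconst (M k j) * mvar j)) + q0"
      "homogeneous (t * s + 1) q0" "\<And>k :: unit. fischer (\<Delta> ^ t) q0 = 0"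
      using fischer_projection[of "t * s" "\<lambda>_ :: unit. \<Delta> ^ t", OF V hq] by blast
    \<comment> \<open>The vector parameter enters pure terms through its conjugate, and \<open>L\<close> with a minus sign.\<close>
    define a where "a k = - cnj (M () k / cs ^ t)" for k
    have "to_hol q = \<Delta> ^ t * (\<Sum>j\<in>UNIV. mconst (M () j) * mvar j) + q0"
      using M(1) by (simp only: UNIV_unit sum.insert finite.emptyI empty_iff not_False_eq_True sum.empty add_0_right)
    then have q_eq: "q = D ^ t * lin (M ()) + of_hol q0"
      using of_hol_to_hol[OF q] by (simp add: lin_eq of_hol_add of_hol_mult of_hol_power of_hol_\<Delta>)
    have cs0: "cs ^ t \<noteq> 0" by (rule matrix_map_constants_nonzero(1)[OF refl])
    have "M () = (\<lambda>k. (- (cs ^ t)) * cnj (a k))"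
      using cs0 by (simp add: a_def fun_eq_iff)
    then have lM: "lin (M ()) = - (mconst (cs ^ t) * lin (\<lambda>k. cnj (a k)))"
      using lin_scale[of "- (cs ^ t)" "\<lambda>k. cnj (a k)"] by (simp add: mconst_uminus)
    have a0: "bihomogeneous 0 0 (mconst (a k))" for k
      by (auto simp: bihomogeneous_iff mcoeff_mconst split: if_splits)
    let ?f = "\<lambda>k. lift (to_hol (mconst (a k))) t"
    have Lf: "L ?f 0 0 = - (Hw (\<lambda>k. mconst (a k)) t + mbar (Hw (\<lambda>k. mconst (a k)) t))"
      by (rule L_lift) (rule a0)
    have "Im0 W (mbar q - mbar (of_hol q0) - L ?f 0 0)"
    proof -
      have "mbar q - mbar (of_hol q0) - L ?f 0 0 =
          Hw (\<lambda>k. mconst (a k)) t + mbar (Hw (\<lambda>k. mconst (a k)) t) -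
          mbar (mconst (cs ^ t) * (lin (\<lambda>k. cnj (a k)) * D ^ t))"
        unfolding q_eq lM Lf by (simp add: algebra_simps)
      then show ?thesis using Im0_vector_parameter[OF 1(2), of a] by simp
    qed
    moreover have "vge levF W (?f k)" for k
      by (rule vge_levF_lift[OF a0]) (use 1 in auto)
    moreover have "bihomogeneous W 0 (of_hol q0)"
      using M(2) 1 by (simp add: bihomogeneous_of_hol_iff)
    moreover have "fischer_normal W (to_hol (of_hol q0))"
      using fischer_normal_1[OF M(3)] 1 by simp
    ultimately show ?thesis
      by (intro exI[of _ ?f] exI[of _ "of_hol q0"]) simp
  next
    case 2
    define V where "V k = mderiv k \<Delta> * \<Delta> ^ t" for k
    have V: "homogeneous (W - 1) (V k)" for k
    proof -
      have "s - 1 + t * s = W - 1" using 2 s3 by simp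
      then show ?thesis
        using homogeneous_mult[OF \<Delta>k_hom homogeneous_power[OF \<Delta>_hom, of t]] by (simp add: V_def)
    qed
    have W1: "W - 1 + 1 = W" using 2 s3 by simp
    have hq: "homogeneous (W - 1 + 1) (to_hol q)"
      using homogeneous_to_hol[OF q] W1 by simp
    obtain M q0 where M: "to_hol q = (\<Sum>k\<in>UNIV. V k * (\<Sum>j\<in>UNIV. mconst (M k j) * mvar j)) + q0"
      "homogeneous (W - 1 + 1) q0" "\<And>k. fischer (V k) q0 = 0"
      using fischer_projection[where V = V, OF V hq] by blast
    obtain A where A: "matrix_map t A = (\<lambda>k j. - M k j)"
      using matrix_map_surj[OF 2(2)] by blast
    have "q = (\<Sum>k\<in>UNIV. of_hol (V k) * lin (M k)) + of_hol q0"
      using of_hol_to_hol[OF q] unfolding M(1) by (simp add: of_hol_add of_hol_sum of_hol_mult lin_eq)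
    also have "(\<Sum>k\<in>UNIV. of_hol (V k) * lin (M k)) = dil M * D ^ t"
      by (simp add: V_def of_hol_mult of_hol_power Dk_eq dil_def of_hol_\<Delta> sum_distrib_left mult_ac)
    finally have q_eq: "q = dil M * D ^ t + of_hol q0" .
    have dA: "dil (matrix_map t A) = - dil M"
      using dil_scale[of "- 1" M] by (simp add: A mconst_uminus)
    let ?f = "\<lambda>k. lift (to_hol (lin (A k))) t"
    have Lf: "L ?f 0 0 = - (Hw (\<lambda>k. lin (A k)) t + mbar (Hw (\<lambda>k. lin (A k)) t))"
      by (rule L_lift) (rule bihomogeneous_lin)
    have "Im0 W (mbar q - mbar (of_hol q0) - L ?f 0 0)"
    proof -
      have "mbar q - mbar (of_hol q0) - L ?f 0 0 =
          Hw (\<lambda>k. lin (A k)) t + mbar (Hw (\<lambda>k. lin (A k)) t) - mbar (dil (matrix_map t A) * D ^ t)"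
        unfolding q_eq dA Lf by (simp add: algebra_simps)
      then show ?thesis using Im0_matrix_parameter[OF 2(2), of A] by simp
    qed
    moreover have "vge levF W (?f k)" for k
      by (rule vge_levF_lift[OF bihomogeneous_lin]) (use 2 s3 in auto)
    moreover have "bihomogeneous W 0 (of_hol q0)"
      using M(2) W1 by (simp add: bihomogeneous_of_hol_iff)
    moreover have "fischer_normal W (to_hol (of_hol q0))"
      using fischer_normal_2[of t q0] 2 M(3) unfolding V_def by simp
    ultimately show ?thesis
      by (intro exI[of _ ?f] exI[of _ "of_hol q0"]) simp
  next
    case 3
    have "fischer_normal W (to_hol q)" using 3 by (auto simp: fischer_normal_def)
    moreover have "Im0 W (mbar q - mbar q - L (\<lambda>k. 0) 0 0)"
      by (rule Im0_small) (simp add: L_def)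
    ultimately show ?thesis using q
      by (intro exI[of _ "\<lambda>k. 0"] exI[of _ q]) simp
  qed
qed

text \<open>
  What is left of \<open>y\<close> is reduced to the conjugate of a holomorphic \<open>q\<close>, and by the parameters to the
  conjugate of some \<open>q0\<close> that satisfies the Fischer conditions. This is one half of a real pure term
  of the normal form; the other half, \<open>q0\<close> itself, is produced by \<open>G\<close>.
\<close>

lemma linearization_surjective:
  assumes "small W y"
  shows "\<exists>f g r. (\<forall>k. vge levF W (f k)) \<and> vge levG W g \<and> small W r \<and> full_normal r \<and>
    small (W + 1) (y - L f g r)"
proof -
  obtain q where q: "bihomogeneous W 0 q" "Im0 W (y - mbar q)"
    using Im0_pure_all[OF assms] unfolding Im0_pure_def by blast
  obtain f q0 where f: "\<And>k. vge levF W (f k)" and q0: "bihomogeneous W 0 q0" "fischer_normal W (to_hol q0)"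
    and fq: "Im0 W (mbar q - mbar q0 - L f 0 0)"
    using parameters_exist[OF q(1)] by blast
  \<comment> \<open>\<open>L\<close> contains \<open>- r\<close>.\<close>
  define r where "r = - (q0 + mbar q0)"
  have "Im0 W (q0 * u ^ 0)" by (rule Im0_hol[OF q0(1)]) simp
  then have "Im0 W ((y - mbar q) + (mbar q - mbar q0 - L f 0 0) - q0 * u ^ 0)"
    using q(2) fq by - (assumption | rule Im0_diff Im0_add)+
  also have "(y - mbar q) + (mbar q - mbar q0 - L f 0 0) - q0 * u ^ 0 = y - L f 0 r"
    by (simp add: L_def r_def)
  finally obtain f' g' r' where 2: "\<And>k. vge levF W (f' k)" "vge levG W g'" "small W r'"
      "trace_normal r'" "mixed r'" "small (W + 1) (y - L f 0 r - L f' g' r')"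
    unfolding Im0_def by blast
  have "small (W + 1) (y - L (\<lambda>k. f k + f' k) (0 + g') (r + r'))"
    using 2(6) unfolding L_add by (simp add: algebra_simps)
  moreover have "small W (r + r')"
  proof (rule small_add[OF _ 2(3)])
    have "small W q0"
      by (rule small_bihom[OF q0(1)]) (use s_mult(1)[of W] in linarith)+
    then show "small W r" unfolding r_def small_uminus by (intro small_add) simp_all
  qed
  moreover have "full_normal (r + r')"
  proof (rule full_normal_add)
    show "full_normal r'" by (rule full_normal_mixed[OF 2(4,5)])
    have parts: "bipart m n r = - ((if m = W \<and> n = 0 then q0 else 0) + (if m = 0 \<and> n = W then mbar q0 else 0))" for m n
      by (simp only: r_def bipart_uminus bipart_add bipart_bihomogeneous[OF q0(1)]
          bipart_bihomogeneous[OF bihomogeneous_mbar[OF q0(1)]])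
    have "trace_normal r"
      unfolding trace_normal_def parts by simp
    moreover have "pure_real r"
      unfolding pure_real_def parts by auto
    moreover have "fischer_normal k (to_hol (bipart k 0 r))" for k
    proof (cases "W = 0")
      case True
      have "fischer_normal 0 p" for p using s3 by (simp add: fischer_normal_def)
      then show ?thesis unfolding parts using True by (cases "k = 0") simp_all
    next
      case False
      then show ?thesis
        unfolding parts using fischer_normal_uminus[OF q0(2)] by (cases "k = W") (simp_all add: to_hol_uminus)
    qed
    ultimately show "full_normal r" by (simp add: full_normal_def)
  qed
  ultimately show ?thesis
    using f 2(1,2) by (intro exI[of _ "\<lambda>k. f k + f' k"] exI[of _ "0 + g'"] exI[of _ "r + r'"])
      (auto intro: vge_add)
qed

text \<open>
  The contribution \<open>q1\<close> of the parameters lies in the space that the Fischer conditions exclude. If it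
  satisfies them, then it vanishes; after cancellation of the power of \<open>\<Delta>\<close> this is a linear relation
  between linear forms, which nondegeneracy and the injectivity of \<open>matrix_map\<close> make trivial.
\<close>

lemma parameters_unique:
  assumes f: "\<And>k \<beta>. mcoeff (f k) \<beta> \<noteq> 0 \<Longrightarrow> levF \<beta> = W \<and> odeg \<beta> \<le> 1" and W: "W \<ge> s + 1"
  shows "\<exists>q1. bihomogeneous W 0 q1 \<and> Im0 W (- L f 0 0 - mbar q1) \<and>
    (fischer_normal W (to_hol q1) \<longrightarrow> f = (\<lambda>k. 0))"
proof -
  consider "f = (\<lambda>k. 0)" | k \<beta> where "mcoeff (f k) \<beta> \<noteq> 0" "odeg \<beta> = 0"
    | k \<beta> where "mcoeff (f k) \<beta> \<noteq> 0" "odeg \<beta> = 1"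
  proof -
    have "f = (\<lambda>k. 0)" if "\<And>k \<beta>. mcoeff (f k) \<beta> = 0"
      using that by (intro ext mfps_eqI) simp
    then show ?thesis
      using that f by (metis One_nat_def le_Suc_eq le_zero_eq)
  qed
  then show ?thesis
  proof cases
    case 1
    then show ?thesis
      by (intro exI[of _ 0]) (simp add: L_def Im0_small)
  next
    case (2 k0 \<beta>0)
    define t where "t = \<beta>0 None"
    have t: "W = t * s + 1" using f[OF 2(1)] 2(2) by (simp add: levF_def t_def)
    then have t1: "t \<ge> 1" using W s3 by (cases t) auto
    define a where "a k = mcoeff (f k) (oindex t 0)" for k
    have a0: "bihomogeneous 0 0 (mconst (a k))" for k
      by (auto simp: bihomogeneous_iff mcoeff_mconst split: if_splits)
    have fk: "f k = lift (to_hol (mconst (a k))) t" for k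
    proof (rule mfps_eqI)
      fix \<beta>
      have h: "mcoeff (to_hol (mconst (a k))) \<gamma> = (if \<gamma> = 0 then a k else 0)" for \<gamma> :: "'n \<Rightarrow> nat"
      proof -
        have "(case_sum \<gamma> (\<lambda>_. 0) :: 'n + 'n \<Rightarrow> nat) = 0 \<longleftrightarrow> \<gamma> = 0"
          by (auto simp: fun_eq_iff split: sum.splits)
        then show ?thesis by (simp add: to_hol_def mcoeff_mconst)
      qed
      show "mcoeff (f k) \<beta> = mcoeff (lift (to_hol (mconst (a k))) t) \<beta>"
      proof (cases "\<beta> None = t \<and> \<beta> \<circ> Some = 0")
        case True
        then have "\<beta> = oindex t 0" using oindex_eq[of \<beta>] by simp
        then have "mcoeff (f k) \<beta> = a k" by (simp only: a_def)
        moreover have "mcoeff (lift (to_hol (mconst (a k))) t) \<beta> = a k"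
          using True by (simp only: mcoeff_lift h simp_thms if_True)
        ultimately show ?thesis by (simp only:)
      next
        case False
        have "mcoeff (f k) \<beta> = 0"
        proof (rule ccontr)
          assume "mcoeff (f k) \<beta> \<noteq> 0"
          then have lev: "levF \<beta> = W" "odeg \<beta> \<le> 1" using f by blast+
          show False
          proof (cases "odeg \<beta> = 0")
            case True
            then have "\<beta> \<circ> Some = 0" by (auto simp: odeg_def fun_eq_iff)
            moreover have "\<beta> None * s = t * s" using lev True t by (simp add: levF_def)
            then have "\<beta> None = t" using s3 by simp
            ultimately show False using False by simp
          next
            case 3: False
            then have "(\<beta> None + 1) * s = t * s + 1" using lev t s3 by (simp add: levF_def)
            then show False using parameter_levels_disjoint by metis
          qed
        qed
        then show ?thesis using False by (auto simp: mcoeff_lift h)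
      qed
    qed
    define q1 where "q1 = mconst (cs ^ t) * (lin (\<lambda>k. cnj (a k)) * D ^ t)"
    have q1: "bihomogeneous W 0 q1"
      unfolding q1_def t
      using bihomogeneous_mconst_mult[OF bihomogeneous_mult[OF bihomogeneous_lin bihomogeneous_power[OF D]]] by simp
    have "L f 0 0 = - (Hw (\<lambda>k. mconst (a k)) t + mbar (Hw (\<lambda>k. mconst (a k)) t))"
    proof -
      have "f = (\<lambda>k. lift (to_hol (mconst (a k))) t)" by (rule ext) (rule fk)
      then show ?thesis using L_lift[OF a0] by simp
    qed
    then have "Im0 W (- L f 0 0 - mbar q1)"
      using Im0_vector_parameter[OF t, of a] unfolding q1_def by (simp only: minus_minus)
    moreover have "f = (\<lambda>k. 0)" if ok: "fischer_normal W (to_hol q1)"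
    proof -
      define l where "l = (\<Sum>j\<in>UNIV. mconst (cnj (a j)) * mvar j)"
      have l: "homogeneous 1 l" unfolding l_def by (rule linear_form_hom)
      have V: "homogeneous (t * s) (\<Delta> ^ t)" by (rule homogeneous_power[OF \<Delta>_hom])
      have "q1 = of_hol (\<Delta> ^ t * (mconst (cs ^ t) * l))"
        by (simp add: q1_def l_def lin_eq of_hol_mult of_hol_power of_hol_mconst of_hol_\<Delta> mult_ac)
      then have th: "to_hol q1 = \<Delta> ^ t * (mconst (cs ^ t) * l)" by simp
      have e0: "fischer (\<Delta> ^ t) (to_hol q1) = 0"
        using ok t t1 unfolding fischer_normal_def by blast
      have e1: "to_hol q1 = (\<Sum>k\<in>(UNIV :: unit set). \<Delta> ^ t * (mconst (cs ^ t) * l))"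
        unfolding th by simp
      have "to_hol q1 = 0"
        by (rule fischer_projection_unique[where V = "\<lambda>_. \<Delta> ^ t", OF V e1 homogeneous_mconst_mult[OF l] e0])
      then have "\<Delta> ^ t = 0 \<or> mconst (cs ^ t) * l = 0"
        using mult_homogeneous_eq_0[OF V homogeneous_mconst_mult[OF l]] th by metis
      then have "mconst (cs ^ t) * l = 0"
        using power_homogeneous_eq_0[OF \<Delta>_hom] \<Delta>_nonzero by blast
      moreover have "mconst (1 / cs ^ t) * mconst (cs ^ t) = (1 :: 'n mfps)"
        unfolding mconst_mult[symmetric] using matrix_map_constants_nonzero(1)[OF refl, of t] by simp
      then have "l = mconst (1 / cs ^ t) * (mconst (cs ^ t) * l)"
        by (simp only: mult.assoc[symmetric] mult_1_left)
      ultimately have "l = 0"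
        by (simp only: mult_zero_right)
      then have "cnj (a k) = 0" for k
        unfolding l_def by (rule linear_form_eq_0)
      then have "a k = 0" for k by simp
      then show ?thesis
        using fk by (intro ext mfps_eqI) (simp add: mcoeff_lift)
    qed
    ultimately show ?thesis using q1 by blast
  next
    case (3 k0 \<beta>0)
    define t where "t = \<beta>0 None"
    have t: "W = (t + 1) * s" using f[OF 3(1)] 3(2) s3 by (simp add: levF_def t_def)
    then have t1: "t \<ge> 1" using W s3 by (cases t) auto
    define A where "A k j = mcoeff (f k) (oindex t (0(j := 1)))" for k j
    have fk: "f k = lift (to_hol (lin (A k))) t" for k
    proof (rule mfps_eqI)
      fix \<beta>
      show "mcoeff (f k) \<beta> = mcoeff (lift (to_hol (lin (A k))) t) \<beta>"
      proof (cases "\<beta> None = t \<and> odeg \<beta> = 1")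
        case True
        then have "mdeg (\<beta> \<circ> Some) = 1" by (simp add: mdeg_comp_Some)
        then obtain i where "mmono (\<beta> \<circ> Some) = mvar i" by (rule mmono_mdeg_1)
        then have i: "\<beta> \<circ> Some = 0(i := 1)"
          unfolding mvar_eq_mmono by (metis mcoeff_mmono zero_neq_one)
        then have "\<beta> = oindex t (0(i := 1))" using oindex_eq[of \<beta>] True by simp
        then have "mcoeff (f k) \<beta> = A k i" by (simp add: A_def)
        moreover have "mcoeff (\<Sum>j\<in>UNIV. mconst (A k j) * mvar j) (0(i := 1)) = (\<Sum>j\<in>UNIV. if j = i then A k j else 0)"
          unfolding mcoeff_sum mcoeff_mconst_mult mcoeff_mvar_single by (rule sum.cong) auto
        ultimately show ?thesis using True i by (simp add: mcoeff_lift lin_eq)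
      next
        case False
        have "mcoeff (f k) \<beta> = 0"
        proof (rule ccontr)
          assume "mcoeff (f k) \<beta> \<noteq> 0"
          then have lev: "levF \<beta> = W" "odeg \<beta> \<le> 1" using f by blast+
          show False
          proof (cases "odeg \<beta> = 0")
            case True
            then have "\<beta> None * s + 1 = (t + 1) * s" using lev t by (simp add: levF_def)
            then show False using parameter_levels_disjoint by metis
          next
            case 3: False
            then have o: "odeg \<beta> = 1" using lev by simp
            then have "(\<beta> None + 1) * s = (t + 1) * s" using lev t s3 by (simp add: levF_def)
            then have "\<beta> None = t" using s3 unfolding mult_cancel2 by linarith
            then show False using False o by simp
          qed
        qed
        moreover have "mcoeff (lift (to_hol (lin (A k))) t) \<beta> = 0"
          using mcoeff_lift_nonzero[OF bihomogeneous_lin] False by blast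
        ultimately show ?thesis by simp
      qed
    qed
    define q1 where "q1 = dil (matrix_map t A) * D ^ t"
    have q1: "bihomogeneous W 0 q1"
      unfolding q1_def t
      using bihomogeneous_mult[OF bihomogeneous_dil bihomogeneous_power[OF D]] by simp
    have "L f 0 0 = - (Hw (\<lambda>k. lin (A k)) t + mbar (Hw (\<lambda>k. lin (A k)) t))"
    proof -
      have "f = (\<lambda>k. lift (to_hol (lin (A k))) t)" by (rule ext) (rule fk)
      then show ?thesis using L_lift[OF bihomogeneous_lin] by simp
    qed
    then have "Im0 W (- L f 0 0 - mbar q1)"
      using Im0_matrix_parameter[OF t, of A] unfolding q1_def by (simp only: minus_minus)
    moreover have "f = (\<lambda>k. 0)" if ok: "fischer_normal W (to_hol q1)"
    proof -
      define l where "l k = (\<Sum>j\<in>UNIV. mconst (matrix_map t A k j) * mvar j)" for k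
      have l: "homogeneous 1 (l k)" for k unfolding l_def by (rule linear_form_hom)
      define V where "V k = mderiv k \<Delta> * \<Delta> ^ t" for k
      have V: "homogeneous (W - 1) (V k)" for k
      proof -
        have "s - 1 + t * s = W - 1" using t s3 by simp
        then show ?thesis
          using homogeneous_mult[OF \<Delta>k_hom homogeneous_power[OF \<Delta>_hom, of t]] by (simp add: V_def)
      qed
      have "q1 = of_hol (\<Sum>k\<in>UNIV. V k * l k)"
        by (simp add: q1_def l_def V_def dil_def lin_eq of_hol_mult of_hol_power of_hol_sum Dk_eq
            of_hol_\<Delta> sum_distrib_left mult_ac)
      then have th: "to_hol q1 = (\<Sum>k\<in>UNIV. V k * l k)" by simp
      have "fischer (V k) (to_hol q1) = 0" for k
        using ok t t1 unfolding fischer_normal_def V_def by blast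
      then have "to_hol q1 = 0"
        by (rule fischer_projection_unique[OF V th l])
      moreover have "to_hol q1 = (\<Sum>k\<in>UNIV. l k * mderiv k \<Delta>) * \<Delta> ^ t"
        by (simp add: th V_def sum_distrib_left mult_ac)
      moreover have "homogeneous (1 + (s - 1)) (\<Sum>k\<in>UNIV. l k * mderiv k \<Delta>)"
        by (intro homogeneous_sum homogeneous_mult l \<Delta>k_hom)
      ultimately have "(\<Sum>k\<in>UNIV. l k * mderiv k \<Delta>) = 0 \<or> \<Delta> ^ t = 0"
        using mult_homogeneous_eq_0[OF _ homogeneous_power[OF \<Delta>_hom]] by metis
      then have "(\<Sum>k\<in>UNIV. l k * mderiv k \<Delta>) = 0"
        using power_homogeneous_eq_0[OF \<Delta>_hom] \<Delta>_nonzero by blast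
      then have "l k = 0" for k
        by (rule nondegD[OF l])
      then have "matrix_map t A k j = 0" for k j
        unfolding l_def by (rule linear_form_eq_0)
      then have "matrix_map t A = (\<lambda>k j. 0)" by (intro ext)
      then have "A = (\<lambda>k j. 0)" by (rule matrix_map_inj[OF t])
      then have "lin (A k) = 0" for k by (simp add: lin_def)
      then show ?thesis
        using fk by (intro ext mfps_eqI) (simp add: mcoeff_lift)
    qed
    ultimately show ?thesis using q1 by blast
  qed
qed

text \<open>
  The contribution of the parameters is, modulo \<open>Im0\<close>, the conjugate of a holomorphic \<open>q1\<close>. Replacing
  the parameters by the terms that realize this reduction yields unknowns without parameters, with
  $q_1 + \overline{q_1}$ added to the normal form. Injectivity without parameters then identifies \<open>q1\<close> with the
  negative of the pure part of \<open>r\<close>. So \<open>q1\<close> satisfies the Fischer conditions and the parameters vanish.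
\<close>

lemma linearization_injective:
  assumes F: "\<And>k. vge levF W (f k)" and G: "vge levG W g" and r: "small W r" "full_normal r"
    and L: "small (W + 1) (L f g r)" and W: "W \<ge> s + 1"
  shows "(\<forall>k. vge levF (W + 1) (f k)) \<and> vge levG (W + 1) g \<and> small (W + 1) r"
proof -
  \<comment> \<open>The parameters among the unknowns, and the rest.\<close>
  define fp where "fp k = keep (\<lambda>\<beta>. levF \<beta> = W \<and> odeg \<beta> \<le> 1) (f k)" for k
  define f' where "f' k = keep (\<lambda>\<beta>. \<not> (levF \<beta> = W \<and> odeg \<beta> \<le> 1)) (f k)" for k
  have "fp k + f' k = f k" for k
    unfolding f'_def fp_def by (rule keep_add_keep)
  then have f_sum: "f = (\<lambda>k. f' k + fp k)"
    by (intro ext) (simp only: add.commute[of "f' _"])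
  have F': "vge levF W (f' k)" for k
    using F[of k] by (auto simp: vge_def f'_def mcoeff_keep)
  have par': "2 \<le> odeg \<beta>" if "mcoeff (f' k) \<beta> \<noteq> 0" "levF \<beta> = W" for k \<beta>
    using that by (auto simp: f'_def mcoeff_keep split: if_splits)
  have par: "levF \<beta> = W \<and> odeg \<beta> \<le> 1" if "mcoeff (fp k) \<beta> \<noteq> 0" for k \<beta>
    using that unfolding fp_def mcoeff_keep by (meson)
  have "\<exists>q1. bihomogeneous W 0 q1 \<and> Im0 W (- L fp 0 0 - mbar q1) \<and>
      (fischer_normal W (to_hol q1) \<longrightarrow> fp = (\<lambda>k. 0))"
    by (rule parameters_unique[OF _ W], rule par)
  then obtain q1 where
    q1: "bihomogeneous W 0 q1" "Im0 W (- L fp 0 0 - mbar q1)"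
      "fischer_normal W (to_hol q1) \<Longrightarrow> fp = (\<lambda>k. 0)"
    by blast
  obtain f0 g0 r0 where 0: "\<And>k. vge levF W (f0 k)" "\<And>k. vge odeg 2 (f0 k)" "vge levG W g0"
     "small W r0" "trace_normal r0" "mixed r0" "small (W + 1) (- L fp 0 0 - mbar q1 - L f0 g0 r0)"
    using q1(2) unfolding Im0_def by blast
  define f1 where "f1 k = f' k + - f0 k" for k
  \<comment> \<open>The term of \<open>G\<close> cancels the holomorphic half of the real pure term added to the normal form.\<close>
  define g1 where "g1 = g + - g0 + lift (to_hol q1) 0"
  define r1 where "r1 = r + - r0 + (q1 + mbar q1)"
  have q1s: "small W q1"
    by (rule small_bihom[OF q1(1)]) (use s_mult(1)[of W] in linarith)+
  have parts: "bipart m n (q1 + mbar q1) = (if m = W \<and> n = 0 then q1 else 0) + (if m = 0 \<and> n = W then mbar q1 else 0)" for m n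
    by (simp add: bipart_add bipart_bihomogeneous[OF q1(1)]
        bipart_bihomogeneous[OF bihomogeneous_mbar[OF q1(1)]])
  have "L f1 g1 r1 = L (\<lambda>k. f' k + - f0 k) ((g + - g0) + lift (to_hol q1) 0) ((r + - r0) + (q1 + mbar q1))"
    by (simp add: f1_def[abs_def] g1_def r1_def)
  also have "\<dots> = L f' g r - L f0 g0 r0 + L (\<lambda>k. 0) (lift (to_hol q1) 0) (q1 + mbar q1)"
    using L_add[of "\<lambda>k. f' k + - f0 k" "\<lambda>k. 0" "g + - g0" "lift (to_hol q1) 0" "r + - r0" "q1 + mbar q1"]
      L_add[of f' "\<lambda>k. - f0 k" g "- g0" r "- r0"] L_uminus[of f0 g0 r0] by simp
  also have "L (\<lambda>k. 0) (lift (to_hol q1) 0) (q1 + mbar q1) = - mbar q1"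
    by (simp add: L_def rs_lift[OF q1(1)])
  also have "L f' g r - L f0 g0 r0 + - mbar q1 = L f g r + (- L fp 0 0 - mbar q1 - L f0 g0 r0)"
    using L_add[of f' fp g 0 r 0] by (simp add: f_sum[symmetric])
  finally have L1: "small (W + 1) (L f1 g1 r1)"
    using small_add[OF L 0(7)] by simp
  have F1: "vge levF W (f1 k)" for k
    unfolding f1_def using F' 0(1) by (intro vge_add) simp_all
  have P1: "2 \<le> odeg \<beta>" if nz: "mcoeff (f1 k) \<beta> \<noteq> 0" "levF \<beta> = W" for k \<beta>
  proof -
    have "mcoeff (f' k) \<beta> \<noteq> 0 \<or> mcoeff (f0 k) \<beta> \<noteq> 0" using nz by (auto simp: f1_def)
    then show ?thesis using par' nz(2) 0(2)[of k] by (auto simp: vge_def)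
  qed
  have G1: "vge levG W g1"
  proof -
    have "vge levG W (lift (to_hol q1) 0)"
      using mcoeff_lift_nonzero[OF q1(1)] by (auto simp: vge_def levG_def)
    then show ?thesis unfolding g1_def using G 0(3) by (intro vge_add) simp_all
  qed
  have R1: "small W r1"
    unfolding r1_def using r(1) 0(4) q1s by (intro small_add) simp_all
  have N1: "trace_normal r1"
  proof -
    have "trace_normal (q1 + mbar q1)" unfolding trace_normal_def parts using W by simp
    moreover have "trace_normal r" using r(2) by (simp add: full_normal_def)
    ultimately show ?thesis
      unfolding r1_def by (intro trace_normal_add[of "r + - r0"] trace_normal_add[of r] trace_normal_uminus[OF 0(5)])
  qed
  have PR1: "pure_real r1"
  proof -
    have "pure_real (q1 + mbar q1)" unfolding pure_real_def parts by auto
    moreover have "pure_real r" using r(2) by (simp add: full_normal_def)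
    ultimately show ?thesis
      unfolding r1_def
      by (intro pure_real_add[of "r + - r0"] pure_real_add[of r] pure_real_mixed[OF mixed_uminus[OF 0(6)]])
  qed
  have W1: "1 \<le> W" using W by simp
  have "(\<forall>k. vge levF (W + 1) (f1 k)) \<and> vge levG (W + 1) g1 \<and> small (W + 1) r1"
    by (rule linearization_injective0[OF F1 _ G1 R1 N1 PR1 L1 W1], rule P1)
  then have "small (W + 1) r1" by blast
  then have "bipart W 0 r1 = 0"
    by (intro mfps_eqI) (auto simp: mcoeff_bipart small_mcoeff)
  moreover have "bipart W 0 r1 = bipart W 0 r + bipart W 0 (- r0) + bipart W 0 (q1 + mbar q1)"
    by (simp only: r1_def bipart_add)
  moreover have "bipart W 0 (- r0) = 0"
    using bipart_mixed[OF mixed_uminus[OF 0(6)], of W] by blast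
  moreover have "bipart W 0 (q1 + mbar q1) = q1"
    unfolding parts using W by simp
  ultimately have "bipart W 0 r + q1 = 0"
    by (simp only: add_0_right)
  then have "q1 = - bipart W 0 r" by (simp add: eq_neg_iff_add_eq_0 add.commute)
  then have "fischer_normal W (to_hol q1)"
    using r(2) fischer_normal_uminus by (simp add: full_normal_def to_hol_uminus)
  then have "fp = (\<lambda>k. 0)" by (rule q1(3))
  then have ff: "f = f'" using f_sum by (simp add: fun_eq_iff)
  have two: "2 \<le> odeg \<beta>" if "mcoeff (f k) \<beta> \<noteq> 0" "levF \<beta> = W" for k \<beta>
    using par' that unfolding ff by blast
  show ?thesis
    by (rule linearization_injective0[OF F _ G r(1) _ _ L W1], rule two) (use r(2) in \<open>auto simp: full_normal_def\<close>)
qed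

end


section \<open>The nonlinear equation\<close>

lemma restrict_to_mvar_None: "mcoeff \<rho> 0 = 0 \<Longrightarrow> restrict_to \<rho> (mvar None) = \<rho>"
  unfolding restrict_to_def by (subst msubst_mvar) (auto split: option.splits)

lemma restrict_to_mvar_Some: "mcoeff \<rho> 0 = 0 \<Longrightarrow> restrict_to \<rho> (mvar (Some k)) = mvar (Inl k)"
  unfolding restrict_to_def by (subst msubst_mvar) (auto split: option.splits)

lemma coherent_limit:
  assumes "\<And>n. vge lev (N + n) (x (Suc n) - x n)"
  shows "\<exists>y. \<forall>n. vge lev (N + n) (y - x n)"
proof -
  \<comment> \<open>From this index on, the coefficient at \<open>\<beta>\<close> no longer changes.\<close>
  define y where "y = Abs_mfps (\<lambda>\<beta>. mcoeff (x (Suc (lev \<beta>))) \<beta>)"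
  have const: "mcoeff (x (n + m)) \<beta> = mcoeff (x n) \<beta>" if "lev \<beta> < N + n" for n m \<beta>
  proof (induction m)
    case (Suc m)
    have "mcoeff (x (Suc (n + m)) - x (n + m)) \<beta> = 0"
      by (rule vgeD[OF assms[of "n + m"]]) (use that in simp)
    then show ?case using Suc by simp
  qed simp
  have "vge lev (N + n) (y - x n)" for n
    unfolding vge_def
  proof (intro allI impI)
    fix \<beta> assume nz: "mcoeff (y - x n) \<beta> \<noteq> 0"
    show "N + n \<le> lev \<beta>"
    proof (rule ccontr)
      assume "\<not> N + n \<le> lev \<beta>"
      then have "mcoeff (x (n + Suc (lev \<beta>))) \<beta> = mcoeff (x n) \<beta>"
        by (intro const) simp
      moreover have "mcoeff (x (Suc (lev \<beta>) + n)) \<beta> = mcoeff (x (Suc (lev \<beta>))) \<beta>"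
        by (intro const) simp
      ultimately show False using nz by (simp add: y_def add.commute)
    qed
  qed
  then show ?thesis by blast
qed

locale normalization = nondegenerate_model D s for D :: "('n::finite + 'n) mfps" and s +
  fixes \<rho> :: "('n + 'n) mfps"
  assumes \<rho>: "small (s + 1) (\<rho> - u)"
begin

abbreviation R :: "'n option mfps \<Rightarrow> ('n + 'n) mfps" where "R \<equiv> restrict_to \<rho>"

lemma \<rho>_ord: "vz 1 (s - 1) s \<rho>" "vz (s - 1) 1 s \<rho>"
proof -
  have "small s (\<rho> - u)" by (rule small_mono[OF \<rho>]) simp
  then have "vz 1 (s - 1) s ((\<rho> - u) + u)" "vz (s - 1) 1 s ((\<rho> - u) + u)"
    unfolding small_def by (blast intro: vge_add u_ord)+
  then show "vz 1 (s - 1) s \<rho>" "vz (s - 1) 1 s \<rho>" by simp_all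
qed

lemma \<rho>_0 [simp]: "mcoeff \<rho> 0 = 0"
  by (rule vgeD[OF \<rho>_ord(1)]) (use s3 in simp)

text \<open>
  The substitution $(F, \overline F)$ on the manifold \<open>w = \<rho>\<close>, for \<open>F = z + f\<close>.
\<close>

definition map_on :: "('n \<Rightarrow> 'n option mfps) \<Rightarrow> 'n + 'n \<Rightarrow> ('n + 'n) mfps" where
  "map_on f = case_sum (\<lambda>k. mvar (Inl k) + R (f k)) (\<lambda>k. mvar (Inr k) + mbar (R (f k)))"

lemma map_on_simps [simp]: "map_on f (Inl k) = mvar (Inl k) + R (f k)"
  "map_on f (Inr k) = mvar (Inr k) + mbar (R (f k))"
  by (simp_all add: map_on_def)

definition E :: "('n \<Rightarrow> 'n option mfps) \<Rightarrow> 'n option mfps \<Rightarrow> ('n + 'n) mfps \<Rightarrow> ('n + 'n) mfps" where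
  "E f g r = \<rho> + R g - msubst (u + r) (map_on f)"

lemma transforms_iff_E:
  "transforms (\<lambda>k. mvar (Some k) + f k) (mvar None + g) \<rho> (u + r) \<longleftrightarrow> E f g r = 0"
proof -
  have "case_sum (\<lambda>k. R (mvar (Some k) + f k)) (\<lambda>k. mbar (R (mvar (Some k) + f k))) = map_on f"
    by (auto simp: fun_eq_iff map_on_def restrict_to_add restrict_to_mvar_Some split: sum.splits)
  then show ?thesis
    by (simp add: transforms_def E_def restrict_to_add restrict_to_mvar_None)
qed

text \<open>The estimates are the same in both weights, which only enter through \<open>a + b = s\<close>.\<close>

context
  fixes a b W :: nat and f f' :: "'n \<Rightarrow> 'n option mfps"
  assumes ab: "a \<ge> 1" "b \<ge> 1" "a + b = s" and W: "W \<ge> s + 1"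
    and u_ab: "vz a b s u" and \<rho>_ab: "vz a b (s + 1) (\<rho> - u)"
    and c_ab: "\<And>k. vz a b b (mvar (Inr k) + Dk k)"
    and f_ab: "\<And>k. vz a b (a + 1) (R (f k))" "\<And>k. vz b a (b + 1) (R (f k))"
    and f'_ab: "\<And>k. vz a b (a + (W - s)) (R (f' k))" "\<And>k. vz b a (b + (W - s)) (R (f' k))"
begin

lemma map_on_near_identity: "vz a b (zw a b v + 1) (map_on f v - mvar v)"
  using f_ab by (cases v) (simp_all add: vge_mbar)

lemma map_on_increment: "vz a b (zw a b v + (W - s)) (map_on (\<lambda>k. f k + f' k) v - map_on f v)"
  using f'_ab by (cases v) (simp_all add: vge_mbar restrict_to_add)

lemma map_on_ord: "vz a b (zw a b v) (map_on f v)"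
  using vge_add[OF vge_mono[OF map_on_near_identity[of v]] vge_mvar[of "zw a b" v]] by simp

lemma map_on_ord': "vz a b (zw a b v) (map_on (\<lambda>k. f k + f' k) v)"
  using vge_add[OF vge_mono[OF map_on_increment[of v]] map_on_ord[of v]] by simp

lemma map_on_near_identity': "vz a b (zw a b v + 1) (map_on (\<lambda>k. f k + f' k) v - mvar v)"
  using vge_add[OF vge_mono[OF map_on_increment[of v], of "zw a b v + 1"] map_on_near_identity[of v]] W
  by simp

lemma map_on_0: "mcoeff (map_on f v) 0 = 0" "mcoeff (map_on (\<lambda>k. f k + f' k) v) 0 = 0"
proof -
  have "zw a b v > 0" using ab by (cases v) auto
  then show "mcoeff (map_on f v) 0 = 0" "mcoeff (map_on (\<lambda>k. f k + f' k) v) 0 = 0"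
    using vgeD[OF map_on_ord[of v], of 0] vgeD[OF map_on_ord'[of v], of 0] by simp_all
qed

lemma mderiv_quadric:
  "mderiv (Inl k) (quadric :: ('n + 'n) mfps) = mvar (Inr k)"
  "mderiv (Inr k) (quadric :: ('n + 'n) mfps) = mvar (Inl k)"
proof -
  have 1: "mderiv v (mvar w) = (if v = w then 1 else 0)" for v w :: "'n + 'n"
    using mderiv_mvar_mult[of v w 1] by (simp add: mderiv_1)
  have "mderiv v (quadric :: ('n + 'n) mfps) =
      (\<Sum>j\<in>UNIV. (if v = Inl j then mvar (Inr j) else 0) + (if v = Inr j then mvar (Inl j) else 0))" for v
    unfolding quadric_def mderiv_sum mderiv_mvar_mult 1 by (rule sum.cong) auto
  from this[of "Inl k"] this[of "Inr k"]
  show "mderiv (Inl k) (quadric :: ('n + 'n) mfps) = mvar (Inr k)"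
    "mderiv (Inr k) (quadric :: ('n + 'n) mfps) = mvar (Inl k)"
    by (simp_all add: sum.distrib)
qed

lemma mderiv_u: "mderiv (Inl k) u = mvar (Inr k) + Dk k" "mderiv (Inr k) u = mvar (Inl k) + mbar (Dk k)"
proof -
  have 1: "mderiv (Inr k) D = 0"
    using mderiv_of_hol_Inr[of k \<Delta>] by (simp only: of_hol_\<Delta>)
  then have "mbar (mbar (mderiv (Inl k) Db)) = mbar 0"
    using mbar_mderiv[of k Db] by (simp only: mbar_mbar mbar_0)
  then have 2: "mderiv (Inl k) Db = 0"
    by (simp only: mbar_mbar mbar_0)
  show "mderiv (Inl k) u = mvar (Inr k) + Dk k" "mderiv (Inr k) u = mvar (Inl k) + mbar (Dk k)"
    by (simp_all add: u_def mderiv_add mderiv_quadric 1 2 mbar_mderiv)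
qed

lemma u_finite: "finite {\<beta>. mcoeff u \<beta> \<noteq> 0}"
proof (rule finite_subset)
  show "{\<beta>. mcoeff u \<beta> \<noteq> 0} \<subseteq> {\<beta>. mcoeff Q \<beta> \<noteq> 0} \<union> {\<beta>. mcoeff D \<beta> \<noteq> 0} \<union> {\<beta>. mcoeff Db \<beta> \<noteq> 0}"
    by (auto simp: u_def)
  show "finite ({\<beta>. mcoeff Q \<beta> \<noteq> 0} \<union> {\<beta>. mcoeff D \<beta> \<noteq> 0} \<union> {\<beta>. mcoeff Db \<beta> \<noteq> 0})"
    using bihomogeneous_finite[OF Q] bihomogeneous_finite[OF D] bihomogeneous_finite[OF Db] by simp
qed

text \<open>
  As \<open>\<rho>\<close> and \<open>u\<close> agree to leading order, restricting to one instead of the other costs one order.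
\<close>

lemma restriction_change:
  assumes "vge (wt (case_option s (\<lambda>_. a))) e h"
  shows "vz a b (e + 1) (R h - rs h)"
  unfolding restrict_to_def
proof (rule vge_msubst_diff[OF _ _ _ assms])
  fix v :: "'n option"
  have z: "vz a b a (mvar (Inl k))" for k
    using vge_mvar[of "zw a b" "Inl k"] by simp
  have "\<rho> = (\<rho> - u) + u" by simp
  then have \<rho>s: "vz a b s \<rho>"
    using vge_add[OF vge_mono[OF \<rho>_ab] u_ab] by simp
  have "vz a b (case_option s (\<lambda>_. a) v) (case v of None \<Rightarrow> u | Some k \<Rightarrow> mvar (Inl k)) \<and>
    vz a b (case_option s (\<lambda>_. a) v) (case v of None \<Rightarrow> \<rho> | Some k \<Rightarrow> mvar (Inl k)) \<and>
    vz a b (case_option s (\<lambda>_. a) v + 1)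
      ((case v of None \<Rightarrow> \<rho> | Some k \<Rightarrow> mvar (Inl k)) - (case v of None \<Rightarrow> u | Some k \<Rightarrow> mvar (Inl k)))"
  proof (cases v)
    case None
    show ?thesis unfolding None option.case using u_ab \<rho>s \<rho>_ab by blast
  next
    case (Some k)
    show ?thesis unfolding Some option.case diff_self using z[of k] by simp
  qed
  then show "vz a b (case_option s (\<lambda>_. a) v) (case v of None \<Rightarrow> u | Some k \<Rightarrow> mvar (Inl k))"
    "vz a b (case_option s (\<lambda>_. a) v) (case v of None \<Rightarrow> \<rho> | Some k \<Rightarrow> mvar (Inl k))"
    "vz a b (case_option s (\<lambda>_. a) v + 1)
      ((case v of None \<Rightarrow> \<rho> | Some k \<Rightarrow> mvar (Inl k)) - (case v of None \<Rightarrow> u | Some k \<Rightarrow> mvar (Inl k)))"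
    by blast+
qed

text \<open>
  The error consists of the Taylor remainder of \<open>u\<close>, the effect of the increment \<open>f'\<close> on \<open>r\<close> and of
  \<open>map_on\<close> on \<open>r'\<close>, and the changes of restriction from \<open>u\<close> to \<open>\<rho>\<close>. In each of them a leading order is
  improved by at least one.
\<close>

lemma E_expansion_weight:
  assumes f'_lev: "\<And>k. vge (wt (case_option s (\<lambda>_. a))) (a + (W - s)) (f' k)"
      "\<And>k. vz b a (b + (W - s) + 1) (R (f' k) - rs (f' k))"
    and c2: "\<And>k. vz b a a (mvar (Inr k) + Dk k)"
    and g: "vge (wt (case_option s (\<lambda>_. a))) W g'"
    and r: "vz a b (s + 1) r" and r': "vz a b W r'"
  shows "vz a b (W + 1) (E (\<lambda>k. f k + f' k) (g + g') (r + r') - E f g r - L f' g' r')"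
proof -
  define h where "h = map_on (\<lambda>k. f k + f' k)"
  define T where "T = (\<Sum>v\<in>UNIV. mderiv v u * (h v - map_on f v))"
  have Ws: "s + (W - s) = W" using W by simp
  have T: "T = (\<Sum>k\<in>UNIV. (mvar (Inr k) + Dk k) * R (f' k)) + mbar (\<Sum>k\<in>UNIV. (mvar (Inr k) + Dk k) * R (f' k))"
    unfolding T_def h_def
    by (simp add: UNIV_Plus_UNIV[symmetric] sum.Plus mderiv_u restrict_to_add del: UNIV_Plus_UNIV)
  have TH: "vz a b (W + 1) (T - H f' - mbar (H f'))"
  proof -
    have eq: "T - H f' - mbar (H f') = (\<Sum>k\<in>UNIV. (mvar (Inr k) + Dk k) * (R (f' k) - rs (f' k))) +
        mbar (\<Sum>k\<in>UNIV. (mvar (Inr k) + Dk k) * (R (f' k) - rs (f' k)))"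
      unfolding T H_def by (simp add: right_diff_distrib sum_subtractf)
    have "vz a b (W + 1) (\<Sum>k\<in>UNIV. (mvar (Inr k) + Dk k) * (R (f' k) - rs (f' k)))"
      by (intro vge_sum vge_mult'[OF c_ab restriction_change[OF f'_lev(1)]]) (use ab Ws in linarith)
    moreover have "vz b a (W + 1) (\<Sum>k\<in>UNIV. (mvar (Inr k) + Dk k) * (R (f' k) - rs (f' k)))"
      by (intro vge_sum vge_mult'[OF c2 f'_lev(2)]) (use ab Ws in linarith)
    ultimately show ?thesis unfolding eq by (intro vge_add) (simp_all only: vge_mbar)
  qed
  have A2: "vz a b (W + 1) (msubst u h - msubst u (map_on f) - T)"
    using taylor_rest[of "map_on f" h "zw a b" "W - s" u s] map_on_0 map_on_near_identity map_on_increment u_finite u_ab W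
    unfolding T_def h_def by simp
  have "s + 1 + (W - s) = W + 1" using W by simp
  then have A4: "vz a b (W + 1) (msubst r h - msubst r (map_on f))"
    using vge_msubst_diff[OF map_on_ord map_on_ord' map_on_increment r] unfolding h_def by metis
  have A5: "vz a b (W + 1) (msubst r' h - msubst r' mvar)"
    unfolding h_def by (rule vge_msubst_diff[OF vge_mvar map_on_ord' map_on_near_identity' r'])
  have A1: "vz a b (W + 1) (R g' - rs g')"
    by (rule restriction_change[OF g])
  have "E (\<lambda>k. f k + f' k) (g + g') (r + r') - E f g r - L f' g' r' =
      (R g' - rs g') - (msubst u h - msubst u (map_on f) - T) - (T - H f' - mbar (H f')) -
      (msubst r h - msubst r (map_on f)) - (msubst r' h - msubst r' mvar)"
    unfolding E_def L_def h_def by (simp add: restrict_to_add msubst_add algebra_simps)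
  then show ?thesis
    using A1 A2 TH A4 A5 by (simp only: vge_diff)
qed

end

lemma R_ord1:
  assumes "\<And>\<beta>. mcoeff h \<beta> \<noteq> 0 \<Longrightarrow> e \<le> odeg \<beta> + \<beta> None * s"
  shows "vz 1 (s - 1) e (R h)" and "vge (wt (case_option s (\<lambda>_. 1))) e h"
proof -
  show o: "vge (wt (case_option s (\<lambda>_. 1))) e h"
    using assms by (auto simp: vge_def wt_option mult.commute)
  show "vz 1 (s - 1) e (R h)"
    unfolding restrict_to_def
  proof (rule vge_msubst[OF _ o])
    show "vz 1 (s - 1) (case_option s (\<lambda>_. 1) v) (case v of None \<Rightarrow> \<rho> | Some k \<Rightarrow> mvar (Inl k))" for v :: "'n option"
      using \<rho>_ord(1) vge_mvar[of "zw 1 (s - 1)" "Inl _"] by (cases v) auto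
  qed
qed

lemma R_ord2:
  assumes "\<And>\<beta>. mcoeff h \<beta> \<noteq> 0 \<Longrightarrow> e \<le> (s - 1) * odeg \<beta> + \<beta> None * s"
  shows "vz (s - 1) 1 e (R h)" and "vge (wt (case_option s (\<lambda>_. s - 1))) e h"
proof -
  show o: "vge (wt (case_option s (\<lambda>_. s - 1))) e h"
    using assms by (auto simp: vge_def wt_option mult.commute)
  show "vz (s - 1) 1 e (R h)"
    unfolding restrict_to_def
  proof (rule vge_msubst[OF _ o])
    show "vz (s - 1) 1 (case_option s (\<lambda>_. s - 1) v) (case v of None \<Rightarrow> \<rho> | Some k \<Rightarrow> mvar (Inl k))" for v :: "'n option"
      using \<rho>_ord(2) vge_mvar[of "zw (s - 1) 1" "Inl _"] by (cases v) auto
  qed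
qed

lemma levF_ord:
  assumes "vge levF W h" "W \<ge> s + 1"
  shows "vz 1 (s - 1) (1 + (W - s)) (R h)" "vz (s - 1) 1 ((s - 1) + (W - s)) (R h)"
    "vge (wt (case_option s (\<lambda>_. 1))) (1 + (W - s)) h"
    "vge (wt (case_option s (\<lambda>_. s - 1))) ((s - 1) + (W - s)) h"
proof -
  have e: "W + 1 - s = 1 + (W - s)" "W - 1 = (s - 1) + (W - s)"
    using assms(2) s3 by simp_all
  have "W \<le> levF \<beta>" if "mcoeff h \<beta> \<noteq> 0" for \<beta>
    using assms(1) that by (simp add: vge_def)
  note b = levF_bounds[OF this, unfolded e]
  show "vz 1 (s - 1) (1 + (W - s)) (R h)" "vge (wt (case_option s (\<lambda>_. 1))) (1 + (W - s)) h"
    using R_ord1[OF b(1)] by blast+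
  show "vz (s - 1) 1 ((s - 1) + (W - s)) (R h)"
    "vge (wt (case_option s (\<lambda>_. s - 1))) ((s - 1) + (W - s)) h"
    using R_ord2[OF b(2)] by blast+
qed

lemma levG_ord:
  assumes "vge levG W h"
  shows "vge (wt (case_option s (\<lambda>_. 1))) W h" "vge (wt (case_option s (\<lambda>_. s - 1))) W h" "small W (R h)"
proof -
  have 1: "W \<le> odeg \<beta> + \<beta> None * s" if "mcoeff h \<beta> \<noteq> 0" for \<beta>
    using assms that by (simp add: vge_def levG_def)
  have 2: "W \<le> (s - 1) * odeg \<beta> + \<beta> None * s" if "mcoeff h \<beta> \<noteq> 0" for \<beta>
    using 1[OF that] s_mult(1)[of "odeg \<beta>"] by linarith
  show "vge (wt (case_option s (\<lambda>_. 1))) W h" "vge (wt (case_option s (\<lambda>_. s - 1))) W h"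
    using R_ord1(2)[OF 1] R_ord2(2)[OF 2] by blast+
  show "small W (R h)"
    using R_ord1(1)[OF 1] R_ord2(1)[OF 2] by (intro smallI) blast+
qed

lemma E_expansion:
  assumes f: "\<And>k. vge levF (s + 1) (f k)" and r: "small (s + 1) r" and W: "W \<ge> s + 1"
    and f': "\<And>k. vge levF W (f' k)" and g': "vge levG W g'" and r': "small W r'"
  shows "small (W + 1) (E (\<lambda>k. f k + f' k) (g + g') (r + r') - E f g r - L f' g' r')"
proof -
  have s1: "s + 1 - s = 1" by simp
  have \<rho>12: "vz 1 (s - 1) (s + 1) (\<rho> - u)" "vz (s - 1) 1 (s + 1) (\<rho> - u)"
    using \<rho> by (simp_all add: small_def)
  note fo = levF_ord[OF f order_refl, unfolded s1]
  note f'o = levF_ord[OF f' W]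
  have d1: "vz 1 (s - 1) (1 + (W - s) + 1) (R (f' k) - rs (f' k))" for k
    by (rule restriction_change[where f = f and f' = f' and W = W])
      (use s3 W u_ord \<rho>12 coeff_ord fo f'o in auto)
  have d2: "vz (s - 1) 1 ((s - 1) + (W - s) + 1) (R (f' k) - rs (f' k))" for k
    by (rule restriction_change[where f = f and f' = f' and W = W])
      (use s3 W u_ord \<rho>12 coeff_ord fo f'o in auto)
  show ?thesis
  proof (rule smallI)
    show "vz 1 (s - 1) (W + 1) (E (\<lambda>k. f k + f' k) (g + g') (r + r') - E f g r - L f' g' r')"
      by (rule E_expansion_weight)
        (use s3 W u_ord \<rho>12 coeff_ord fo f'o d2 levG_ord[OF g'] r r' in \<open>auto simp: small_def\<close>)
    show "vz (s - 1) 1 (W + 1) (E (\<lambda>k. f k + f' k) (g + g') (r + r') - E f g r - L f' g' r')"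
      by (rule E_expansion_weight)
        (use s3 W u_ord \<rho>12 coeff_ord fo f'o d1 levG_ord[OF g'] r r' in \<open>auto simp: small_def\<close>)
  qed
qed

definition solution :: "('n \<Rightarrow> 'n option mfps) \<Rightarrow> 'n option mfps \<Rightarrow> ('n + 'n) mfps \<Rightarrow> bool" where
  "solution f g r \<longleftrightarrow> (\<forall>k. vge levF (s + 1) (f k)) \<and> vge levG (s + 1) g \<and> small (s + 1) r \<and>
     full_normal r \<and> E f g r = 0"

text \<open>
  At each level in turn, the difference of two solutions is in the kernel of the linearized operator
  to leading order.
\<close>

lemma solution_unique:
  assumes 1: "solution f g r" and 2: "solution f2 g2 r2"
  shows "f = f2 \<and> g = g2"
proof -
  define f' where "f' k = f2 k - f k" for k
  define g' where "g' = g2 - g"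
  define r' where "r' = r2 - r"
  have e: "(\<lambda>k. f k + f' k) = f2" "g + g' = g2" "r + r' = r2"
    by (simp_all add: f'_def g'_def r'_def)
  have fn: "full_normal r'"
    using full_normal_add[OF _ full_normal_uminus, of r2 r] 1 2 by (simp add: solution_def r'_def)
  have "(\<forall>k. vge levF (s + 1 + n) (f' k)) \<and> vge levG (s + 1 + n) g' \<and> small (s + 1 + n) r'" for n
  proof (induction n)
    case 0
    then show ?case
      using 1 2 by (auto simp: solution_def f'_def g'_def r'_def intro: vge_diff small_diff)
  next
    case (Suc n)
    have "small (s + 1 + n + 1) (E (\<lambda>k. f k + f' k) (g + g') (r + r') - E f g r - L f' g' r')"
      by (rule E_expansion) (use 1 Suc in \<open>auto simp: solution_def\<close>)
    then have "small (s + 1 + n + 1) (L f' g' r')"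
      using 1 2 unfolding e by (simp add: solution_def)
    then show ?case
      using linearization_injective[of "s + 1 + n" f' g' r'] Suc fn by simp
  qed
  then have F: "vge levF (s + 1 + n) (f' k)" and G: "vge levG (s + 1 + n) g'" for n k
    by blast+
  have "f' k = 0" for k
  proof (rule vge_all_imp_0)
    fix W show "vge levF W (f' k)" by (rule vge_mono[OF F[of W]]) simp
  qed
  moreover have "g' = 0"
  proof (rule vge_all_imp_0)
    fix W show "vge levG W g'" by (rule vge_mono[OF G[of W]]) simp
  qed
  ultimately show ?thesis
    by (auto simp: f'_def g'_def fun_eq_iff)
qed

lemma bipart_small: "small W h \<Longrightarrow> m + (s - 1) * n < W \<Longrightarrow> bipart m n h = 0"
  by (rule mfps_eqI) (force simp: mcoeff_bipart small_mcoeff)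

text \<open>Each normalization condition concerns only finitely many homogeneous parts.\<close>

lemma full_normal_limit:
  assumes "\<And>W. \<exists>r'. full_normal r' \<and> small W (r - r')"
  shows "full_normal r"
proof -
  have approx: "\<exists>r'. full_normal r' \<and> (\<forall>m n. m + (s - 1) * n < W \<longrightarrow> bipart m n r = bipart m n r')" for W
  proof -
    obtain r' where r': "full_normal r'" "small W (r - r')" using assms by blast
    have "bipart m n r = bipart m n r'" if "m + (s - 1) * n < W" for m n
      using bipart_small[OF r'(2) that] by (simp add: bipart_diff)
    then show ?thesis using r'(1) by blast
  qed
  have "trace_normal r"
    unfolding trace_normal_def
  proof (intro allI impI)
    fix m n :: nat assume mn: "m \<noteq> 0" "n \<noteq> 0"
    obtain r' where "full_normal r'" "\<forall>m' n'. m' + (s - 1) * n' < m + (s - 1) * n + 1 \<longrightarrow> bipart m' n' r = bipart m' n' r'"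
      using approx by blast
    then show "(m < n \<longrightarrow> (trace_op ^^ (m - 1)) (bipart m n r) = 0) \<and> (n \<le> m \<longrightarrow> (trace_op ^^ n) (bipart m n r) = 0)"
      using mn by (simp add: full_normal_def trace_normal_def)
  qed
  moreover have "pure_real r"
    unfolding pure_real_def
  proof
    fix m
    obtain r' where "full_normal r'" "\<forall>m' n'. m' + (s - 1) * n' < m + (s - 1) * m + 1 \<longrightarrow> bipart m' n' r = bipart m' n' r'"
      using approx by blast
    then show "bipart 0 m r = mbar (bipart m 0 r)"
      by (simp add: full_normal_def pure_real_def)
  qed
  moreover have "fischer_normal k (to_hol (bipart k 0 r))" for k
  proof -
    obtain r' where "full_normal r'" "\<forall>m' n'. m' + (s - 1) * n' < k + 1 \<longrightarrow> bipart m' n' r = bipart m' n' r'"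
      using approx by blast
    then show ?thesis by (simp add: full_normal_def)
  qed
  ultimately show ?thesis by (simp add: full_normal_def)
qed

lemma small_iff_vge: "small W f \<longleftrightarrow> vge levR W f"
  by (simp add: small_def vge_min)

text \<open>
  Successive corrections: at each step the leading terms of the error are removed by solving the
  linearized equation. The corrections have increasing levels and add up to a solution.
\<close>

lemma solution_exists: "\<exists>f g r. solution f g r"
proof -
  let ?N = "s + 1"
  define P where "P n x \<longleftrightarrow> (case x of (f, g, r) \<Rightarrow> (\<forall>k :: 'n. vge levF ?N (f k)) \<and> vge levG ?N g \<and>
    small ?N r \<and> full_normal r \<and> small (?N + n) (E f g r))" for n x
  define T where "T n x y \<longleftrightarrow> (case x of (f, g, r) \<Rightarrow> case y of (f2, g2, r2) \<Rightarrow>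
    (\<forall>k :: 'n. vge levF (?N + n) (f2 k - f k)) \<and> vge levG (?N + n) (g2 - g) \<and> small (?N + n) (r2 - r))" for n x y
  have "\<exists>x. \<forall>n. P n (x n) \<and> T n (x n) (x (Suc n))"
  proof (rule dependent_nat_choice)
    have "map_on (\<lambda>k. 0) = mvar"
    proof
      fix v show "map_on (\<lambda>k. 0) v = mvar v" by (cases v) simp_all
    qed
    then have "E (\<lambda>k. 0) 0 0 = \<rho> - u" by (simp add: E_def)
    then show "\<exists>x. P 0 x"
      using \<rho> by (intro exI[of _ "(\<lambda>k. 0, 0, 0)"]) (simp add: P_def)
  next
    fix x n assume P: "P n x"
    obtain f g r where x: "x = (f, g, r)" by (cases x) auto
    have small_E: "small (?N + n) (- E f g r)" using P by (simp add: P_def x)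
    obtain f' g' r' where d: "\<And>k. vge levF (?N + n) (f' k)" "vge levG (?N + n) g'" "small (?N + n) r'"
      "full_normal r'" "small (?N + n + 1) (- E f g r - L f' g' r')"
      using linearization_surjective[OF small_E] by blast
    have "small (?N + n + 1) (E (\<lambda>k. f k + f' k) (g + g') (r + r') - E f g r - L f' g' r')"
      by (rule E_expansion) (use P d in \<open>auto simp: P_def x\<close>)
    then have "small (?N + n + 1) ((E (\<lambda>k. f k + f' k) (g + g') (r + r') - E f g r - L f' g' r') - (- E f g r - L f' g' r'))"
      by (rule small_diff[OF _ d(5)])
    then have "small (?N + Suc n) (E (\<lambda>k. f k + f' k) (g + g') (r + r'))" by simp
    moreover have "vge levF ?N (f' k)" for k by (rule vge_mono[OF d(1)]) simp
    moreover have "vge levG ?N g'" by (rule vge_mono[OF d(2)]) simp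
    moreover have "small ?N r'" by (rule small_mono[OF d(3)]) simp
    ultimately have "P (Suc n) (\<lambda>k. f k + f' k, g + g', r + r')"
      using P d(4) by (auto simp: P_def x intro: vge_add small_add full_normal_add)
    moreover have "T n x (\<lambda>k. f k + f' k, g + g', r + r')"
      using d by (simp add: T_def x)
    ultimately show "\<exists>y. P (Suc n) y \<and> T n x y" by blast
  qed
  then obtain x where x: "\<And>n. P n (x n)" "\<And>n. T n (x n) (x (Suc n))" by blast
  define f where "f n = fst (x n)" for n
  define g where "g n = fst (snd (x n))" for n
  define r where "r n = snd (snd (x n))" for n
  have P: "\<And>k. vge levF ?N (f n k)" "vge levG ?N (g n)" "small ?N (r n)" "full_normal (r n)"
      "small (?N + n) (E (f n) (g n) (r n))" for n
    using x(1)[of n] by (auto simp: P_def f_def g_def r_def case_prod_unfold)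
  have T: "\<And>k. vge levF (?N + n) (f (Suc n) k - f n k)" "vge levG (?N + n) (g (Suc n) - g n)"
      "small (?N + n) (r (Suc n) - r n)" for n
    using x(2)[of n] by (auto simp: T_def f_def g_def r_def case_prod_unfold)
  have "\<forall>k. \<exists>y. \<forall>n. vge levF (?N + n) (y - f n k)"
    using coherent_limit[of levF ?N "\<lambda>n. f n _"] T(1) by blast
  then obtain fl where f: "\<And>k n. vge levF (?N + n) (fl k - f n k)" by metis
  obtain gl where g: "\<And>n. vge levG (?N + n) (gl - g n)"
    using coherent_limit[of levG ?N g] T(2) by blast
  obtain rl where r: "\<And>n. small (?N + n) (rl - r n)"
    using coherent_limit[of levR ?N r] T(3)
    unfolding small_iff_vge by blast
  have E_small: "small (?N + n) (E fl gl rl)" for n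
  proof -
    have sum: "(\<lambda>k. f n k + (fl k - f n k)) = fl" "g n + (gl - g n) = gl" "r n + (rl - r n) = rl"
      by simp_all
    have "small (?N + n + 1) (E (\<lambda>k. f n k + (fl k - f n k)) (g n + (gl - g n)) (r n + (rl - r n)) -
        E (f n) (g n) (r n) - L (\<lambda>k. fl k - f n k) (gl - g n) (rl - r n))"
      by (rule E_expansion) (use P f g r in auto)
    then have "small (?N + n + 1) (E fl gl rl - E (f n) (g n) (r n) - L (\<lambda>k. fl k - f n k) (gl - g n) (rl - r n))"
      unfolding sum .
    then have 1: "small (?N + n) (E fl gl rl - E (f n) (g n) (r n) - L (\<lambda>k. fl k - f n k) (gl - g n) (rl - r n))"
      by (rule small_mono) simp
    have 2: "small (?N + n) (L (\<lambda>k. fl k - f n k) (gl - g n) (rl - r n))"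
      by (rule small_L) (use f g r in auto)
    show ?thesis
      using small_add[OF small_add[OF 1 2] P(5)[of n]] by simp
  qed
  have "E fl gl rl = 0"
  proof (rule vge_all_imp_0)
    fix W show "vge (wt (zw 1 (s - 1))) W (E fl gl rl)"
      using small_mono[OF E_small[of W], of W] by (simp add: small_def)
  qed
  moreover have "full_normal rl"
  proof (rule full_normal_limit)
    fix W
    have "small W (rl - r W)" by (rule small_mono[OF r]) simp
    then show "\<exists>r'. full_normal r' \<and> small W (rl - r')" using P(4) by blast
  qed
  moreover have "vge levF ?N (fl k)" for k
    using vge_add[OF f[where n = 0 and k = k, unfolded add_0_right] P(1)[of 0 k]] by simp
  moreover have "vge levG ?N gl"
    using vge_add[OF g[of 0, unfolded add_0_right] P(2)[of 0]] by simp
  moreover have "small ?N rl"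
    using small_add[OF r[of 0, unfolded add_0_right] P(3)[of 0]] by simp
  ultimately show ?thesis unfolding solution_def by blast
qed

text \<open>
  The terms of level at most \<open>s\<close>: the equation itself forces the leading pure terms to be those of
  \<open>D\<close>, and \<open>G\<close> to have no holomorphic terms of degree at most \<open>s\<close>.
\<close>

lemma low_levels:
  assumes f: "\<And>k. vge levF (s + 1) (f k)"
    and g: "\<And>\<beta>. mcoeff g \<beta> \<noteq> 0 \<Longrightarrow> 3 \<le> odeg \<beta> + 2 * \<beta> None"
    and r: "small s r" "bipart 1 1 r = 0" "bipart 0 s r = mbar (bipart s 0 r)" and E: "E f g r = 0"
  shows "vge levG (s + 1) g \<and> small (s + 1) r"
proof -
  define gl where "gl = keep (\<lambda>\<beta>. \<not> s + 1 \<le> levG \<beta>) g"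
  define gh where "gh = keep (\<lambda>\<beta>. s + 1 \<le> levG \<beta>) g"
  have g_eq: "g = gh + gl"
    unfolding gl_def gh_def by (rule keep_add_keep[symmetric])
  have gl: "\<beta> None = 0 \<and> odeg \<beta> \<le> s" if "mcoeff gl \<beta> \<noteq> 0" for \<beta>
  proof -
    have lev: "\<not> s + 1 \<le> odeg \<beta> + \<beta> None * s" and 3: "3 \<le> odeg \<beta> + 2 * \<beta> None"
      using that g[of \<beta>] by (auto simp: gl_def mcoeff_keep levG_def split: if_splits)
    show ?thesis
    proof (cases "\<beta> None")
      case (Suc l)
      then have "odeg \<beta> + l * s < 1" using lev unfolding Suc mult_Suc by linarith
      then have "odeg \<beta> = 0" "l * s = 0" by linarith+
      then have "odeg \<beta> = 0" "l = 0" using s3 by simp_all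
      then show ?thesis using 3 Suc by simp
    qed (use lev in simp)
  qed
  \<comment> \<open>The low terms of \<open>G\<close> do not involve \<open>w\<close>.\<close>
  define p where "p = Abs_mfps (\<lambda>\<gamma>. mcoeff gl (oindex 0 \<gamma>))"
  have p_fin: "finite {\<gamma>. mcoeff p \<gamma> \<noteq> 0}"
  proof (rule finite_subset[OF _ finite_multi_index_mdeg[of s]])
    show "{\<gamma>. mcoeff p \<gamma> \<noteq> 0} \<subseteq> {\<gamma>. mdeg \<gamma> \<le> s}"
      using gl by (auto simp: p_def odeg_def mdeg_def dest!: gl)
  qed
  have gl_p: "gl = lift p 0"
  proof (rule mfps_eqI)
    fix \<beta>
    show "mcoeff gl \<beta> = mcoeff (lift p 0) \<beta>"
    proof (cases "\<beta> None = 0")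
      case True
      then show ?thesis using oindex_eq[of \<beta>] by (simp add: mcoeff_lift p_def)
    next
      case False
      have "mcoeff gl \<beta> = 0"
      proof (rule ccontr)
        assume "mcoeff gl \<beta> \<noteq> 0"
        from gl[OF this] False show False by simp
      qed
      then show ?thesis using False by (simp add: mcoeff_lift)
    qed
  qed
  have R_gl: "R gl = of_hol p"
    unfolding gl_p using restrict_to_lift_finite[OF p_fin \<rho>_0, of 0] by simp
  have R_gh: "small (s + 1) (R gh)"
    by (rule levG_ord(3)) (auto simp: vge_def gh_def mcoeff_keep split: if_splits)
  have ur: "small s (u + r)"
    by (rule small_add[OF smallI[OF u_ord(1,2)] r(1)])
  have s1: "s + 1 - s = 1" by simp
  note fo = levF_ord[OF f order_refl, unfolded s1]
  have near: "vz 1 (s - 1) (zw 1 (s - 1) v + 1) (map_on f v - mvar v)"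
    "vz (s - 1) 1 (zw (s - 1) 1 v + 1) (map_on f v - mvar v)" for v
    using fo by (cases v; simp add: vge_mbar)+
  have ord: "vz 1 (s - 1) (zw 1 (s - 1) v) (map_on f v)" "vz (s - 1) 1 (zw (s - 1) 1 v) (map_on f v)" for v
    using vge_add[OF vge_mono[OF near(1)[of v]] vge_mvar[of "zw 1 (s - 1)" v]]
      vge_add[OF vge_mono[OF near(2)[of v]] vge_mvar[of "zw (s - 1) 1" v]] by simp_all
  have "small (s + 1) (msubst (u + r) (map_on f) - msubst (u + r) mvar)"
  proof (rule smallI)
    show "vz 1 (s - 1) (s + 1) (msubst (u + r) (map_on f) - msubst (u + r) mvar)"
      by (rule vge_msubst_diff[of _ "zw 1 (s - 1)"]) (use near ord vge_mvar ur in \<open>auto simp: small_def\<close>)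
    show "vz (s - 1) 1 (s + 1) (msubst (u + r) (map_on f) - msubst (u + r) mvar)"
      by (rule vge_msubst_diff[of _ "zw (s - 1) 1"]) (use near ord vge_mvar ur in \<open>auto simp: small_def\<close>)
  qed
  then have "small (s + 1) (E f g r + (msubst (u + r) (map_on f) - msubst (u + r) mvar) - (\<rho> - u) - R gh)"
    unfolding E by (intro small_diff \<rho> R_gh) simp
  also have "E f g r + (msubst (u + r) (map_on f) - msubst (u + r) mvar) - (\<rho> - u) - R gh = of_hol p - r"
    by (simp add: E_def g_eq restrict_to_add R_gl)
  finally have pr: "small (s + 1) (of_hol p - r)" .
  have "bipart 0 s (of_hol p - r) = 0"
    by (rule mfps_eqI) (use pr s3 in \<open>force simp: mcoeff_bipart small_mcoeff\<close>)
  moreover have "bipart 0 s (of_hol p) = 0"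
    using s3 by (intro mfps_eqI) (auto simp: mcoeff_bipart mcoeff_of_hol)
  ultimately have "bipart 0 s r = 0" by (simp add: bipart_diff)
  then have r0: "bipart 0 s r = 0" "bipart s 0 r = 0"
    using r(3) by (metis mbar_0 mbar_mbar)+
  have small_r: "small (s + 1) r"
    unfolding small_mcoeff
  proof (intro allI impI)
    fix \<alpha> assume nz: "mcoeff r \<alpha> \<noteq> 0"
    define m n where "m = zdeg \<alpha>" and "n = bdeg \<alpha>"
    have ge: "s \<le> m + (s - 1) * n" "s \<le> (s - 1) * m + n"
      using r(1) nz by (auto simp: small_mcoeff m_def n_def)
    have ne: "\<not> (m = 1 \<and> n = 1)" "\<not> (m = 0 \<and> n = s)" "\<not> (m = s \<and> n = 0)"
      using nz r(2) r0 mcoeff_bipart[of _ _ r \<alpha>] unfolding m_def n_def by (metis mcoeff_0)+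
    show "s + 1 \<le> zdeg \<alpha> + (s - 1) * bdeg \<alpha> \<and> s + 1 \<le> (s - 1) * zdeg \<alpha> + bdeg \<alpha>"
      unfolding m_def[symmetric] n_def[symmetric]
    proof -
      consider "m = 0" | "n = 0" | "m \<ge> 1" "n \<ge> 1" by linarith
      then show "s + 1 \<le> m + (s - 1) * n \<and> s + 1 \<le> (s - 1) * m + n"
      proof cases
      case 1
      then have "s \<le> n" "n \<noteq> s" using ge(2) ne by simp_all
      then show ?thesis
        using s_mult(1)[of n] unfolding 1 mult_0_right by linarith
    next
      case 2
      then have "s \<le> m" "m \<noteq> s" using ge(1) ne by simp_all
      then show ?thesis
        using s_mult(1)[of m] unfolding 2 mult_0_right by linarith
    next
      case 3
      moreover have "m \<ge> 2 \<or> n \<ge> 2" using 3 ne by linarith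
      moreover have "(s - 1) * 1 \<le> (s - 1) * n" "(s - 1) * 1 \<le> (s - 1) * m"
        using \<open>m \<ge> 1\<close> \<open>n \<ge> 1\<close> by (intro mult_le_mono2; simp)+
      moreover have "n \<ge> 2 \<Longrightarrow> (s - 1) * 2 \<le> (s - 1) * n" "m \<ge> 2 \<Longrightarrow> (s - 1) * 2 \<le> (s - 1) * m"
        by (intro mult_le_mono2; simp)+
      ultimately show ?thesis
        using s3 by linarith
      qed
    qed
  qed
  then have "small (s + 1) (of_hol p)"
    using small_add[OF pr small_r] by simp
  have "p = 0"
  proof (rule mfps_eqI)
    fix \<gamma>
    show "mcoeff p \<gamma> = mcoeff 0 \<gamma>"
    proof (rule ccontr)
      assume "mcoeff p \<gamma> \<noteq> mcoeff 0 \<gamma>"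
      then have nz: "mcoeff p \<gamma> \<noteq> 0" by simp
      then have "odeg (oindex 0 \<gamma>) \<le> s" using gl[of "oindex 0 \<gamma>"] by (simp add: p_def)
      then have deg: "mdeg \<gamma> \<le> s" by (simp add: odeg_def mdeg_def)
      have "bdeg (case_sum \<gamma> (\<lambda>_. 0)) = 0" "zdeg (case_sum \<gamma> (\<lambda>_. 0)) = mdeg \<gamma>"
        by (simp_all add: bdeg_def zdeg_def mdeg_def)
      moreover have "mcoeff (of_hol p) (case_sum \<gamma> (\<lambda>_. 0)) \<noteq> 0"
        using nz by (simp add: mcoeff_of_hol bdeg_def comp_def)
      ultimately show False
        using \<open>small (s + 1) (of_hol p)\<close> deg unfolding small_mcoeff by fastforce
    qed
  qed
  then have "gl = 0" unfolding gl_p by (intro mfps_eqI) (simp add: mcoeff_lift)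
  then have "g = gh" using g_eq by simp
  moreover have "vge levG (s + 1) gh"
    by (auto simp: vge_def gh_def mcoeff_keep split: if_splits)
  ultimately show ?thesis using small_r by simp
qed

end


section \<open>Existence and uniqueness of the normal form\<close>

lemma mcoeff_formal_sum_single:
  assumes "\<And>i. i \<in> I \<Longrightarrow> mcoeff (f i) \<alpha> \<noteq> 0 \<Longrightarrow> i = i0"
  shows "mcoeff (formal_sum I f) \<alpha> = (if i0 \<in> I then mcoeff (f i0) \<alpha> else 0)"
proof -
  have "mcoeff (formal_sum I f) \<alpha> = (\<Sum>i\<in>{i. i \<in> I \<and> mcoeff (f i) \<alpha> \<noteq> 0}. mcoeff (f i) \<alpha>)"
    by (simp add: formal_sum_def)
  also have "{i. i \<in> I \<and> mcoeff (f i) \<alpha> \<noteq> 0} = (if i0 \<in> I \<and> mcoeff (f i0) \<alpha> \<noteq> 0 then {i0} else {})"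
    using assms by auto
  also have "(\<Sum>i\<in>(if i0 \<in> I \<and> mcoeff (f i0) \<alpha> \<noteq> 0 then {i0} else {}). mcoeff (f i) \<alpha>) =
      (if i0 \<in> I then mcoeff (f i0) \<alpha> else 0)"
    by simp
  finally show ?thesis .
qed

lemma mcoeff_formal_sum_bihomogeneous:
  assumes "\<And>m n. (m, n) \<in> I \<Longrightarrow> bihomogeneous m n (\<phi> m n)"
  shows "mcoeff (formal_sum I (\<lambda>(m, n). \<phi> m n)) \<alpha> =
    (if (zdeg \<alpha>, bdeg \<alpha>) \<in> I then mcoeff (\<phi> (zdeg \<alpha>) (bdeg \<alpha>)) \<alpha> else 0)"
proof -
  have "mcoeff (formal_sum I (\<lambda>(m, n). \<phi> m n)) \<alpha> =
    (if (zdeg \<alpha>, bdeg \<alpha>) \<in> I then mcoeff (case (zdeg \<alpha>, bdeg \<alpha>) of (m, n) \<Rightarrow> \<phi> m n) \<alpha> else 0)"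
  proof (rule mcoeff_formal_sum_single)
    fix i assume i: "i \<in> I" "mcoeff (case i of (m, n) \<Rightarrow> \<phi> m n) \<alpha> \<noteq> 0"
    obtain m n where mn: "i = (m, n)" by (cases i)
    then have "bihomogeneous m n (\<phi> m n)" "mcoeff (\<phi> m n) \<alpha> \<noteq> 0" using assms i by auto
    then show "i = (zdeg \<alpha>, bdeg \<alpha>)" by (simp add: bihomogeneous_iff mn)
  qed
  then show ?thesis by simp
qed

lemma mcoeff_formal_sum_of_hol:
  assumes "\<And>k. k \<in> I \<Longrightarrow> homogeneous k (\<psi> k)"
  shows "mcoeff (formal_sum I (\<lambda>k. of_hol (\<psi> k))) \<alpha> =
    (if bdeg \<alpha> = 0 \<and> zdeg \<alpha> \<in> I then mcoeff (of_hol (\<psi> (zdeg \<alpha>))) \<alpha> else 0)"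
proof -
  have "mcoeff (formal_sum I (\<lambda>k. of_hol (\<psi> k))) \<alpha> =
    (if zdeg \<alpha> \<in> I then mcoeff (of_hol (\<psi> (zdeg \<alpha>))) \<alpha> else 0)"
  proof (rule mcoeff_formal_sum_single)
    fix k assume k: "k \<in> I" "mcoeff (of_hol (\<psi> k)) \<alpha> \<noteq> 0"
    then have "bihomogeneous k 0 (of_hol (\<psi> k))" using assms by (simp add: bihomogeneous_of_hol_iff)
    then show "k = zdeg \<alpha>" using k by (simp add: bihomogeneous_iff)
  qed
  then show ?thesis by (auto simp: mcoeff_of_hol)
qed

lemma two_mRe:
  fixes h :: "('n::finite + 'n) mfps"
  shows "2 * mRe h = h + mbar h"
proof -
  have 2: "mconst 2 = (2 :: ('n + 'n) mfps)" using mconst_of_nat[of 2] by simp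
  have "2 * mRe h = mconst (2 * (1 / 2)) * (h + mbar h)"
    unfolding mRe_def mconst_mult 2 by (simp add: mult.assoc)
  then show ?thesis by simp
qed

lemma bipart_eqI: "(\<And>m n. bipart m n f = bipart m n g) \<Longrightarrow> f = g"
proof (rule mfps_eqI)
  fix \<alpha> :: "'a + 'a \<Rightarrow> nat"
  assume "\<And>m n. bipart m n f = bipart m n g"
  then have "mcoeff (bipart (zdeg \<alpha>) (bdeg \<alpha>) f) \<alpha> = mcoeff (bipart (zdeg \<alpha>) (bdeg \<alpha>) g) \<alpha>" by simp
  then show "mcoeff f \<alpha> = mcoeff g \<alpha>" by (simp add: mcoeff_bipart)
qed

definition normal_form_series :: "nat \<Rightarrow> (nat \<Rightarrow> nat \<Rightarrow> ('n::finite + 'n) mfps) \<Rightarrow> (nat \<Rightarrow> 'n mfps) \<Rightarrow> ('n + 'n) mfps" where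
  "normal_form_series s \<phi> \<psi> = quadric
     + formal_sum {(m, n). m + n \<ge> 3 \<and> m \<noteq> 0 \<and> n \<noteq> 0} (\<lambda>(m, n). \<phi> m n)
     + 2 * mRe (formal_sum {s..} (\<lambda>k. of_hol (\<psi> k)))"

lemma bipart_normal_form_series:
  fixes \<phi> :: "nat \<Rightarrow> nat \<Rightarrow> ('n::finite + 'n) mfps"
  assumes "\<And>m n. m + n \<ge> 3 \<Longrightarrow> m \<noteq> 0 \<Longrightarrow> n \<noteq> 0 \<Longrightarrow> bihomogeneous m n (\<phi> m n)"
    and "\<And>k. k \<ge> s \<Longrightarrow> homogeneous k (\<psi> k)" and "s \<ge> 1"
  shows "bipart m n (normal_form_series s \<phi> \<psi>) =
    (if m \<noteq> 0 \<and> n \<noteq> 0 then if m + n \<ge> 3 then \<phi> m n else quadric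
     else if n = 0 \<and> m \<ge> s then of_hol (\<psi> m) else if m = 0 \<and> n \<ge> s then mbar (of_hol (\<psi> n)) else 0)"
proof -
  let ?I = "{(m, n). m + n \<ge> 3 \<and> m \<noteq> 0 \<and> n \<noteq> (0 :: nat)}"
  let ?h = "formal_sum {s..} (\<lambda>k. of_hol (\<psi> k))"
  have Q: "bipart m n quadric = (if m = 1 \<and> n = 1 then quadric else (0 :: ('n + 'n) mfps))"
    using bipart_bihomogeneous[OF bihomogeneous_quadric, of m n] by simp
  have F: "bipart m n (formal_sum ?I (\<lambda>(m, n). \<phi> m n)) = (if (m, n) \<in> ?I then \<phi> m n else 0)"
  proof (rule mfps_eqI)
    fix \<alpha>
    have "mcoeff (formal_sum ?I (\<lambda>(m, n). \<phi> m n)) \<alpha> =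
        (if (zdeg \<alpha>, bdeg \<alpha>) \<in> ?I then mcoeff (\<phi> (zdeg \<alpha>) (bdeg \<alpha>)) \<alpha> else 0)"
      by (rule mcoeff_formal_sum_bihomogeneous) (use assms(1) in auto)
    moreover have "mcoeff (\<phi> m n) \<alpha> = 0" if "(m, n) \<in> ?I" "\<not> (zdeg \<alpha> = m \<and> bdeg \<alpha> = n)"
      using assms(1)[of m n] that by (auto simp: bihomogeneous_iff)
    ultimately show "mcoeff (bipart m n (formal_sum ?I (\<lambda>(m, n). \<phi> m n))) \<alpha> =
        mcoeff (if (m, n) \<in> ?I then \<phi> m n else 0) \<alpha>"
      by (cases "zdeg \<alpha> = m \<and> bdeg \<alpha> = n"; cases "(m, n) \<in> ?I") (simp_all only: mcoeff_bipart if_True if_False mcoeff_0 simp_thms)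
  qed
  have h: "bipart m n ?h = (if n = 0 \<and> m \<ge> s then of_hol (\<psi> m) else 0)" for m n
  proof (rule mfps_eqI)
    fix \<alpha>
    have 1: "mcoeff ?h \<alpha> = (if bdeg \<alpha> = 0 \<and> zdeg \<alpha> \<in> {s..} then mcoeff (of_hol (\<psi> (zdeg \<alpha>))) \<alpha> else 0)"
      by (rule mcoeff_formal_sum_of_hol) (use assms(2) in auto)
    have 2: "mcoeff (of_hol (\<psi> m)) \<alpha> = 0" if "m \<ge> s" "\<not> (zdeg \<alpha> = m \<and> bdeg \<alpha> = 0)"
      using assms(2)[OF that(1)] that(2) unfolding bihomogeneous_of_hol_iff[symmetric] by (auto simp: bihomogeneous_iff)
    show "mcoeff (bipart m n ?h) \<alpha> = mcoeff (if n = 0 \<and> m \<ge> s then of_hol (\<psi> m) else 0) \<alpha>"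
    proof (cases "zdeg \<alpha> = m \<and> bdeg \<alpha> = n")
      case True
      then show ?thesis unfolding mcoeff_bipart 1 by auto
    next
      case False
      then have "mcoeff (if n = 0 \<and> m \<ge> s then of_hol (\<psi> m) else 0) \<alpha> = 0" using 2 by auto
      then show ?thesis unfolding mcoeff_bipart if_not_P[OF False] by simp
    qed
  qed
  have hb: "bipart m n (mbar ?h) = (if m = 0 \<and> n \<ge> s then mbar (of_hol (\<psi> n)) else 0)"
    unfolding mbar_bipart[symmetric] h by simp
  have "m \<noteq> 0 \<Longrightarrow> n \<noteq> 0 \<Longrightarrow> \<not> m + n \<ge> 3 \<Longrightarrow> m = 1 \<and> n = 1" by linarith
  then show ?thesis
    unfolding normal_form_series_def two_mRe bipart_add Q F h hb using assms(3) by auto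
qed

definition onor :: "('n::finite option \<Rightarrow> nat) \<Rightarrow> nat" where
  "onor \<alpha> = odeg \<alpha> + 2 * \<alpha> None"

lemma formal_sum_nor_part:
  "mcoeff (formal_sum {2..} (\<lambda>k. nor_part (k + e) h)) \<alpha> = (if onor \<alpha> \<ge> 2 + e then mcoeff h \<alpha> else 0)"
proof -
  have nor: "mcoeff (nor_part l h) \<alpha> = (if onor \<alpha> = l then mcoeff h \<alpha> else 0)" for l
    by (simp add: nor_part_def onor_def odeg_def)
  have "mcoeff (formal_sum {2..} (\<lambda>k. nor_part (k + e) h)) \<alpha> =
      (if onor \<alpha> - e \<in> {2..} then mcoeff (nor_part (onor \<alpha> - e + e) h) \<alpha> else 0)"
    by (rule mcoeff_formal_sum_single) (auto simp: nor split: if_splits)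
  then show ?thesis by (auto simp: nor)
qed

lemma onor_mvar: "mcoeff (mvar v) \<alpha> \<noteq> 0 \<Longrightarrow> onor \<alpha> = (case v of None \<Rightarrow> 2 | Some k \<Rightarrow> 1)"
proof -
  assume "mcoeff (mvar v) \<alpha> \<noteq> 0"
  then have \<alpha>: "\<alpha> = 0(v := 1)" by (simp add: mcoeff_mvar split: if_splits)
  have "onor \<alpha> = wt (case_option 2 (\<lambda>_. 1)) \<alpha>" by (simp add: onor_def wt_option)
  then show ?thesis unfolding \<alpha> wt_single by (simp split: option.splits)
qed

lemma id_plus_O2_iff:
  "id_plus_O2 F G \<longleftrightarrow> (\<forall>j. vge onor 2 (F j - mvar (Some j))) \<and> vge onor 3 (G - mvar None)"
proof -
  have *: "h = mvar v + formal_sum {2..} (\<lambda>k. nor_part (k + e) h) \<longleftrightarrow> vge onor (2 + e) (h - mvar v)"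
    if v: "(case v of None \<Rightarrow> 2 | Some k \<Rightarrow> 1) < 2 + e" for v :: "'a option" and h e
  proof -
    have iff: "mcoeff h \<alpha> = mcoeff (mvar v + formal_sum {2..} (\<lambda>k. nor_part (k + e) h)) \<alpha> \<longleftrightarrow>
        (mcoeff (h - mvar v) \<alpha> \<noteq> 0 \<longrightarrow> 2 + e \<le> onor \<alpha>)" for \<alpha>
    proof (cases "2 + e \<le> onor \<alpha>")
      case True
      then have "mcoeff (mvar v) \<alpha> = 0" using onor_mvar[of v \<alpha>] v by fastforce
      then show ?thesis using True by (simp add: formal_sum_nor_part)
    next
      case False
      then show ?thesis by (simp add: formal_sum_nor_part)
    qed
    show ?thesis
      unfolding vge_def using iff by (metis mfps_eqI)
  qed
  have F: "F j = mvar (Some j) + formal_sum {2..} (\<lambda>k. nor_part k (F j)) \<longleftrightarrow> vge onor 2 (F j - mvar (Some j))" for j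
    using *[of "Some j" 0 "F j"] by simp
  have G: "G = mvar None + formal_sum {2..} (\<lambda>k. nor_part (k + 1) G) \<longleftrightarrow> vge onor 3 (G - mvar None)"
    using *[of None 1 G] by simp
  show ?thesis unfolding id_plus_O2_def F G by simp
qed

lemma id_plus_O2_imp_formal_map: "id_plus_O2 F G \<Longrightarrow> formal_map F G"
proof -
  assume *: "id_plus_O2 F G"
  have "onor (0 :: 'a option \<Rightarrow> nat) = 0" by (simp add: onor_def odeg_def)
  then have "mcoeff (F j - mvar (Some j)) 0 = 0" "mcoeff (G - mvar None) 0 = 0" for j
    using * unfolding id_plus_O2_iff vge_def by fastforce+
  then show ?thesis by (simp add: formal_map_def)
qed

context normalization
begin

text \<open>
  For the components of \<open>F\<close>, being the identity up to terms of normal weight 2 is the same as having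
  increments of level at least \<open>s + 1\<close>. For \<open>G\<close> only one implication holds in general, and the other
  one relies on the equation through \<open>low_levels\<close>.
\<close>

lemma levF_iff: "vge levF (s + 1) h \<longleftrightarrow> vge onor 2 h"
proof -
  have "s + 1 \<le> levF \<beta> \<longleftrightarrow> 2 \<le> onor \<beta>" for \<beta> :: "'n option \<Rightarrow> nat"
  proof (cases "\<beta> None")
    case 0
    then show ?thesis using s3 by (auto simp: levF_def onor_def)
  next
    case (Suc l)
    then show ?thesis using s3 by (auto simp: levF_def onor_def)
  qed
  then show ?thesis by (simp add: vge_def)
qed

lemma levG_imp: "vge levG (s + 1) h \<Longrightarrow> vge onor 3 h"
proof -
  have "3 \<le> onor \<beta>" if "s + 1 \<le> levG \<beta>" for \<beta> :: "'n option \<Rightarrow> nat"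
  proof (cases "\<beta> None")
    case 0
    then show ?thesis using that s3 by (simp add: levG_def onor_def)
  next
    case (Suc l)
    then show ?thesis using that s3 by (cases l) (auto simp: levG_def onor_def)
  qed
  then show "vge levG (s + 1) h \<Longrightarrow> vge onor 3 h" by (auto simp: vge_def)
qed

definition nf_conditions :: "(nat \<Rightarrow> nat \<Rightarrow> ('n + 'n) mfps) \<Rightarrow> (nat \<Rightarrow> 'n mfps) \<Rightarrow> bool" where
  "nf_conditions \<phi>' \<psi>' \<longleftrightarrow>
    (\<forall>m n. m + n \<ge> 3 \<and> m \<noteq> 0 \<and> n \<noteq> 0 \<longrightarrow> bihomogeneous m n (\<phi>' m n)) \<and>
    (\<forall>k\<ge>s. homogeneous k (\<psi>' k)) \<and>
    (\<forall>m n. m + n \<ge> 3 \<and> m \<noteq> 0 \<and> n \<noteq> 0 \<longrightarrow>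
      (m \<le> n - 1 \<longrightarrow> (trace_op ^^ (m - 1)) (\<phi>' m n) = 0) \<and>
      (m \<ge> n \<longrightarrow> (trace_op ^^ n) (\<phi>' m n) = 0)) \<and>
    (\<forall>t\<ge>1. fischer (\<Delta> ^ t) (\<psi>' (t * s + 1)) = 0) \<and>
    (\<forall>t\<ge>1. \<forall>k. fischer (mderiv k \<Delta> * \<Delta> ^ t) (\<psi>' ((t + 1) * s)) = 0)"

lemma bipart_u: "bipart m n u = (if m = 1 \<and> n = 1 then Q else 0) + (if m = s \<and> n = 0 then D else 0) +
    (if m = 0 \<and> n = s then Db else 0)"
  unfolding u_def bipart_add using bipart_bihomogeneous[OF Q, of m n] bipart_bihomogeneous[OF D, of m n]
    bipart_bihomogeneous[OF Db, of m n] by simp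

lemma solution_imp_nf:
  assumes "solution f g r"
  shows "\<exists>\<phi>' \<psi>'. nf_conditions \<phi>' \<psi>' \<and>
    transforms (\<lambda>k. mvar (Some k) + f k) (mvar None + g) \<rho> (normal_form_series s \<phi>' \<psi>')"
proof -
  have r: "small (s + 1) r" "trace_normal r" "pure_real r" "\<And>k. fischer_normal k (to_hol (bipart k 0 r))" and E: "E f g r = 0"
    using assms by (auto simp: solution_def full_normal_def)
  define \<phi>' where "\<phi>' m n = bipart m n r" for m n
  define \<psi>' where "\<psi>' k = to_hol (bipart k 0 (u + r))" for k
  have \<phi>': "bihomogeneous m n (\<phi>' m n)" for m n
    by (simp add: \<phi>'_def bihomogeneous_bipart)
  have \<psi>'_hom: "homogeneous k (\<psi>' k)" for k
    unfolding \<psi>'_def by (rule homogeneous_to_hol[OF bihomogeneous_bipart])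
  have \<psi>'_of_hol: "of_hol (\<psi>' k) = bipart k 0 (u + r)" for k
    unfolding \<psi>'_def by (rule of_hol_to_hol[OF bihomogeneous_bipart])
  have \<psi>'_eq: "\<psi>' k = to_hol (bipart k 0 r)" if "k \<ge> s + 1" for k
    using that by (simp add: \<psi>'_def bipart_add bipart_u)
  have low: "bipart m n r = 0" if "m + (s - 1) * n < s + 1 \<or> (s - 1) * m + n < s + 1" for m n
    by (rule mfps_eqI) (use r(1) that in \<open>force simp: mcoeff_bipart small_mcoeff\<close>)
  have "normal_form_series s \<phi>' \<psi>' = u + r"
  proof (rule bipart_eqI)
    fix m n
    have r11: "m = 1 \<Longrightarrow> n = 1 \<Longrightarrow> bipart m n r = 0"
      using low[of m n] s3 by simp
    have pure: "bipart 0 n (u + r) = mbar (bipart n 0 (u + r))"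
      using r(3) s3 by (auto simp: bipart_add bipart_u pure_real_def)
    have small0: "m < s \<Longrightarrow> bipart m 0 (u + r) = 0" "n < s \<Longrightarrow> bipart 0 n (u + r) = 0"
      using low[of m 0] low[of 0 n] s3 by (auto simp: bipart_add bipart_u)
    have "bipart m n (normal_form_series s \<phi>' \<psi>') =
      (if m \<noteq> 0 \<and> n \<noteq> 0 then if m + n \<ge> 3 then \<phi>' m n else quadric
       else if n = 0 \<and> m \<ge> s then of_hol (\<psi>' m) else if m = 0 \<and> n \<ge> s then mbar (of_hol (\<psi>' n)) else 0)"
      by (rule bipart_normal_form_series) (use \<phi>' \<psi>'_hom s3 in auto)
    also have "\<dots> = bipart m n (u + r)"
    proof -
      consider "m \<noteq> 0" "n \<noteq> 0" "m + n \<ge> 3" | "m = 1" "n = 1" | "n = 0" | "m = 0" "n \<noteq> 0" by linarith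
      then show ?thesis
      proof cases
        case 1 then show ?thesis by (auto simp: \<phi>'_def bipart_add bipart_u)
      next
        case 2 then show ?thesis using r11 by (simp add: bipart_add bipart_u)
      next
        case 3 then show ?thesis using small0(1) small0(2) s3 by (auto simp: \<psi>'_of_hol)
      next
        case 4 then show ?thesis using small0(2) pure by (auto simp: \<psi>'_of_hol)
      qed
    qed
    finally show "bipart m n (normal_form_series s \<phi>' \<psi>') = bipart m n (u + r)" .
  qed
  then have "transforms (\<lambda>k. mvar (Some k) + f k) (mvar None + g) \<rho> (normal_form_series s \<phi>' \<psi>')"
    using E transforms_iff_E by simp
  moreover have "nf_conditions \<phi>' \<psi>'"
    unfolding nf_conditions_def
  proof (intro conjI allI impI)
    fix m n :: nat assume "m + n \<ge> 3 \<and> m \<noteq> 0 \<and> n \<noteq> 0"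
    then show "bihomogeneous m n (\<phi>' m n)" by (simp add: \<phi>')
  next
    fix k show "homogeneous k (\<psi>' k)" by (rule \<psi>'_hom)
  next
    fix m n :: nat assume "m + n \<ge> 3 \<and> m \<noteq> 0 \<and> n \<noteq> 0" "m \<le> n - 1"
    then show "(trace_op ^^ (m - 1)) (\<phi>' m n) = 0"
      using r(2) by (auto simp: trace_normal_def \<phi>'_def)
  next
    fix m n :: nat assume "m + n \<ge> 3 \<and> m \<noteq> 0 \<and> n \<noteq> 0" "n \<le> m"
    then show "(trace_op ^^ n) (\<phi>' m n) = 0"
      using r(2) by (auto simp: trace_normal_def \<phi>'_def)
  next
    fix t :: nat assume t: "t \<ge> 1"
    then have "s + 1 \<le> t * s + 1" by simp
    show "fischer (\<Delta> ^ t) (\<psi>' (t * s + 1)) = 0"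
      unfolding \<psi>'_eq[OF \<open>s + 1 \<le> t * s + 1\<close>] using r(4)[of "t * s + 1"] t unfolding fischer_normal_def by blast
  next
    fix t :: nat and k assume t: "t \<ge> 1"
    have "1 * s \<le> t * s" using t by (rule mult_le_mono1)
    then have "s + 1 \<le> (t + 1) * s" using s3 by simp
    show "fischer (mderiv k \<Delta> * \<Delta> ^ t) (\<psi>' ((t + 1) * s)) = 0"
      unfolding \<psi>'_eq[OF \<open>s + 1 \<le> (t + 1) * s\<close>] using r(4)[of "(t + 1) * s"] t unfolding fischer_normal_def by blast
  qed
  ultimately show ?thesis by blast
qed

text \<open>
  The pure part of degree \<open>s\<close> of the normal form is not prescribed by the conditions; that it is \<open>D\<close>,
  so that \<open>r\<close> has level \<open>s + 1\<close>, follows from the equation.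
\<close>

lemma nf_imp_solution:
  assumes F: "\<And>k. vge onor 2 (f k)" and G: "vge onor 3 g" and nf: "nf_conditions \<phi>' \<psi>'"
    and tr: "transforms (\<lambda>k. mvar (Some k) + f k) (mvar None + g) \<rho> (normal_form_series s \<phi>' \<psi>')"
  shows "\<exists>r. solution f g r"
proof -
  define r where "r = normal_form_series s \<phi>' \<psi>' - u"
  have \<phi>': "bihomogeneous m n (\<phi>' m n)" if "m + n \<ge> 3" "m \<noteq> 0" "n \<noteq> 0" for m n
    using nf that unfolding nf_conditions_def by blast
  have \<psi>': "homogeneous k (\<psi>' k)" if "k \<ge> s" for k
    using nf that unfolding nf_conditions_def by blast
  have E: "E f g r = 0"
    using tr transforms_iff_E[of f g r] by (simp add: r_def)
  have parts: "bipart m n r = (if m \<noteq> 0 \<and> n \<noteq> 0 then if m + n \<ge> 3 then \<phi>' m n else quadric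
       else if n = 0 \<and> m \<ge> s then of_hol (\<psi>' m) else if m = 0 \<and> n \<ge> s then mbar (of_hol (\<psi>' n)) else 0) -
      bipart m n u" for m n
    unfolding r_def bipart_diff using bipart_normal_form_series[where \<phi> = \<phi>' and \<psi> = \<psi>' and s = s and m = m and n = n, OF \<phi>' \<psi>'] s3 by simp
  have part_mixed: "bipart m n r = (if m + n \<ge> 3 then \<phi>' m n else 0)" if "m \<noteq> 0" "n \<noteq> 0" for m n
  proof -
    have "\<not> 3 \<le> m + n \<Longrightarrow> m = 1 \<and> n = 1" using that by linarith
    then show ?thesis using that unfolding parts bipart_u by auto
  qed
  have part_hol: "bipart m 0 r = (if m > s then of_hol (\<psi>' m) else if m = s then of_hol (\<psi>' s) - D else 0)" for m
    unfolding parts bipart_u using s3 by auto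
  have real: "bipart 0 n r = mbar (bipart n 0 r)" for n
    unfolding parts bipart_u using s3 by auto
  have "small s r"
    unfolding small_mcoeff
  proof (intro allI impI)
    fix \<alpha> assume nz: "mcoeff r \<alpha> \<noteq> 0"
    define m n where "m = zdeg \<alpha>" and "n = bdeg \<alpha>"
    have "mcoeff (bipart m n r) \<alpha> \<noteq> 0" using nz by (simp add: mcoeff_bipart m_def n_def)
    then have ne: "bipart m n r \<noteq> 0" by auto
    show "s \<le> zdeg \<alpha> + (s - 1) * bdeg \<alpha> \<and> s \<le> (s - 1) * zdeg \<alpha> + bdeg \<alpha>"
      unfolding m_def[symmetric] n_def[symmetric]
    proof -
      consider "n = 0" | "m = 0" | "m \<ge> 1" "n \<ge> 1" by linarith
      then show "s \<le> m + (s - 1) * n \<and> s \<le> (s - 1) * m + n"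
      proof cases
        case 1
        then have "s \<le> m" using ne part_hol[of m] by (auto split: if_splits)
        then show ?thesis using s_mult(1)[of m] unfolding 1 mult_0_right by linarith
      next
        case 2
        then have "bipart n 0 r \<noteq> 0" using ne real[of n] by auto
        then have "s \<le> n" using part_hol[of n] by (auto split: if_splits)
        then show ?thesis using s_mult(1)[of n] unfolding 2 mult_0_right by linarith
      next
        case 3
        have "(s - 1) * 1 \<le> (s - 1) * n" "(s - 1) * 1 \<le> (s - 1) * m"
          using 3 by (intro mult_le_mono2; simp)+
        then show ?thesis using 3 s3 by linarith
      qed
    qed
  qed
  moreover have "bipart 1 1 r = 0" using part_mixed[of 1 1] by simp
  moreover have f_lev: "vge levF (s + 1) (f k)" for k using F[of k] by (simp only: levF_iff)
  moreover have "3 \<le> odeg \<beta> + 2 * \<beta> None" if "mcoeff g \<beta> \<noteq> 0" for \<beta>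
    using G that by (simp add: vge_def onor_def)
  ultimately have low: "vge levG (s + 1) g" "small (s + 1) r"
    using low_levels[of f g r] real E by blast+
  have "trace_normal r"
    unfolding trace_normal_def
  proof (intro allI impI)
    fix m n :: nat assume mn: "m \<noteq> 0" "n \<noteq> 0"
    show "(m < n \<longrightarrow> (trace_op ^^ (m - 1)) (bipart m n r) = 0) \<and> (n \<le> m \<longrightarrow> (trace_op ^^ n) (bipart m n r) = 0)"
    proof (cases "m + n \<ge> 3")
      case True
      then have "(m \<le> n - 1 \<longrightarrow> (trace_op ^^ (m - 1)) (\<phi>' m n) = 0) \<and> (n \<le> m \<longrightarrow> (trace_op ^^ n) (\<phi>' m n) = 0)"
        using nf mn unfolding nf_conditions_def by blast
      then show ?thesis using True mn by (auto simp: part_mixed)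
    qed (simp add: part_mixed mn)
  qed
  moreover have "pure_real r" using real by (simp add: pure_real_def)
  moreover have "fischer_normal k (to_hol (bipart k 0 r))" for k
  proof (cases "k > s")
    case True
    then have "to_hol (bipart k 0 r) = \<psi>' k" by (simp add: part_hol)
    then show ?thesis using nf unfolding nf_conditions_def fischer_normal_def by auto
  next
    case False
    have "k \<noteq> t * s + 1" "k \<noteq> (t + 1) * s" if "t \<ge> 1" for t
    proof -
      have "1 * s \<le> t * s" using that by (rule mult_le_mono1)
      then show "k \<noteq> t * s + 1" "k \<noteq> (t + 1) * s"
        using False s3 unfolding mult_1 add_mult_distrib by linarith+
    qed
    then show ?thesis unfolding fischer_normal_def by blast
  qed
  ultimately have "solution f g r"
    unfolding solution_def full_normal_def using low f_lev E by blast
  then show ?thesis by blast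
qed

lemma normal_form_exists_unique:
  "\<exists>!(F, G). formal_map F G \<and> id_plus_O2 F G \<and>
    (\<exists>\<phi>' \<psi>'. nf_conditions \<phi>' \<psi>' \<and> transforms F G \<rho> (normal_form_series s \<phi>' \<psi>'))"
proof -
  obtain f g r where sol: "solution f g r" using solution_exists by blast
  define F0 where "F0 k = mvar (Some k) + f k" for k
  define G0 where "G0 = mvar None + g"
  have id: "id_plus_O2 F0 G0"
    using sol levG_imp unfolding id_plus_O2_iff solution_def levF_iff by (simp add: F0_def G0_def)
  have nf: "\<exists>\<phi>' \<psi>'. nf_conditions \<phi>' \<psi>' \<and> transforms F0 G0 \<rho> (normal_form_series s \<phi>' \<psi>')"
    using solution_imp_nf[OF sol] by (simp add: F0_def[abs_def] G0_def)
  show ?thesis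
  proof (rule ex1I[of _ "(F0, G0)"])
    show "case (F0, G0) of (F, G) \<Rightarrow> formal_map F G \<and> id_plus_O2 F G \<and>
        (\<exists>\<phi>' \<psi>'. nf_conditions \<phi>' \<psi>' \<and> transforms F G \<rho> (normal_form_series s \<phi>' \<psi>'))"
      using id nf id_plus_O2_imp_formal_map[OF id] by simp
  next
    fix x :: "('n \<Rightarrow> 'n option mfps) \<times> 'n option mfps"
    assume x: "case x of (F, G) \<Rightarrow> formal_map F G \<and> id_plus_O2 F G \<and>
        (\<exists>\<phi>' \<psi>'. nf_conditions \<phi>' \<psi>' \<and> transforms F G \<rho> (normal_form_series s \<phi>' \<psi>'))"
    obtain F G where FG: "x = (F, G)" by (cases x)
    obtain \<phi>' \<psi>' where 1: "id_plus_O2 F G" "nf_conditions \<phi>' \<psi>'" "transforms F G \<rho> (normal_form_series s \<phi>' \<psi>')"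
      using x unfolding FG by auto
    define f1 where "f1 k = F k - mvar (Some k)" for k
    define g1 where "g1 = G - mvar None"
    have eq: "F = (\<lambda>k. mvar (Some k) + f1 k)" "G = mvar None + g1"
      by (auto simp: f1_def g1_def fun_eq_iff)
    have "vge onor 2 (f1 k)" "vge onor 3 g1" for k
      using 1(1) unfolding id_plus_O2_iff f1_def g1_def by blast+
    then obtain r1 where "solution f1 g1 r1"
      using nf_imp_solution[OF _ _ 1(2) 1(3)[unfolded eq]] by blast
    then have "f1 = f \<and> g1 = g" using solution_unique sol by blast
    then show "x = (F0, G0)" by (simp add: FG eq F0_def[abs_def] G0_def)
  qed
qed

end

theorem theorem1p3:
  fixes \<phi> :: "nat \<Rightarrow> nat \<Rightarrow> ('n::finite + 'n) mfps"
    and \<rho> :: "('n + 'n) mfps"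
    and s :: nat
    and \<Delta> :: "'n mfps"
  assumes bihom: "\<And>m n. m + n \<ge> 3 \<Longrightarrow> bihomogeneous m n (\<phi> m n)"
    and M: "\<rho> = quadric + formal_sum {(m, n). m + n \<ge> 3} (\<lambda>(m, n). \<phi> m n)"
    and pure_terms_real: "\<And>k. k \<ge> 3 \<Longrightarrow> \<phi> 0 k = mbar (\<phi> k 0)"
    and pure_terms_nonzero: "mRe (formal_sum {3..} (\<lambda>k. \<phi> k 0)) \<noteq> 0"
    and s: "s = (LEAST k. k \<ge> 3 \<and> \<phi> k 0 \<noteq> 0)"
    and \<Delta>: "\<Delta> = to_hol (\<phi> s 0)"
    and nondeg: "nondegenerate \<Delta>"
  shows "\<exists>!(F, G). formal_map F G \<and> id_plus_O2 F G \<and>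
    (\<exists>(\<phi>' :: nat \<Rightarrow> nat \<Rightarrow> ('n + 'n) mfps) (\<psi>' :: nat \<Rightarrow> 'n mfps).
      (\<forall>m n. m + n \<ge> 3 \<and> m \<noteq> 0 \<and> n \<noteq> 0 \<longrightarrow> bihomogeneous m n (\<phi>' m n)) \<and>
      (\<forall>k\<ge>s. homogeneous k (\<psi>' k)) \<and>
      transforms F G \<rho>
        (quadric
          + formal_sum {(m, n). m + n \<ge> 3 \<and> m \<noteq> 0 \<and> n \<noteq> 0} (\<lambda>(m, n). \<phi>' m n)
          + 2 * mRe (formal_sum {s..} (\<lambda>k. of_hol (\<psi>' k)))) \<and>
      (\<forall>m n. m + n \<ge> 3 \<and> m \<noteq> 0 \<and> n \<noteq> 0 \<longrightarrow>
        (m \<le> n - 1 \<longrightarrow> (trace_op ^^ (m - 1)) (\<phi>' m n) = 0) \<and>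
        (m \<ge> n \<longrightarrow> (trace_op ^^ n) (\<phi>' m n) = 0)) \<and>
      (\<forall>t\<ge>1. fischer (\<Delta> ^ t) (\<psi>' (t * s + 1)) = 0) \<and>
      (\<forall>t\<ge>1. \<forall>k. fischer (mderiv k \<Delta> * \<Delta> ^ t) (\<psi>' ((t + 1) * s)) = 0))"
proof -
  have "\<exists>k\<ge>3. \<phi> k 0 \<noteq> 0"
  proof (rule ccontr)
    assume "\<not> ?thesis"
    then have "formal_sum {3..} (\<lambda>k. \<phi> k 0) = 0"
      by (intro mfps_eqI) (simp add: formal_sum_def)
    then show False using pure_terms_nonzero by (simp add: mRe_def)
  qed
  then have s3: "s \<ge> 3" and below: "\<And>k. k \<ge> 3 \<Longrightarrow> k < s \<Longrightarrow> \<phi> k 0 = 0"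
    using LeastI_ex[of "\<lambda>k. k \<ge> 3 \<and> \<phi> k 0 \<noteq> 0"] not_less_Least[of _ "\<lambda>k. k \<ge> 3 \<and> \<phi> k 0 \<noteq> 0"]
    unfolding s by blast+
  have D: "bihomogeneous s 0 (\<phi> s 0)" by (rule bihom) (use s3 in simp)
  interpret nondegenerate_model "\<phi> s 0" s
    using D s3 nondeg \<Delta> by unfold_locales simp_all
  have coeff: "mcoeff \<rho> \<alpha> = mcoeff Q \<alpha> + (if zdeg \<alpha> + bdeg \<alpha> \<ge> 3 then mcoeff (\<phi> (zdeg \<alpha>) (bdeg \<alpha>)) \<alpha> else 0)" for \<alpha>
    unfolding M using mcoeff_formal_sum_bihomogeneous[of "{(m, n). m + n \<ge> 3}" \<phi> \<alpha>] bihom by simp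
  have small_\<rho>: "small (s + 1) (\<rho> - u)"
    unfolding small_mcoeff
  proof (intro allI impI)
    fix \<alpha> assume nz: "mcoeff (\<rho> - u) \<alpha> \<noteq> 0"
    define m n where "m = zdeg \<alpha>" and "n = bdeg \<alpha>"
    have deg: "\<not> (m = s \<and> n = 0)" "\<not> (m = 0 \<and> n = s)" "m + n \<ge> 3" "\<phi> m n \<noteq> 0"
    proof -
      have D0: "mcoeff (\<phi> s 0) \<alpha> = 0" if "\<not> (m = s \<and> n = 0)"
        using D that unfolding bihomogeneous_iff m_def n_def by blast
      have Db0: "mcoeff Db \<alpha> = 0" if "\<not> (m = 0 \<and> n = s)"
        using Db that unfolding bihomogeneous_iff m_def n_def by blast
      have c: "(if m + n \<ge> 3 then mcoeff (\<phi> m n) \<alpha> else 0) - mcoeff (\<phi> s 0) \<alpha> - mcoeff Db \<alpha> \<noteq> 0"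
      proof -
        have eq: "(q + c) - (q + d + e) = c - d - e" for q c d e :: complex by simp
        show ?thesis
          using nz unfolding mcoeff_diff u_def mcoeff_add coeff eq m_def n_def .
      qed
      show 1: "\<not> (m = s \<and> n = 0)"
      proof
        assume "m = s \<and> n = 0"
        then show False using c Db0 s3 by simp
      qed
      show 2: "\<not> (m = 0 \<and> n = s)"
      proof
        assume "m = 0 \<and> n = s"
        then show False using c D0 s3 pure_terms_real[of s] by simp
      qed
      show "m + n \<ge> 3" "\<phi> m n \<noteq> 0"
        using c D0[OF 1] Db0[OF 2] by (auto split: if_splits)
    qed
    show "s + 1 \<le> zdeg \<alpha> + (s - 1) * bdeg \<alpha> \<and> s + 1 \<le> (s - 1) * zdeg \<alpha> + bdeg \<alpha>"
      unfolding m_def[symmetric] n_def[symmetric]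
    proof -
      consider "n = 0" | "m = 0" | "m \<ge> 1" "n \<ge> 1" by linarith
      then show "s + 1 \<le> m + (s - 1) * n \<and> s + 1 \<le> (s - 1) * m + n"
      proof cases
        case 1
        then have "s + 1 \<le> m" using deg below[of m] by (cases "m < s") auto
        then show ?thesis using s_mult(1)[of m] unfolding 1 mult_0_right by linarith
      next
        case 2
        have "s + 1 \<le> n"
        proof (rule ccontr)
          assume "\<not> ?thesis"
          then have "n < s" "n \<ge> 3" using deg 2 by auto
          then have "\<phi> 0 n = 0" using below[of n] pure_terms_real[of n] by simp
          then show False using deg 2 by simp
        qed
        then show ?thesis using s_mult(1)[of n] unfolding 2 mult_0_right by linarith
      next
        case 3
        then have "m \<ge> 2 \<or> n \<ge> 2" using deg(3) by linarith
        moreover have "(s - 1) * 1 \<le> (s - 1) * n" "(s - 1) * 1 \<le> (s - 1) * m"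
          using 3 by (intro mult_le_mono2; simp)+
        moreover have "n \<ge> 2 \<Longrightarrow> (s - 1) * 2 \<le> (s - 1) * n" "m \<ge> 2 \<Longrightarrow> (s - 1) * 2 \<le> (s - 1) * m"
          by (intro mult_le_mono2; simp)+
        ultimately show ?thesis using 3 s3 by linarith
      qed
    qed
  qed
  interpret normalization "\<phi> s 0" s \<rho>
    using small_\<rho> by unfold_locales
  have reorder: "((a \<and> b \<and> c \<and> d \<and> e) \<and> h) = (a \<and> b \<and> h \<and> c \<and> d \<and> e)" for a b c d e h
    by blast
  have eq: "nf_conditions \<phi>' \<psi>' \<and> transforms F G \<rho> (normal_form_series s \<phi>' \<psi>') \<longleftrightarrow>
      (\<forall>m n. m + n \<ge> 3 \<and> m \<noteq> 0 \<and> n \<noteq> 0 \<longrightarrow> bihomogeneous m n (\<phi>' m n)) \<and>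
      (\<forall>k\<ge>s. homogeneous k (\<psi>' k)) \<and>
      transforms F G \<rho>
        (quadric
          + formal_sum {(m, n). m + n \<ge> 3 \<and> m \<noteq> 0 \<and> n \<noteq> 0} (\<lambda>(m, n). \<phi>' m n)
          + 2 * mRe (formal_sum {s..} (\<lambda>k. of_hol (\<psi>' k)))) \<and>
      (\<forall>m n. m + n \<ge> 3 \<and> m \<noteq> 0 \<and> n \<noteq> 0 \<longrightarrow>
        (m \<le> n - 1 \<longrightarrow> (trace_op ^^ (m - 1)) (\<phi>' m n) = 0) \<and>
        (m \<ge> n \<longrightarrow> (trace_op ^^ n) (\<phi>' m n) = 0)) \<and>
      (\<forall>t\<ge>1. fischer (\<Delta> ^ t) (\<psi>' (t * s + 1)) = 0) \<and>
      (\<forall>t\<ge>1. \<forall>k. fischer (mderiv k \<Delta> * \<Delta> ^ t) (\<psi>' ((t + 1) * s)) = 0)" for F G \<phi>' \<psi>'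
    unfolding nf_conditions_def normal_form_series_def \<Delta> \<Delta>_def by (rule reorder)
  show ?thesis
    using normal_form_exists_unique unfolding eq .
qed

end
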